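(* Let $n\ge 1$ and let $0<\epsilon\le 1/2$ and $k\ge 0$ be real numbers. Let $\mathcal{P}$ be a two-party quantum communication protocol for the set membership problem $\mathsf{SetMemb}_n$ (Alice holds $x\in\{0,1\}^n$, Bob holds $i\in[n]$, and the output should be $x_i$). Let $\mu$ be the uniform distribution on $\{0,1\}^n\times[n]$ (a product distribution), and suppose $\mathcal{P}$ has error at most $1/2-\epsilon$ with respect to $\mu$. If $L^{\mathcal{P}}(\mathsf{SetMemb}_n,\mu,B,A)\le k$, then \[ L^{\mathcal{P}}(\mathsf{SetMemb}_n,\mu,A,B)\ \ge\ \frac{n}{2^{\epsilon^{-3}(14k+24)}}-2 . \]
   Context: Quantum communication protocols (Yao's model): for a function $f:\mathcal{X}\times\mathcal{Y}\to\mathcal{Z}$, Alice gets $x\in\mathcal{X}$ (stored in her input register $X$) and Bob gets $y\in\mathcal{Y}$ (stored in his input register $Y$). Initially Alice's and Bob's work qubits are in state $|0\rangle$, and they may share an input-independent pure entangled state $|\psi\rangle$ (some of its qubits belong to Alice, the rest to Bob), so the initial state is $|x\rangle|0\rangle_A|\psi\rangle|0\rangle_B|y\rangle$. The players take turns: the player whose turn it is applies a unitary to the qubits she holds that depends only on her own input (i.e. a unitary controlled by her input register), then sends some qubits to the other player. At the end, the last recipient measures designated answer qubits in the computational basis to produce the output $\mathcal{P}(x,y)$. All these choices are fixed in advance by $\mathcal{P}$. $\mathcal{P}$ has error at most $\delta$ with respect to a distribution $\mu$ on $\mathcal{X}\times\mathcal{Y}$ if $\mathbb{E}_{(x,y)\sim\mu}\Pr[\mathcal{P}(x,y)\ne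 f(x,y)]\le\delta$. The set membership problem $\mathsf{SetMemb}_n$ is the function $f:\{0,1\}^n\times[n]\to\{0,1\}$, $f(x,i)=x_i$. Registers: $A,X,B,Y$ denote Alice's work qubits, Alice's input register, Bob's work qubits and Bob's input register at the end of the protocol (just before the final measurement). Running $\mathcal{P}$ with a mixture (resp. superposition) fed to an input register means the register is initialised in that mixed (resp. pure) state and the protocol's input-controlled unitaries are applied. For a product distribution $\mu=\mu_{\mathcal{X}}\times\mu_{\mathcal{Y}}$, write $|\mu_{\mathcal{X}}\rangle=\sum_x\sqrt{\mu_{\mathcal{X}}(x)}|x\rangle$ and $|\mu_{\mathcal{Y}}\rangle=\sum_y\sqrt{\mu_{\mathcal{Y}}(y)}|y\rangle$. Superpositional privacy loss: $L^{\mathcal{P}}(f,\mu,A,B):=I(X:BY)$ evaluated at the end of the run of $\mathcal{P}$ in which the mixture $\sum_x\mu_{\mathcal{X}}(x)|x\rangle\langle x|$ is fed to $X$ and the superposition $|\mu_{\mathcal{Y}}\rangle$ is fed to $Y$. Symmetrically, $L^{\mathcal{P}}(f,\mu,B,A):=I(Y:AX)$ evaluated at the end of the run in which the mixture $\sum_y\mu_{\mathcal{Y}}(y)|y\rangle\langle y|$ is fed to $Y$ and the superposition $|\mu_{\mathcal{X}}\rangle$ is fed to $X$. Here $I(R:S)=S(R)+S(S)-S(RS)$ is quantum mutual information with von Neumann entropy $S(\rho)=-\mathrm{Tr}\,\rho\log_2\rho$. *)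

theory Defs
  imports Complex_Main "Jordan_Normal_Form.Char_Poly"
begin

text \<open>A system consists of registers indexed by natural numbers; register r has
dimension d r. A computational basis state of a set S of registers is a
configuration assigning to every r in S a value below d r and 0 elsewhere.\<close>

type_synonym cfg = "nat \<Rightarrow> nat"
type_synonym qvec = "cfg \<Rightarrow> complex"
type_synonym qop = "cfg \<Rightarrow> cfg \<Rightarrow> complex"

definition basis :: "(nat \<Rightarrow> nat) \<Rightarrow> nat set \<Rightarrow> cfg set" where
  "basis d S = {\<sigma>. (\<forall>r\<in>S. \<sigma> r < d r) \<and> (\<forall>r. r \<notin> S \<longrightarrow> \<sigma> r = 0)}"

definition restr :: "nat set \<Rightarrow> cfg \<Rightarrow> cfg" where
  "restr S \<sigma> = (\<lambda>r. if r \<in> S then \<sigma> r else 0)"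

definition merge :: "nat set \<Rightarrow> cfg \<Rightarrow> cfg \<Rightarrow> cfg" where
  "merge S \<sigma> \<tau> = (\<lambda>r. if r \<in> S then \<sigma> r else \<tau> r)"

definition proj :: "qvec \<Rightarrow> qop" where
  "proj v = (\<lambda>\<sigma> \<tau>. v \<sigma> * cnj (v \<tau>))"

definition ptrace :: "(nat \<Rightarrow> nat) \<Rightarrow> nat set \<Rightarrow> nat set \<Rightarrow> qop \<Rightarrow> qop" where
  "ptrace d R S \<rho> = (\<lambda>\<sigma> \<tau>. \<Sum>\<kappa>\<in>basis d (R - S). \<rho> (merge S \<sigma> \<kappa>) (merge S \<tau> \<kappa>))"

text \<open>Matrix of an operator on registers S w.r.t. some enumeration of the basis
(eigenvalues do not depend on the chosen enumeration).\<close>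
definition op_mat :: "(nat \<Rightarrow> nat) \<Rightarrow> nat set \<Rightarrow> qop \<Rightarrow> complex mat" where
  "op_mat d S \<rho> = (let B = basis d S; e = (SOME e. bij_betw e {..<card B} B)
     in mat (card B) (card B) (\<lambda>(i, j). \<rho> (e i) (e j)))"

definition eigvals :: "complex mat \<Rightarrow> complex list" where
  "eigvals M = (SOME as. char_poly M = (\<Prod>a\<leftarrow>as. [:- a, 1:]))"

definition eta :: "real \<Rightarrow> real" where
  "eta t = (if t \<le> 0 then 0 else t * log 2 t)"

text \<open>von Neumann entropy S(rho) = - Tr rho log2 rho (eigenvalues of a density matrix are real).\<close>
definition vn_entropy :: "(nat \<Rightarrow> nat) \<Rightarrow> nat set \<Rightarrow> qop \<Rightarrow> real" where
  "vn_entropy d S \<rho> = - (\<Sum>a\<leftarrow>eigvals (op_mat d S \<rho>). eta (Re a))"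

definition qmutual_info :: "(nat \<Rightarrow> nat) \<Rightarrow> nat set \<Rightarrow> nat set \<Rightarrow> nat set \<Rightarrow> qop \<Rightarrow> real" where
  "qmutual_info d R S T \<rho> =
     vn_entropy d S (ptrace d R S \<rho>) + vn_entropy d T (ptrace d R T \<rho>)
     - vn_entropy d (S \<union> T) (ptrace d R (S \<union> T) \<rho>)"

text \<open>Register 0 = Alice's input register X (dimension 2^n, x encodes a bit string),
register 1 = Bob's input register Y (dimension ny), registers 2..m+1 = work qubits
(including the shared entangled qubits and the message qubits).\<close>

definition Xr :: nat where "Xr = 0"
definition Yr :: nat where "Yr = 1"

definition workregs :: "nat \<Rightarrow> nat set" where
  "workregs m = {2..<m+2}"

definition allregs :: "nat \<Rightarrow> nat set" where
  "allregs m = {Xr, Yr} \<union> workregs m"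

definition dims :: "nat \<Rightarrow> nat \<Rightarrow> nat \<Rightarrow> nat" where
  "dims n ny r = (if r = Xr then 2 ^ n else if r = Yr then ny else 2)"

text \<open>A protocol: m work qubits, initial pure state psi of the work qubits
(contains the input-independent shared entangled state and the |0> work qubits),
number of rounds r, who moves first, ownership own t q (True: Alice holds work qubit q
at the beginning of round t; own r = ownership at the end), unitaries U t v
(the unitary of round t when the acting player's input is v), answer qubit ans.\<close>

record protocol =
  nwork :: nat
  psi :: qvec
  rounds :: nat
  alice_first :: bool
  own :: "nat \<Rightarrow> nat \<Rightarrow> bool"
  unis :: "nat \<Rightarrow> nat \<Rightarrow> qop"
  ans :: nat

definition alice_acts :: "protocol \<Rightarrow> nat \<Rightarrow> bool" where
  "alice_acts P t = (alice_first P = even t)"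

definition acting_qubits :: "protocol \<Rightarrow> nat \<Rightarrow> nat set" where
  "acting_qubits P t = {q \<in> workregs (nwork P). own P t q = alice_acts P t}"

definition input_reg :: "protocol \<Rightarrow> nat \<Rightarrow> nat" where
  "input_reg P t = (if alice_acts P t then Xr else Yr)"

definition unitary_on :: "(nat \<Rightarrow> nat) \<Rightarrow> nat set \<Rightarrow> qop \<Rightarrow> bool" where
  "unitary_on d S U \<longleftrightarrow> (\<forall>\<sigma>\<in>basis d S. \<forall>\<tau>\<in>basis d S.
      (\<Sum>\<kappa>\<in>basis d S. cnj (U \<kappa> \<sigma>) * U \<kappa> \<tau>) = (if \<sigma> = \<tau> then 1 else 0))"

definition unit_vec :: "(nat \<Rightarrow> nat) \<Rightarrow> nat set \<Rightarrow> qvec \<Rightarrow> bool" where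
  "unit_vec d S v \<longleftrightarrow> (\<Sum>\<sigma>\<in>basis d S. (cmod (v \<sigma>))\<^sup>2) = 1"

definition valid_protocol :: "nat \<Rightarrow> nat \<Rightarrow> protocol \<Rightarrow> bool" where
  "valid_protocol n ny P \<longleftrightarrow>
     rounds P \<ge> 1
   \<and> unit_vec (dims n ny) (workregs (nwork P)) (psi P)
   \<comment> \<open>in round t, only the acting player's qubits may change hands (she sends them)\<close>
   \<and> (\<forall>t<rounds P. \<forall>q\<in>workregs (nwork P).
        own P (Suc t) q \<noteq> own P t q \<longrightarrow> own P t q = alice_acts P t)
   \<comment> \<open>the unitary of round t acts on the acting player's qubits, controlled by her input\<close>
   \<and> (\<forall>t<rounds P. \<forall>v < dims n ny (input_reg P t).
        unitary_on (dims n ny) (acting_qubits P t) (unis P t v))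
   \<comment> \<open>the answer qubit is held at the end by the last recipient\<close>
   \<and> ans P \<in> workregs (nwork P)
   \<and> own P (rounds P) (ans P) = (\<not> alice_acts P (rounds P - 1))"

definition apply_round :: "nat \<Rightarrow> nat \<Rightarrow> protocol \<Rightarrow> nat \<Rightarrow> qvec \<Rightarrow> qvec" where
  "apply_round n ny P t v = (\<lambda>\<sigma>.
     (\<Sum>\<tau>\<in>basis (dims n ny) (acting_qubits P t).
        unis P t (\<sigma> (input_reg P t)) (restr (acting_qubits P t) \<sigma>) \<tau>
          * v (merge (acting_qubits P t) \<tau> \<sigma>)))"

definition run :: "nat \<Rightarrow> nat \<Rightarrow> protocol \<Rightarrow> qvec \<Rightarrow> qvec" where
  "run n ny P v = fold (apply_round n ny P) [0..<rounds P] v"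

definition init_state :: "protocol \<Rightarrow> (nat \<Rightarrow> complex) \<Rightarrow> (nat \<Rightarrow> complex) \<Rightarrow> qvec" where
  "init_state P \<alpha> \<beta> = (\<lambda>\<sigma>. \<alpha> (\<sigma> Xr) * \<beta> (\<sigma> Yr) * psi P (restr (workregs (nwork P)) \<sigma>))"

definition ket :: "nat \<Rightarrow> nat \<Rightarrow> complex" where
  "ket a = (\<lambda>b. if b = a then 1 else 0)"

definition final_state :: "nat \<Rightarrow> nat \<Rightarrow> protocol \<Rightarrow> nat \<Rightarrow> nat \<Rightarrow> qvec" where
  "final_state n ny P x y = run n ny P (init_state P (ket x) (ket y))"

definition out_prob :: "nat \<Rightarrow> nat \<Rightarrow> protocol \<Rightarrow> nat \<Rightarrow> nat \<Rightarrow> bool \<Rightarrow> real" where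
  "out_prob n ny P x y b =
     (\<Sum>\<sigma>\<in>{\<sigma>\<in>basis (dims n ny) (allregs (nwork P)). \<sigma> (ans P) = (if b then 1 else 0)}.
        (cmod (final_state n ny P x y \<sigma>))\<^sup>2)"

definition dist_error :: "nat \<Rightarrow> nat \<Rightarrow> protocol \<Rightarrow> (nat \<Rightarrow> nat \<Rightarrow> bool) \<Rightarrow> (nat \<Rightarrow> nat \<Rightarrow> real) \<Rightarrow> real" where
  "dist_error n ny P f \<mu> =
     (\<Sum>x<2^n. \<Sum>y<ny. \<mu> x y * out_prob n ny P x y (\<not> f x y))"

definition regA :: "protocol \<Rightarrow> nat set" where
  "regA P = {q \<in> workregs (nwork P). own P (rounds P) q}"
definition regB :: "protocol \<Rightarrow> nat set" where
  "regB P = {q \<in> workregs (nwork P). \<not> own P (rounds P) q}"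

text \<open>Superpositional privacy loss for a product distribution muX x muY.
L(f,mu,A,B) = I(X:BY), X fed the mixture of muX, Y fed the superposition |muY>.\<close>
definition loss_AB :: "nat \<Rightarrow> nat \<Rightarrow> protocol \<Rightarrow> (nat \<Rightarrow> real) \<Rightarrow> (nat \<Rightarrow> real) \<Rightarrow> real" where
  "loss_AB n ny P \<mu>X \<mu>Y =
     qmutual_info (dims n ny) (allregs (nwork P)) {Xr} (regB P \<union> {Yr})
       (\<lambda>\<sigma> \<tau>. \<Sum>x<2^n. complex_of_real (\<mu>X x) *
          proj (run n ny P (init_state P (ket x) (\<lambda>y. complex_of_real (sqrt (\<mu>Y y))))) \<sigma> \<tau>)"

text \<open>L(f,mu,B,A) = I(Y:AX), Y fed the mixture of muY, X fed the superposition |muX>.\<close>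
definition loss_BA :: "nat \<Rightarrow> nat \<Rightarrow> protocol \<Rightarrow> (nat \<Rightarrow> real) \<Rightarrow> (nat \<Rightarrow> real) \<Rightarrow> real" where
  "loss_BA n ny P \<mu>X \<mu>Y =
     qmutual_info (dims n ny) (allregs (nwork P)) {Yr} (regA P \<union> {Xr})
       (\<lambda>\<sigma> \<tau>. \<Sum>y<ny. complex_of_real (\<mu>Y y) *
          proj (run n ny P (init_state P (\<lambda>x. complex_of_real (sqrt (\<mu>X x))) (ket y))) \<sigma> \<tau>)"

text \<open>Set membership: x < 2^n encodes a bit string x_0 ... x_(n-1); Bob holds i in {0..<n}.\<close>
definition setmemb :: "nat \<Rightarrow> nat \<Rightarrow> bool" where
  "setmemb x i = bit x i"

end

(*
  After the run, the joint state is V in A x B, where the answer qubit is counted on Bob's side (this costs at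
  most two bits of Bob's information and nothing on Alice's side). Let rho be Alice's reduced state and rho_j
  the one for Bob's input j, so that the average relative entropy S(rho_j || rho) is at most k, and let D_j be
  the sign (-1)^(x_j). Bob's ability to guess x_j from the superposed run is the trace norm T_j of
  V^* D_j V, which equals the fidelity of rho and D_j rho D_j; for the run on input j the analogous fidelity is
  at least the advantage of the protocol. By Fuchs-Caves some measurement attains the former fidelity, and
  measuring does not increase relative entropies, so the comparison of the two fidelities becomes a statement on
  classical distributions: Jensen's inequality gives T_j >= (f^2 / 2) exp (- 2 (S(rho_j || rho) + 1) / f^2).
  Finally Bob's information is at least the sum of T_j^2 / 8 by the chain rule over the bits of x.

  The only deep input, monotonicity of the relative entropy under measurements, is proved by comparing
  sum c r ln (s + t r) with sum p ln (q + t p) at t = 0 and t = infinity: their t-derivatives are ordered by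
  completing a square.
*)
theory Submission
  imports "Jordan_Normal_Form.Schur_Decomposition" "HOL-Analysis.L2_Norm" Defs
begin

section \<open>Spectral theorem\<close>

text \<open>The obstacle is that k may be large: rho_j and rho can then be almost perfectly
  distinguishable, and bounds on their trace distance say nothing. What survives is a fidelity
  bounded away from 0, though exponentially small, so everything is compared through fidelities.
  That the trace norm of V^* D_j V is a fidelity is Uhlmann's theorem: V and D_j V purify rho and
  D_j rho D_j on the same system, Bob's. In the run on input j the overlap of the two purifications,
  corrected by the sign of Bob's answer, is the advantage; this sign must be an observable of Bob,
  hence the answer qubit on his side. The superposed run is tied to the runs on fixed j because Y
  lies on Bob's side: tracing it out makes rho the average of the rho_j. The power eps^-3 has two
  sources. The weights in Jensen's inequality have total mass at least f^2 / 2 with f of order eps,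
  which costs eps^-2; discarding by Markov's inequality the inputs of large divergence leaves
  divergences of order k / eps, which costs another eps^-1.\<close>

definition adj :: "complex mat \<Rightarrow> complex mat" where
  "adj M = mat (dim_col M) (dim_row M) (\<lambda>(i, j). cnj (M $$ (j, i)))"

lemma adj_carrier[simp]: "M \<in> carrier_mat m n \<Longrightarrow> adj M \<in> carrier_mat n m"
  by (auto simp: adj_def)

lemma adj_index[simp]: "i < dim_col M \<Longrightarrow> j < dim_row M \<Longrightarrow> adj M $$ (i, j) = cnj (M $$ (j, i))"
  by (auto simp: adj_def)

lemma adj_dim[simp]: "dim_row (adj M) = dim_col M" "dim_col (adj M) = dim_row M"
  by (auto simp: adj_def)

lemma adj_mult:
  assumes "A \<in> carrier_mat m n" "B \<in> carrier_mat n p"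
  shows "adj (A * B) = adj B * adj A"
  by (rule eq_matI) (use assms in \<open>auto simp: scalar_prod_def mult.commute\<close>)

lemma adj_adj[simp]: "adj (adj M) = M"
  by (rule eq_matI) auto

lemma adj_four_block_mat:
  assumes "A \<in> carrier_mat m1 n1" "B \<in> carrier_mat m1 n2" "C \<in> carrier_mat m2 n1" "D \<in> carrier_mat m2 n2"
  shows "adj (four_block_mat A B C D) = four_block_mat (adj A) (adj C) (adj B) (adj D)"
  by (rule eq_matI) (use assms in \<open>auto\<close>)

text \<open>Gram-Schmidt applied to a basis starting with \<open>v\<close> keeps its first vector
  and gives orthogonal but unnormalised columns; dividing them by \<open>sqrt (g j)\<close> makes
  the matrix unitary.\<close>

lemma unitary_with_first_col:
  fixes v :: "complex vec"
  assumes v: "v \<in> carrier_vec n" and v0: "v \<noteq> 0\<^sub>v n"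
  shows "\<exists>W\<in>carrier_mat n n. adj W * W = 1\<^sub>m n \<and> (\<exists>c. col W 0 = c \<cdot>\<^sub>v v)"
proof -
  interpret cof_vec_space n "TYPE(complex)" .
  have n: "n \<noteq> 0" using v v0 by auto
  note bc = basis_completion[OF v v0]
  define ws where "ws = gram_schmidt n (basis_completion v)"
  obtain vs where bv: "basis_completion v = v # vs"
    using bc(6,7) n by (cases "basis_completion v") auto
  have ws: "set ws \<subseteq> carrier_vec n" "corthogonal ws" "length ws = n"
    using gram_schmidt_result[OF bc(2,4,5) refl] bc(6) by (auto simp: ws_def)
  have hdws: "ws ! 0 = v" using gram_schmidt_hd[OF v, of vs] n ws(3)
    unfolding ws_def bv by (metis hd_conv_nth length_0_conv)
  define g where "g j = (\<Sum>i<n. (cmod (ws ! j $ i))\<^sup>2)" for j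
  have car: "ws ! j \<in> carrier_vec n" if "j < n" for j using ws that by auto
  have ip: "ws ! j \<bullet>c ws ! k = (\<Sum>i<n. ws ! j $ i * cnj (ws ! k $ i))" if "j < n" "k < n" for j k
    using car[OF that(1)] car[OF that(2)] by (auto simp: scalar_prod_def atLeast0LessThan)
  have gg: "ws ! j \<bullet>c ws ! j = of_real (g j)" if "j < n" for j
    unfolding ip[OF that that] g_def of_real_sum complex_norm_square ..
  have gpos: "g j > 0" if "j < n" for j
  proof -
    have "g j \<noteq> 0" using corthogonalD[OF ws(2), of j j] gg[OF that] that ws(3) by auto
    moreover have "g j \<ge> 0" unfolding g_def by (intro sum_nonneg) auto
    ultimately show ?thesis by simp
  qed
  define W where "W = mat n n (\<lambda>(i, j). ws ! j $ i / of_real (sqrt (g j)))"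
  have W: "W \<in> carrier_mat n n" by (auto simp: W_def)
  have "adj W * W = 1\<^sub>m n"
  proof (rule eq_matI)
    fix i j assume "i < dim_row (1\<^sub>m n :: complex mat)" "j < dim_col (1\<^sub>m n :: complex mat)"
    hence ij: "i < n" "j < n" by auto
    have "(adj W * W) $$ (i, j) = (\<Sum>k<n. cnj (ws ! i $ k / of_real (sqrt (g i))) * (ws ! j $ k / of_real (sqrt (g j))))"
      using ij W by (auto simp: scalar_prod_def atLeast0LessThan W_def intro!: sum.cong)
    also have "\<dots> = (\<Sum>k<n. ws ! j $ k * cnj (ws ! i $ k)) / of_real (sqrt (g i) * sqrt (g j))"
      by (simp add: sum_divide_distrib mult.commute)
    also have "\<dots> = (ws ! j \<bullet>c ws ! i) / of_real (sqrt (g i) * sqrt (g j))"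
      using ip[OF ij(2,1)] by simp
    also have "\<dots> = 1\<^sub>m n $$ (i, j)"
    proof (cases "i = j")
      case True
      have "complex_of_real (g j) / of_real (sqrt (g j) * sqrt (g j)) = 1"
        using gpos[OF ij(2)] by simp
      thus ?thesis using True ij gg[OF ij(2)] by simp
    next
      case False
      thus ?thesis using corthogonalD[OF ws(2), of j i] ij ws(3) by auto
    qed
    finally show "(adj W * W) $$ (i, j) = 1\<^sub>m n $$ (i, j)" .
  qed (use W in auto)
  moreover have "col W 0 = (1 / of_real (sqrt (g 0))) \<cdot>\<^sub>v v"
    by (rule eq_vecI) (use n v hdws in \<open>auto simp: W_def\<close>)
  ultimately show ?thesis using W by blast
qed

text \<open>Deflation: conjugating by a unitary whose first column is an eigenvector clears the
  first column of \<open>A\<close>, hermiticity then clears the first row, and the induction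
  hypothesis treats the remaining block. The list \<open>es\<close> is an arbitrary factorisation
  because \<open>eigvals\<close> picks one by choice.\<close>

lemma spectral_theorem_mat:
  assumes "A \<in> carrier_mat n n" "adj A = A" "char_poly A = (\<Prod>a\<leftarrow>es. [:- a, 1:])"
  shows "length es = n \<and> (\<exists>P\<in>carrier_mat n n. adj P * P = 1\<^sub>m n \<and>
     A * P = P * mat n n (\<lambda>(i, j). if i = j then es ! i else 0))"
  using assms
proof (induct es arbitrary: n A)
  case Nil
  with degree_monic_char_poly[of A n] show ?case by (auto intro!: bexI[of _ A])
next
  case (Cons e es n A)
  note A = Cons(2) and her = Cons(3)
  have cp: "char_poly A = [: -e, 1 :] * (\<Prod>e \<leftarrow> es. [:- e, 1:])" using Cons(4) by auto
  have mon: "monic (\<Prod>e\<leftarrow> es. [:- e, 1:])" by (rule monic_prod_list) auto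
  have "degree (char_poly A) = Suc (degree (\<Prod>e\<leftarrow> es. [:- e, 1:]))" unfolding cp
    by (subst degree_mult_eq) (use mon in auto)
  with degree_monic_char_poly[OF A] obtain m where n: "n = Suc m" by (cases n) auto
  have "eigenvalue A e" unfolding eigenvalue_root_char_poly[OF A] cp by simp
  then obtain v where "eigenvector A v e" unfolding eigenvalue_def by auto
  hence v: "v \<in> carrier_vec n" and v0: "v \<noteq> 0\<^sub>v n" and ev: "A *\<^sub>v v = e \<cdot>\<^sub>v v"
    using A unfolding eigenvector_def by auto
  obtain W c where W: "W \<in> carrier_mat n n" and WW: "adj W * W = 1\<^sub>m n" and Wc: "col W 0 = c \<cdot>\<^sub>v v"
    using unitary_with_first_col[OF v v0] by blast
  have aW: "adj W \<in> carrier_mat n n" using W by simp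
  have WW': "W * adj W = 1\<^sub>m n" using mat_mult_left_right_inverse[OF aW W WW] .
  define B where "B = adj W * (A * W)"
  have AW: "A * W \<in> carrier_mat n n" using A W by simp
  have B: "B \<in> carrier_mat n n" unfolding B_def using aW AW by simp
  have herB: "adj B = B" unfolding B_def
    using adj_mult[OF aW AW] adj_mult[OF A W] her aW W A by (simp add: assoc_mult_mat[OF aW A W])
  have colAW: "col (A * W) 0 = e \<cdot>\<^sub>v col W 0"
    using A W n v ev by (auto simp: Wc mult_mat_vec smult_smult_assoc mult.commute)
  have B0: "B $$ (i, 0) = (if i = 0 then e else 0)" if "i < n" for i
  proof -
    have "B $$ (i, 0) = row (adj W) i \<bullet> col (A * W) 0"
      unfolding B_def by (subst index_mult_mat(1)) (use that W A n in auto)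
    also have "\<dots> = e * (row (adj W) i \<bullet> col W 0)"
      unfolding colAW using that aW W n by (intro scalar_prod_smult_right) auto
    also have "row (adj W) i \<bullet> col W 0 = (adj W * W) $$ (i, 0)" using that aW W n by simp
    finally show ?thesis unfolding WW using that n by auto
  qed
  have B0': "B $$ (0, j) = (if j = 0 then e else 0)" if "j < n" for j
  proof -
    have "B $$ (0, j) = cnj (B $$ (j, 0))" using that B n herB
      by (metis adj_index carrier_matD zero_less_Suc)
    moreover have "e = cnj e" using B0[of 0] B n herB
      by (metis adj_index carrier_matD zero_less_Suc)
    ultimately show ?thesis using B0[OF that] by (auto split: if_splits)
  qed
  define A3 where "A3 = mat m m (\<lambda>(i, j). B $$ (Suc i, Suc j))"
  have A3: "A3 \<in> carrier_mat m m" by (simp add: A3_def)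
  define E where "E = mat 1 1 (\<lambda>_. e)"
  have E: "E \<in> carrier_mat 1 1" by (simp add: E_def)
  have Bb: "B = four_block_mat E (0\<^sub>m 1 m) (0\<^sub>m m 1) A3"
    by (rule eq_matI) (use B n B0 B0' in \<open>auto simp: A3_def E_def\<close>)
  have herA3: "adj A3 = A3"
  proof (rule eq_matI)
    fix i j assume "i < dim_row A3" "j < dim_col A3"
    hence "i < m" "j < m" using A3 by auto
    thus "adj A3 $$ (i, j) = A3 $$ (i, j)" using A3 B n herB
      by (auto simp: A3_def) (metis adj_index carrier_matD not_less_eq)
  qed (use A3 in auto)
  have "similar_mat B A"
    unfolding similar_mat_def
    by (rule exI[of _ "adj W"], rule exI[of _ W], rule similar_mat_witI[of _ _ n])
      (use W aW A B WW WW' in \<open>auto simp: B_def assoc_mult_mat[OF aW A W]\<close>)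
  from char_poly_similar[OF this] cp
  have "char_poly B = [: -e,1 :] * (\<Prod> e \<leftarrow> es. [:- e, 1:])" by simp
  also have "char_poly B = char_poly E * char_poly A3"
    unfolding Bb by (rule char_poly_four_block_zeros_col[OF E _ A3]) simp
  also have "char_poly E = [: -e,1 :]"
    by (simp add: E_def char_poly_defs det_def sign_def)
  finally have "char_poly A3 = (\<Prod> e \<leftarrow> es. [:- e, 1:])"
    by (metis mult_cancel_left pCons_eq_0_iff zero_neq_one)
  from Cons(1)[OF A3 herA3 this] obtain P where len: "length es = m" and P: "P \<in> carrier_mat m m"
    and PP: "adj P * P = 1\<^sub>m m"
    and AP: "A3 * P = P * mat m m (\<lambda>(i, j). if i = j then es ! i else 0)" (is "_ = P * ?D") by blast
  define Q where "Q = four_block_mat (1\<^sub>m 1) (0\<^sub>m 1 m) (0\<^sub>m m 1) P"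
  have Q: "Q \<in> carrier_mat n n" unfolding Q_def n using P by (auto intro: four_block_carrier_mat)
  have aQ: "adj Q = four_block_mat (1\<^sub>m 1) (0\<^sub>m 1 m) (0\<^sub>m m 1) (adj P)"
    unfolding Q_def
    by (subst adj_four_block_mat[of _ 1 1 _ m _ m]) (use P in \<open>auto intro!: arg_cong4[of _ _ _ _ _ _ _ _ four_block_mat] eq_matI\<close>)
  have QQ: "adj Q * Q = 1\<^sub>m n" unfolding aQ unfolding Q_def
    by (subst mult_four_block_mat[of _ 1 1 _ m _ m _ _ 1 _ m]) (use P PP n in \<open>auto simp: adj_carrier[OF P]\<close>)
  let ?D' = "mat n n (\<lambda>(i, j). if i = j then (e # es) ! i else 0)"
  have D': "?D' = four_block_mat E (0\<^sub>m 1 m) (0\<^sub>m m 1) ?D"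
    by (rule eq_matI) (use n in \<open>auto simp: E_def nth_Cons split: nat.splits\<close>)
  have D'c: "?D' \<in> carrier_mat n n" by simp
  have BQ: "B * Q = Q * ?D'" unfolding Bb Q_def D'
    using P A3 E AP by (simp add: mult_four_block_mat[of _ 1 1 _ m _ m _ _ 1 _ m])
  define R where "R = W * Q"
  have R: "R \<in> carrier_mat n n" using W Q by (simp add: R_def)
  have "adj R * R = (adj Q * adj W) * (W * Q)" unfolding R_def using adj_mult[OF W Q] by simp
  also have "\<dots> = adj Q * ((adj W * W) * Q)"
    using W Q aW by (simp add: assoc_mult_mat[of _ n n _ n _ n] adj_carrier[OF Q])
  also have "\<dots> = 1\<^sub>m n" unfolding WW using Q QQ by simp
  finally have RR: "adj R * R = 1\<^sub>m n" .
  have "A * R = (W * adj W) * (A * (W * Q))" unfolding R_def WW' using A W Q by simp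
  also have "\<dots> = W * (B * Q)" unfolding B_def
    using A W Q aW by (simp add: assoc_mult_mat[of _ n n _ n _ n])
  also have "\<dots> = R * ?D'" unfolding BQ R_def using W Q by (simp add: assoc_mult_mat[of _ n n _ n _ n])
  finally show ?case using R RR len n by auto
qed

section \<open>Orthonormal bases and spectral decompositions of kernels on a finite set\<close>

definition ip :: "'a set \<Rightarrow> ('a \<Rightarrow> complex) \<Rightarrow> ('a \<Rightarrow> complex) \<Rightarrow> complex" where
  "ip S u w = (\<Sum>a\<in>S. cnj (u a) * w a)"

text \<open>Completeness is built in, so that Parseval's identity needs no dimension count and the
  index set can have any type, for instance pairs of a block and a label.\<close>

definition onb :: "'a set \<Rightarrow> 'j set \<Rightarrow> ('j \<Rightarrow> 'a \<Rightarrow> complex) \<Rightarrow> bool" where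
  "onb S J e \<longleftrightarrow> finite S \<and> finite J \<and>
     (\<forall>j\<in>J. \<forall>k\<in>J. ip S (e j) (e k) = of_bool (j = k)) \<and>
     (\<forall>a\<in>S. \<forall>b\<in>S. (\<Sum>j\<in>J. e j a * cnj (e j b)) = of_bool (a = b))"

definition sesq :: "'a set \<Rightarrow> ('a \<Rightarrow> 'a \<Rightarrow> complex) \<Rightarrow> ('a \<Rightarrow> complex) \<Rightarrow> ('a \<Rightarrow> complex) \<Rightarrow> complex" where
  "sesq S K u w = (\<Sum>a\<in>S. \<Sum>b\<in>S. cnj (u a) * K a b * w b)"

definition expct :: "'a set \<Rightarrow> ('a \<Rightarrow> 'a \<Rightarrow> complex) \<Rightarrow> ('a \<Rightarrow> complex) \<Rightarrow> real" where
  "expct S K u = Re (sesq S K u u)"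

definition spectral ::
  "'a set \<Rightarrow> ('a \<Rightarrow> 'a \<Rightarrow> complex) \<Rightarrow> 'j set \<Rightarrow> ('j \<Rightarrow> 'a \<Rightarrow> complex) \<Rightarrow> ('j \<Rightarrow> real) \<Rightarrow> bool" where
  "spectral S K J e l \<longleftrightarrow> onb S J e \<and>
     (\<forall>a\<in>S. \<forall>b\<in>S. K a b = (\<Sum>j\<in>J. of_real (l j) * e j a * cnj (e j b)))"

definition hermitian_on :: "'a set \<Rightarrow> ('a \<Rightarrow> 'a \<Rightarrow> complex) \<Rightarrow> bool" where
  "hermitian_on S K \<longleftrightarrow> (\<forall>a\<in>S. \<forall>b\<in>S. cnj (K a b) = K b a)"

lemma onb_finite: "onb S J e \<Longrightarrow> finite S" "onb S J e \<Longrightarrow> finite J"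
  by (auto simp: onb_def)

lemma cnj_ip: "cnj (ip S u w) = ip S w u"
  by (simp add: ip_def mult.commute)

lemma ip_self: "ip S u u = of_real (\<Sum>a\<in>S. (cmod (u a))\<^sup>2)"
  unfolding ip_def of_real_sum by (intro sum.cong refl) (metis complex_norm_square mult.commute)

lemma ip_mult_swap: "ip S u w * ip S w u = of_real ((cmod (ip S u w))\<^sup>2)"
  by (metis complex_norm_square cnj_ip)

lemma parseval:
  assumes "onb S J e"
  shows "ip S u w = (\<Sum>j\<in>J. ip S u (e j) * ip S (e j) w)"
proof -
  have "(\<Sum>j\<in>J. ip S u (e j) * ip S (e j) w)
      = (\<Sum>j\<in>J. \<Sum>a\<in>S. \<Sum>b\<in>S. cnj (u a) * w b * (e j a * cnj (e j b)))"
    unfolding ip_def sum_product by (simp add: mult_ac)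
  also have "\<dots> = (\<Sum>a\<in>S. \<Sum>b\<in>S. cnj (u a) * w b * (\<Sum>j\<in>J. e j a * cnj (e j b)))"
    unfolding sum_distrib_left by (subst sum.swap, intro sum.cong refl, rule sum.swap)
  also have "\<dots> = (\<Sum>a\<in>S. \<Sum>b\<in>S. if a = b then cnj (u a) * w b else 0)"
    using assms by (intro sum.cong refl) (auto simp: onb_def)
  also have "\<dots> = ip S u w"
    using onb_finite[OF assms] by (simp add: ip_def)
  finally show ?thesis by simp
qed

lemma parseval_norm:
  assumes "onb S J e"
  shows "(\<Sum>j\<in>J. (cmod (ip S (e j) u))\<^sup>2) = (\<Sum>a\<in>S. (cmod (u a))\<^sup>2)"
proof -
  have "complex_of_real (\<Sum>j\<in>J. (cmod (ip S (e j) u))\<^sup>2) = (\<Sum>j\<in>J. ip S u (e j) * ip S (e j) u)"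
    unfolding of_real_sum by (intro sum.cong refl) (metis ip_mult_swap mult.commute)
  also have "\<dots> = of_real (\<Sum>a\<in>S. (cmod (u a))\<^sup>2)"
    using parseval[OF assms, of u u] ip_self by metis
  finally show ?thesis using of_real_eq_iff by blast
qed

lemma onb_unit:
  assumes "onb S J e" "j \<in> J"
  shows "(\<Sum>a\<in>S. (cmod (e j a))\<^sup>2) = 1"
proof -
  have "ip S (e j) (e j) = 1" using assms by (auto simp: onb_def)
  thus ?thesis unfolding ip_self by (metis of_real_eq_1_iff)
qed

lemma onb_overlap_sum:
  assumes "onb S J e" "onb S L f" "l \<in> L"
  shows "(\<Sum>j\<in>J. (cmod (ip S (e j) (f l)))\<^sup>2) = 1"
  using parseval_norm[OF assms(1), of "f l"] onb_unit[OF assms(2,3)] by simp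

lemma cmod_ip_commute: "cmod (ip S u w) = cmod (ip S w u)"
  by (metis cnj_ip complex_mod_cnj)

lemma onb_overlap_sum':
  assumes "onb S J e" "onb S L f" "j \<in> J"
  shows "(\<Sum>l\<in>L. (cmod (ip S (e j) (f l)))\<^sup>2) = 1"
  using onb_overlap_sum[OF assms(2,1,3)] by (simp add: cmod_ip_commute)

lemma sesq_spectral:
  assumes "spectral S K J e l"
  shows "sesq S K u w = (\<Sum>j\<in>J. of_real (l j) * ip S u (e j) * ip S (e j) w)"
proof -
  have "(\<Sum>j\<in>J. of_real (l j) * ip S u (e j) * ip S (e j) w)
      = (\<Sum>j\<in>J. \<Sum>a\<in>S. \<Sum>b\<in>S. cnj (u a) * (of_real (l j) * e j a * cnj (e j b)) * w b)"
    unfolding ip_def mult.assoc sum_product unfolding sum_distrib_left by (simp add: mult_ac)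
  also have "\<dots> = (\<Sum>a\<in>S. \<Sum>b\<in>S. cnj (u a) * (\<Sum>j\<in>J. of_real (l j) * e j a * cnj (e j b)) * w b)"
    unfolding sum_distrib_left sum_distrib_right
    by (subst sum.swap, intro sum.cong refl, rule sum.swap)
  also have "\<dots> = sesq S K u w"
    using assms unfolding sesq_def by (intro sum.cong refl) (auto simp: spectral_def)
  finally show ?thesis by simp
qed

lemma expct_spectral:
  assumes "spectral S K J e l"
  shows "expct S K u = (\<Sum>j\<in>J. l j * (cmod (ip S (e j) u))\<^sup>2)"
proof -
  have "sesq S K u u = of_real (\<Sum>j\<in>J. l j * (cmod (ip S (e j) u))\<^sup>2)"
    unfolding sesq_spectral[OF assms] of_real_sum
    by (intro sum.cong refl) (simp add: ip_mult_swap cmod_ip_commute mult.assoc)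
  thus ?thesis by (simp add: expct_def)
qed

lemma sesq_eigvec:
  assumes "spectral S K J e l" "j \<in> J"
  shows "sesq S K (e j) w = of_real (l j) * ip S (e j) w"
    and "sesq S K u (e j) = of_real (l j) * ip S u (e j)"
proof -
  have o: "ip S (e j) (e i) = of_bool (j = i)" "ip S (e i) (e j) = of_bool (i = j)" if "i \<in> J" for i
    using assms that by (auto simp: spectral_def onb_def)
  have f: "finite J" using assms by (auto simp: spectral_def onb_def)
  have "sesq S K (e j) w = (\<Sum>i\<in>J. if j = i then of_real (l i) * ip S (e i) w else 0)"
    unfolding sesq_spectral[OF assms(1)] by (intro sum.cong refl) (auto simp: o)
  thus "sesq S K (e j) w = of_real (l j) * ip S (e j) w" using f assms(2) by simp
  have "sesq S K u (e j) = (\<Sum>i\<in>J. if i = j then of_real (l i) * ip S u (e i) else 0)"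
    unfolding sesq_spectral[OF assms(1)] by (intro sum.cong refl) (auto simp: o)
  thus "sesq S K u (e j) = of_real (l j) * ip S u (e j)" using f assms(2) by simp
qed

lemma expct_eigvec:
  assumes "spectral S K J e l" "j \<in> J"
  shows "expct S K (e j) = l j"
proof -
  have "ip S (e j) (e j) = 1" using assms by (auto simp: spectral_def onb_def)
  thus ?thesis by (simp add: expct_def sesq_eigvec[OF assms])
qed

lemma sum_expct_onb:
  assumes "onb S L v"
  shows "(\<Sum>l\<in>L. expct S K (v l)) = (\<Sum>a\<in>S. Re (K a a))"
proof -
  have "(\<Sum>l\<in>L. sesq S K (v l) (v l)) = (\<Sum>a\<in>S. \<Sum>b\<in>S. K a b * (\<Sum>l\<in>L. v l b * cnj (v l a)))"
    unfolding sesq_def sum_distrib_left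
    by (subst sum.swap, intro sum.cong refl, subst sum.swap) (simp add: mult_ac)
  also have "\<dots> = (\<Sum>a\<in>S. \<Sum>b\<in>S. if a = b then K a b else 0)"
    using assms by (intro sum.cong refl) (auto simp: onb_def)
  also have "\<dots> = (\<Sum>a\<in>S. K a a)" using onb_finite[OF assms] by simp
  finally show ?thesis unfolding expct_def by (metis Re_sum)
qed

lemma sum_eigenvalues:
  assumes "spectral S K J e l"
  shows "sum l J = (\<Sum>a\<in>S. Re (K a a))"
proof -
  have "sum l J = (\<Sum>j\<in>J. expct S K (e j))" using expct_eigvec[OF assms] by simp
  thus ?thesis using sum_expct_onb[of S J e K] assms by (simp add: spectral_def)
qed

text \<open>The squared overlaps of the two eigenbases have row and column sums 1 and vanish unless
  the two eigenvalues agree, so they transport one sum into the other.\<close>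

lemma spectral_function_unique:
  fixes h :: "real \<Rightarrow> real"
  assumes 1: "spectral S K J e l" and 2: "spectral S K L f m"
  shows "(\<Sum>j\<in>J. h (l j)) = (\<Sum>i\<in>L. h (m i))"
proof -
  have o: "onb S J e" "onb S L f" using assms by (auto simp: spectral_def)
  have eq: "(cmod (ip S (e j) (f i)))\<^sup>2 * h (l j) = (cmod (ip S (e j) (f i)))\<^sup>2 * h (m i)"
    if "j \<in> J" "i \<in> L" for i j
  proof -
    have "of_real (l j) * ip S (e j) (f i) = of_real (m i) * ip S (e j) (f i)"
      using sesq_eigvec(1)[OF 1 that(1)] sesq_eigvec(2)[OF 2 that(2)] by metis
    thus ?thesis by auto
  qed
  have "(\<Sum>j\<in>J. h (l j)) = (\<Sum>j\<in>J. \<Sum>i\<in>L. (cmod (ip S (e j) (f i)))\<^sup>2 * h (l j))"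
    by (intro sum.cong refl) (simp add: sum_distrib_right[symmetric] onb_overlap_sum'[OF o])
  also have "\<dots> = (\<Sum>i\<in>L. \<Sum>j\<in>J. (cmod (ip S (e j) (f i)))\<^sup>2 * h (m i))"
    using eq by (subst sum.swap) (auto intro!: sum.cong)
  also have "\<dots> = (\<Sum>i\<in>L. h (m i))"
    by (intro sum.cong refl) (simp add: sum_distrib_right[symmetric] onb_overlap_sum[OF o])
  finally show ?thesis .
qed

text \<open>Moves the matrix theorem to kernels on \<open>S\<close> along an enumeration
  \<open>h\<close>. That the roots are real comes from the diagonal matrix \<open>D\<close>, which
  equals \<open>adj P * (A * P)\<close> and is therefore hermitian.\<close>

lemma spectral_enum:
  assumes h: "bij_betw h {..<N} S" and her: "hermitian_on S K"
    and cp: "char_poly (mat N N (\<lambda>(i, j). K (h i) (h j))) = (\<Prod>a\<leftarrow>es. [:- a, 1:])"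
  shows "length es = N \<and> (\<exists>e. spectral S K {..<N} e (\<lambda>i. Re (es ! i)))"
proof -
  define A where "A = mat N N (\<lambda>(i, j). K (h i) (h j))"
  have hS: "h i \<in> S" if "i < N" for i using h that by (auto simp: bij_betw_def)
  have A: "A \<in> carrier_mat N N" by (simp add: A_def)
  have aA: "adj A = A"
    by (rule eq_matI) (use her hS in \<open>auto simp: A_def hermitian_on_def\<close>)
  define D where "D = mat N N (\<lambda>(i, j). if i = j then es ! i else 0)"
  have D: "D \<in> carrier_mat N N" by (simp add: D_def)
  from spectral_theorem_mat[OF A aA cp[folded A_def]] obtain P where len: "length es = N"
    and P: "P \<in> carrier_mat N N" and PP: "adj P * P = 1\<^sub>m N" and AP: "A * P = P * D"
    by (auto simp: D_def)
  have aP: "adj P \<in> carrier_mat N N" using P by simp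
  have PP': "P * adj P = 1\<^sub>m N" using mat_mult_left_right_inverse[OF aP P PP] .
  have "D = adj P * (A * P)" unfolding AP using P aP PP D by (simp add: assoc_mult_mat[OF aP P D, symmetric])
  hence "adj D = D"
    using adj_mult[OF aP, of "A * P" N] adj_mult[OF A P] A P aA by (simp add: assoc_mult_mat[OF aP A P])
  hence "cnj (es ! i) = es ! i" if "i < N" for i
  proof -
    have "cnj (D $$ (i, i)) = D $$ (i, i)"
      using adj_index[of i D i] \<open>adj D = D\<close> that D by (metis carrier_matD)
    thus ?thesis using that by (simp add: D_def)
  qed
  hence re: "complex_of_real (Re (es ! i)) = es ! i" if "i < N" for i
    using that by (simp add: complex_eq_iff)
  have "A = A * (P * adj P)" unfolding PP' using A by simp
  also have "\<dots> = P * D * adj P" unfolding AP[symmetric] using assoc_mult_mat[OF A P aP] by simp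
  finally have Ad: "A = P * D * adj P" .
  have PD: "(P * D) $$ (i, k) = P $$ (i, k) * es ! k" if "i < N" "k < N" for i k
  proof -
    have "(P * D) $$ (i, k) = (\<Sum>x<N. P $$ (i, x) * (if x = k then es ! x else 0))"
      using that P D by (auto simp: scalar_prod_def atLeast0LessThan D_def intro!: sum.cong)
    also have "\<dots> = (\<Sum>x<N. if x = k then P $$ (i, x) * es ! x else 0)"
      by (intro sum.cong) auto
    finally show ?thesis using that by simp
  qed
  have PDc: "P * D \<in> carrier_mat N N" using P D by simp
  have Aij: "A $$ (i, j) = (\<Sum>k<N. P $$ (i, k) * es ! k * cnj (P $$ (j, k)))" if "i < N" "j < N" for i j
    by (subst Ad, subst index_mult_mat(1))
      (use that P PDc PD aP in \<open>auto simp: scalar_prod_def atLeast0LessThan intro!: sum.cong\<close>)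
  define g where "g = inv_into {..<N} h"
  have g: "g a < N" "h (g a) = a" if "a \<in> S" for a
    using that h unfolding g_def bij_betw_def
    by (metis inv_into_into lessThan_iff) (metis f_inv_into_f h bij_betw_def that)
  have gh: "g (h i) = i" if "i < N" for i
    using that h unfolding g_def bij_betw_def by (simp add: inv_into_f_f)
  have gi: "g a = g b \<longleftrightarrow> a = b" if "a \<in> S" "b \<in> S" for a b using g that by metis
  define e where "e = (\<lambda>k a. P $$ (g a, k))"
  have fS: "finite S" using h bij_betw_finite by blast
  have "ip S (e j) (e k) = of_bool (j = k)" if "j < N" "k < N" for j k
  proof -
    have "ip S (e j) (e k) = (\<Sum>i<N. cnj (P $$ (i, j)) * P $$ (i, k))"
      unfolding ip_def e_def by (subst sum.reindex_bij_betw[OF h, symmetric]) (simp add: gh)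
    also have "\<dots> = (adj P * P) $$ (j, k)"
      using that P by (simp add: scalar_prod_def atLeast0LessThan)
    finally show ?thesis using that PP by simp
  qed
  moreover have "(\<Sum>k<N. e k a * cnj (e k b)) = of_bool (a = b)" if "a \<in> S" "b \<in> S" for a b
  proof -
    have "(\<Sum>k<N. e k a * cnj (e k b)) = (P * adj P) $$ (g a, g b)"
      using g that P by (simp add: scalar_prod_def atLeast0LessThan e_def)
    thus ?thesis using that PP' g gi by simp
  qed
  moreover have "K a b = (\<Sum>k<N. of_real (Re (es ! k)) * e k a * cnj (e k b))" if "a \<in> S" "b \<in> S" for a b
  proof -
    have "K a b = A $$ (g a, g b)" using g that by (simp add: A_def)
    also have "\<dots> = (\<Sum>k<N. of_real (Re (es ! k)) * e k a * cnj (e k b))"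
      using g that re by (simp add: Aij e_def mult_ac)
    finally show ?thesis .
  qed
  ultimately have "spectral S K {..<N} e (\<lambda>i. Re (es ! i))"
    using fS by (auto simp: spectral_def onb_def)
  thus ?thesis using len by blast
qed

lemma spectral_exists:
  assumes "finite S" "hermitian_on S K"
  shows "\<exists>e (l :: nat \<Rightarrow> real). spectral S K {..<card S} e l"
proof -
  obtain h where h: "bij_betw h {..<card S} S"
    using assms(1) ex_bij_betw_nat_finite[of S] by (auto simp: atLeast0LessThan)
  obtain es where "char_poly (mat (card S) (card S) (\<lambda>(i, j). K (h i) (h j))) = (\<Prod>a\<leftarrow>es. [:- a, 1:])"
    using char_poly_factorized[of "mat (card S) (card S) (\<lambda>(i, j). K (h i) (h j))" "card S"] by auto
  thus ?thesis using spectral_enum[OF h assms(2)] by blast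
qed

lemma spectral_hermitian: "spectral S K J e l \<Longrightarrow> hermitian_on S K"
  by (auto simp: spectral_def hermitian_on_def mult_ac intro!: sum.cong)

text \<open>Removes both choices hidden in \<open>vn_entropy\<close>, the enumeration in
  \<open>op_mat\<close> and the list in \<open>eigvals\<close>: from here on any convenient
  eigenbasis computes the entropy.\<close>

lemma vn_entropy_spectral:
  assumes sp: "spectral (basis d S) K J e l"
  shows "vn_entropy d S K = - (\<Sum>j\<in>J. eta (l j))"
proof -
  let ?B = "basis d S"
  have fin: "finite ?B" using sp by (auto simp: spectral_def onb_def)
  define h where "h = (SOME e. bij_betw e {..<card ?B} ?B)"
  have "\<exists>h. bij_betw h {..<card ?B} ?B"
    using fin ex_bij_betw_nat_finite[of ?B] by (auto simp: atLeast0LessThan)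
  hence h: "bij_betw h {..<card ?B} ?B" unfolding h_def by (rule someI_ex)
  have om: "op_mat d S K = mat (card ?B) (card ?B) (\<lambda>(i, j). K (h i) (h j))"
    by (simp add: op_mat_def h_def Let_def)
  define es where "es = eigvals (op_mat d S K)"
  have "\<exists>es. char_poly (op_mat d S K) = (\<Prod>a\<leftarrow>es. [:- a, 1:])"
    using char_poly_factorized[of "op_mat d S K" "card ?B"] om by auto
  hence "char_poly (op_mat d S K) = (\<Prod>a\<leftarrow>es. [:- a, 1:])"
    unfolding es_def eigvals_def by (rule someI_ex)
  from spectral_enum[OF h spectral_hermitian[OF sp], of es, OF this[unfolded om]] obtain f
    where len: "length es = card ?B" and f: "spectral ?B K {..<card ?B} f (\<lambda>i. Re (es ! i))" by blast
  have "(\<Sum>a\<leftarrow>es. eta (Re a)) = (\<Sum>i<card ?B. eta (Re (es ! i)))"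
    by (simp add: sum_list_sum_nth len atLeast0LessThan)
  also have "\<dots> = (\<Sum>j\<in>J. eta (l j))"
    using spectral_function_unique[OF f sp, of eta] .
  finally show ?thesis by (simp add: vn_entropy_def es_def)
qed

section \<open>Relative entropy under measurements\<close>

definition psd :: "'a set \<Rightarrow> ('a \<Rightarrow> 'a \<Rightarrow> complex) \<Rightarrow> bool" where
  "psd S K \<longleftrightarrow> hermitian_on S K \<and> (\<forall>u. 0 \<le> expct S K u)"

text \<open>The operator with eigenvectors \<open>v l\<close> and eigenvalues \<open>u l\<close>,
  applied to \<open>f\<close>; it is the observable that pays \<open>u l\<close> on outcome
  \<open>l\<close>.\<close>

definition diag_op :: "'a set \<Rightarrow> 'l set \<Rightarrow> ('l \<Rightarrow> 'a \<Rightarrow> complex) \<Rightarrow> ('l \<Rightarrow> real) \<Rightarrow> ('a \<Rightarrow> complex) \<Rightarrow> 'a \<Rightarrow> complex" where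
  "diag_op S L v u f = (\<lambda>a. \<Sum>l\<in>L. of_real (u l) * ip S (v l) f * v l a)"

lemma ip_diag_op:
  "ip S e (diag_op S L v u f) = (\<Sum>l\<in>L. of_real (u l) * ip S e (v l) * ip S (v l) f)"
  unfolding ip_def[of S e] diag_op_def sum_distrib_left sum_distrib_right
  by (subst sum.swap) (simp add: mult_ac)

lemma ip_diag_op_left: "ip S (diag_op S L v u e) f = ip S e (diag_op S L v u f)"
proof -
  have "ip S (diag_op S L v u e) f = cnj (ip S f (diag_op S L v u e))" by (simp add: cnj_ip)
  also have "\<dots> = ip S e (diag_op S L v u f)"
    by (simp add: ip_diag_op cnj_ip mult_ac)
  finally show ?thesis .
qed

lemma ip_onb_diag_op:
  assumes "onb S L v" "l \<in> L"
  shows "ip S (v l) (diag_op S L v u f) = of_real (u l) * ip S (v l) f"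
proof -
  have "ip S (v l) (diag_op S L v u f) = (\<Sum>k\<in>L. if l = k then of_real (u k) * ip S (v k) f else 0)"
    unfolding ip_diag_op using assms by (intro sum.cong refl) (auto simp: onb_def)
  thus ?thesis using assms onb_finite(2)[OF assms(1)] by simp
qed

lemma sum_diag_op_sq:
  assumes "onb S L v" "onb S K b"
  shows "(\<Sum>k\<in>K. (cmod (ip S (b k) (diag_op S L v u f)))\<^sup>2) = (\<Sum>l\<in>L. (u l)\<^sup>2 * (cmod (ip S (v l) f))\<^sup>2)"
  unfolding parseval_norm[OF assms(2)] parseval_norm[OF assms(1), symmetric]
  by (intro sum.cong refl) (simp add: ip_onb_diag_op[OF assms(1)] norm_mult power_mult_distrib)

text \<open>Expand the square of the modulus of \<open>r x - D y\<close> and divide by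
  \<open>D\<close>. For \<open>D = 0\<close> the right side is 0 by the convention on division, and
  the assumption kills the linear term on the left.\<close>

lemma complete_square_bound:
  fixes x y :: complex and r D :: real
  assumes "D > 0 \<or> (D = 0 \<and> (r = 0 \<or> x = 0))"
  shows "2 * r * Re (cnj x * y) - D * (cmod y)\<^sup>2 \<le> (cmod x)\<^sup>2 * r\<^sup>2 / D"
proof (cases "D > 0")
  case True
  have "(cmod (of_real r * x - of_real D * y))\<^sup>2 = r\<^sup>2 * (cmod x)\<^sup>2 + D\<^sup>2 * (cmod y)\<^sup>2 - 2 * r * D * Re (cnj x * y)"
    unfolding cmod_power2 by (simp add: power2_eq_square algebra_simps)
  hence "0 \<le> r\<^sup>2 * (cmod x)\<^sup>2 + D\<^sup>2 * (cmod y)\<^sup>2 - 2 * r * D * Re (cnj x * y)"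
    by (metis zero_le_power2)
  hence "D * (2 * r * Re (cnj x * y) - D * (cmod y)\<^sup>2) \<le> (cmod x)\<^sup>2 * r\<^sup>2"
    by (simp add: power2_eq_square algebra_simps)
  thus ?thesis using True by (simp add: pos_le_divide_eq mult.commute)
qed (use assms in auto)

text \<open>A measurement in the basis \<open>v\<close> whose outcomes are merged by
  \<open>g\<close>. The support conditions speak only of the vectors \<open>b k\<close> and
  \<open>v l\<close> that occur, so that the locale serves both the general inequality and Klein's
  inequality, where just these are known.\<close>

locale measured_pair =
  fixes S :: "'a set" and R Q :: "'a \<Rightarrow> 'a \<Rightarrow> complex"
    and J :: "'j set" and a :: "'j \<Rightarrow> 'a \<Rightarrow> complex" and r :: "'j \<Rightarrow> real"
    and K :: "'k set" and b :: "'k \<Rightarrow> 'a \<Rightarrow> complex" and s :: "'k \<Rightarrow> real"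
    and L :: "'l set" and v :: "'l \<Rightarrow> 'a \<Rightarrow> complex" and M :: "'m set" and g :: "'l \<Rightarrow> 'm"
  assumes sr: "spectral S R J a r" and ss: "spectral S Q K b s" and ov: "onb S L v"
    and r0: "\<And>j. j \<in> J \<Longrightarrow> 0 \<le> r j" and s0: "\<And>k. k \<in> K \<Longrightarrow> 0 \<le> s k"
    and rs_supp: "\<And>k. k \<in> K \<Longrightarrow> s k = 0 \<Longrightarrow> expct S R (b k) = 0"
    and pq_supp: "\<And>l. l \<in> L \<Longrightarrow> expct S Q (v l) = 0 \<Longrightarrow> expct S R (v l) = 0"
    and fM: "finite M" and gM: "\<And>l. l \<in> L \<Longrightarrow> g l \<in> M"
begin

definition "p m = (\<Sum>l\<in>{l\<in>L. g l = m}. expct S R (v l))"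
definition "q m = (\<Sum>l\<in>{l\<in>L. g l = m}. expct S Q (v l))"
definition "c j k = (cmod (ip S (a j) (b k)))\<^sup>2"
text \<open>\<open>F 0\<close> collects the terms of the claimed inequality that contain
  \<open>s\<close> and \<open>q\<close>. For large \<open>t\<close> each logarithm is
  \<open>ln t\<close> plus \<open>ln (r j)\<close> or \<open>ln (p m)\<close> up to a vanishing
  error, and the \<open>ln t\<close> parts cancel because both weights have the same total; the
  limit collects the remaining terms.\<close>

definition "F t = (\<Sum>j\<in>J. \<Sum>k\<in>K. c j k * r j * ln (s k + t * r j)) - (\<Sum>m\<in>M. p m * ln (q m + t * p m))"

lemma onbs: "onb S J a" "onb S K b"
  using sr ss by (auto simp: spectral_def)

lemma fin: "finite J" "finite K" "finite L"
  using onbs ov onb_finite by blast+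

lemma group: "(\<Sum>m\<in>M. h m * (\<Sum>l\<in>{l\<in>L. g l = m}. f l)) = (\<Sum>l\<in>L. h (g l) * f l)" for h f :: "_ \<Rightarrow> real"
proof -
  have "(\<Sum>m\<in>M. h m * (\<Sum>l\<in>{l\<in>L. g l = m}. f l)) = (\<Sum>m\<in>M. \<Sum>l\<in>{l\<in>L. g l = m}. h (g l) * f l)"
    unfolding sum_distrib_left by (intro sum.cong refl) auto
  also have "\<dots> = (\<Sum>l\<in>L. h (g l) * f l)"
    by (rule sum.group) (use fin fM gM in auto)
  finally show ?thesis .
qed

lemma expct_R: "expct S R u = (\<Sum>j\<in>J. r j * (cmod (ip S (a j) u))\<^sup>2)"
  using expct_spectral[OF sr] .

lemma expct_Q: "expct S Q u = (\<Sum>k\<in>K. s k * (cmod (ip S (b k) u))\<^sup>2)"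
  using expct_spectral[OF ss] .

lemma expct0: "0 \<le> expct S R u" "0 \<le> expct S Q u"
  unfolding expct_R expct_Q using r0 s0 by (auto intro!: sum_nonneg)

lemma pq0: "0 \<le> p m" "0 \<le> q m"
  unfolding p_def q_def using expct0 by (auto intro!: sum_nonneg)

lemma c0: "0 \<le> c j k" by (simp add: c_def)

lemma pq_dom: "q m = 0 \<Longrightarrow> p m = 0"
proof -
  assume q: "q m = 0"
  have "expct S Q (v l) = 0" if "l \<in> L" "g l = m" for l
    using q that fin expct0(2) unfolding q_def by (subst (asm) sum_nonneg_eq_0_iff) auto
  thus "p m = 0" unfolding p_def using pq_supp by (intro sum.neutral) auto
qed

lemma rs_dom: "j \<in> J \<Longrightarrow> k \<in> K \<Longrightarrow> s k = 0 \<Longrightarrow> c j k * r j = 0"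
proof -
  assume jk: "j \<in> J" "k \<in> K" and s: "s k = 0"
  have "(\<Sum>j\<in>J. r j * (cmod (ip S (a j) (b k)))\<^sup>2) = 0" using rs_supp[OF jk(2) s] expct_R by simp
  hence "r j * (cmod (ip S (a j) (b k)))\<^sup>2 = 0"
    using jk fin r0 by (subst (asm) sum_nonneg_eq_0_iff) auto
  thus "c j k * r j = 0" by (simp add: c_def mult.commute)
qed

lemma sum_c: "j \<in> J \<Longrightarrow> (\<Sum>k\<in>K. c j k) = 1"
  unfolding c_def by (rule onb_overlap_sum'[OF onbs])

lemma sum_c_r: "(\<Sum>j\<in>J. c j k * r j) = expct S R (b k)"
  unfolding c_def expct_R by (simp add: mult.commute)

lemma sum_p: "(\<Sum>m\<in>M. p m) = sum r J"
proof -
  have "(\<Sum>m\<in>M. p m) = (\<Sum>l\<in>L. expct S R (v l))"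
    using group[of "\<lambda>_. 1" "\<lambda>l. expct S R (v l)"] by (simp add: p_def)
  thus ?thesis using sum_expct_onb[OF ov] sum_eigenvalues[OF sr] by simp
qed

text \<open>\<open>x j k\<close> and \<open>y j k\<close> are the matrix elements of the identity
  and of the observable \<open>U\<close> between the eigenbases of \<open>R\<close> and
  \<open>Q\<close>. In these mixed coordinates the sums of \<open>u p\<close>, \<open>u^2 q\<close>
  and \<open>u^2 p\<close> all become sums over the same pairs \<open>(j, k)\<close>, and the square
  can be completed pair by pair.\<close>

lemma variational:
  fixes u :: "'m \<Rightarrow> real"
  assumes t: "0 \<le> t"
  shows "(\<Sum>m\<in>M. 2 * u m * p m - (u m)\<^sup>2 * (q m + t * p m)) \<le> (\<Sum>j\<in>J. \<Sum>k\<in>K. c j k * (r j)\<^sup>2 / (s k + t * r j))"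
proof -
  define U where "U = diag_op S L v (\<lambda>l. u (g l))"
  define x where "x j k = ip S (a j) (b k)" for j k
  define y where "y j k = ip S (a j) (U (b k))" for j k
  have y': "y j k = ip S (U (a j)) (b k)" for j k
    unfolding y_def U_def by (simp add: ip_diag_op_left)
  have A: "(\<Sum>k\<in>K. Re (cnj (x j k) * y j k)) = (\<Sum>l\<in>L. u (g l) * (cmod (ip S (a j) (v l)))\<^sup>2)" for j
  proof -
    have "(\<Sum>k\<in>K. cnj (x j k) * y j k) = (\<Sum>k\<in>K. ip S (U (a j)) (b k) * ip S (b k) (a j))"
      unfolding y' x_def by (simp add: cnj_ip mult.commute)
    also have "\<dots> = ip S (U (a j)) (a j)" by (rule parseval[OF onbs(2), symmetric])
    also have "\<dots> = (\<Sum>l\<in>L. of_real (u (g l) * (cmod (ip S (a j) (v l)))\<^sup>2))"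
      unfolding U_def ip_diag_op_left ip_diag_op by (simp add: ip_mult_swap mult.assoc)
    finally have "(\<Sum>k\<in>K. cnj (x j k) * y j k) = of_real (\<Sum>l\<in>L. u (g l) * (cmod (ip S (a j) (v l)))\<^sup>2)"
      by (simp only: of_real_sum)
    from arg_cong[OF this, of Re] show ?thesis by (simp only: Re_sum Re_complex_of_real)
  qed
  have A': "(\<Sum>j\<in>J. \<Sum>k\<in>K. r j * Re (cnj (x j k) * y j k)) = (\<Sum>l\<in>L. u (g l) * expct S R (v l))"
    unfolding sum_distrib_left[symmetric] A expct_R
    unfolding sum_distrib_left by (subst sum.swap) (simp add: mult_ac)
  have B: "(\<Sum>j\<in>J. (cmod (y j k))\<^sup>2) = (\<Sum>l\<in>L. (u (g l))\<^sup>2 * (cmod (ip S (v l) (b k)))\<^sup>2)" for k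
    unfolding y_def U_def by (rule sum_diag_op_sq[OF ov onbs(1)])
  have B': "(\<Sum>j\<in>J. \<Sum>k\<in>K. s k * (cmod (y j k))\<^sup>2) = (\<Sum>l\<in>L. (u (g l))\<^sup>2 * expct S Q (v l))"
  proof -
    have "(\<Sum>j\<in>J. \<Sum>k\<in>K. s k * (cmod (y j k))\<^sup>2) = (\<Sum>k\<in>K. s k * (\<Sum>l\<in>L. (u (g l))\<^sup>2 * (cmod (ip S (v l) (b k)))\<^sup>2))"
      unfolding B[symmetric] sum_distrib_left by (rule sum.swap)
    also have "\<dots> = (\<Sum>l\<in>L. \<Sum>k\<in>K. (u (g l))\<^sup>2 * (s k * (cmod (ip S (b k) (v l)))\<^sup>2))"
      unfolding sum_distrib_left
      by (subst sum.swap, intro sum.cong refl) (simp add: cmod_ip_commute[of S "v _"])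
    finally show ?thesis unfolding expct_Q sum_distrib_left .
  qed
  have D: "(\<Sum>k\<in>K. (cmod (y j k))\<^sup>2) = (\<Sum>l\<in>L. (u (g l))\<^sup>2 * (cmod (ip S (v l) (a j)))\<^sup>2)" for j
    unfolding y' U_def cmod_ip_commute[of S _ "b _"] by (rule sum_diag_op_sq[OF ov onbs(2)])
  have D': "(\<Sum>j\<in>J. \<Sum>k\<in>K. r j * (cmod (y j k))\<^sup>2) = (\<Sum>l\<in>L. (u (g l))\<^sup>2 * expct S R (v l))"
  proof -
    have "(\<Sum>j\<in>J. \<Sum>k\<in>K. r j * (cmod (y j k))\<^sup>2) = (\<Sum>j\<in>J. r j * (\<Sum>l\<in>L. (u (g l))\<^sup>2 * (cmod (ip S (v l) (a j)))\<^sup>2))"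
      unfolding D[symmetric] sum_distrib_left ..
    also have "\<dots> = (\<Sum>l\<in>L. \<Sum>j\<in>J. (u (g l))\<^sup>2 * (r j * (cmod (ip S (a j) (v l)))\<^sup>2))"
      unfolding sum_distrib_left
      by (subst sum.swap, intro sum.cong refl) (simp add: cmod_ip_commute[of S "v _"])
    finally show ?thesis unfolding expct_R sum_distrib_left .
  qed
  have "(\<Sum>m\<in>M. 2 * u m * p m - (u m)\<^sup>2 * (q m + t * p m))
      = 2 * (\<Sum>m\<in>M. u m * p m) - (\<Sum>m\<in>M. (u m)\<^sup>2 * q m) - t * (\<Sum>m\<in>M. (u m)\<^sup>2 * p m)"
  proof -
    have "2 * u m * p m - (u m)\<^sup>2 * (q m + t * p m) = 2 * (u m * p m) - (u m)\<^sup>2 * q m - t * ((u m)\<^sup>2 * p m)" for m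
      by (simp add: algebra_simps)
    thus ?thesis by (simp only: sum_subtractf sum_distrib_left)
  qed
  also have "\<dots> = 2 * (\<Sum>j\<in>J. \<Sum>k\<in>K. r j * Re (cnj (x j k) * y j k))
      - (\<Sum>j\<in>J. \<Sum>k\<in>K. s k * (cmod (y j k))\<^sup>2) - t * (\<Sum>j\<in>J. \<Sum>k\<in>K. r j * (cmod (y j k))\<^sup>2)"
    unfolding A' B' D' p_def q_def group by simp
  also have "\<dots> = (\<Sum>j\<in>J. \<Sum>k\<in>K. 2 * r j * Re (cnj (x j k) * y j k) - (s k + t * r j) * (cmod (y j k))\<^sup>2)"
  proof -
    have "2 * r j * Re (cnj (x j k) * y j k) - (s k + t * r j) * (cmod (y j k))\<^sup>2
      = 2 * (r j * Re (cnj (x j k) * y j k)) - s k * (cmod (y j k))\<^sup>2 - t * (r j * (cmod (y j k))\<^sup>2)" for j k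
      by (simp only: algebra_simps)
    thus ?thesis by (simp only: sum_subtractf sum_distrib_left)
  qed
  also have "\<dots> \<le> (\<Sum>j\<in>J. \<Sum>k\<in>K. c j k * (r j)\<^sup>2 / (s k + t * r j))"
  proof (intro sum_mono)
    fix j k assume jk: "j \<in> J" "k \<in> K"
    have "s k + t * r j \<ge> 0" using s0 r0 jk t by simp
    moreover have "r j = 0 \<or> x j k = 0" if "s k + t * r j = 0"
    proof -
      have "s k = 0" using that s0 r0 jk t by (smt (verit) mult_nonneg_nonneg)
      from rs_dom[OF jk this] show ?thesis by (auto simp: c_def x_def)
    qed
    ultimately show "2 * r j * Re (cnj (x j k) * y j k) - (s k + t * r j) * (cmod (y j k))\<^sup>2
        \<le> c j k * (r j)\<^sup>2 / (s k + t * r j)"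
      using complete_square_bound[of "s k + t * r j" "r j" "x j k" "y j k"]
      unfolding c_def x_def[symmetric] by linarith
  qed
  finally show ?thesis .
qed

text \<open>The quadratic \<open>2 u p - u^2 (q + t p)\<close> is largest at
  \<open>u = p / (q + t p)\<close>; a zero denominator gives \<open>u = 0\<close> and contributes 0
  on both sides.\<close>

lemma resolvent_ineq:
  assumes t: "0 \<le> t"
  shows "(\<Sum>m\<in>M. (p m)\<^sup>2 / (q m + t * p m)) \<le> (\<Sum>j\<in>J. \<Sum>k\<in>K. c j k * (r j)\<^sup>2 / (s k + t * r j))"
proof -
  have "2 * (P / D) * P - (P / D)\<^sup>2 * D = P\<^sup>2 / D" for P D :: real
    by (cases "D = 0") (auto simp: power2_eq_square)
  thus ?thesis using variational[OF t, of "\<lambda>m. p m / (q m + t * p m)"] by simp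
qed

text \<open>Terms of weight zero are constant in \<open>t\<close>; in all others the support
  conditions make \<open>s k\<close> or \<open>q m\<close> positive, so the logarithms are
  differentiable on the whole half-line including 0.\<close>

lemma F_mono:
  assumes "0 \<le> t"
  shows "F 0 \<le> F t"
proof (rule DERIV_nonneg_imp_nondecreasing[OF assms])
  fix x :: real assume x: "0 \<le> x" "x \<le> t"
  have d1: "((\<lambda>t. c j k * r j * ln (s k + t * r j)) has_real_derivative c j k * (r j)\<^sup>2 / (s k + x * r j)) (at x)"
    if jk: "j \<in> J" "k \<in> K" for j k
  proof (cases "c j k * r j = 0")
    case False
    hence "s k > 0" using rs_dom[OF jk] s0[OF jk(2)] by force
    hence "s k + x * r j > 0" using r0[OF jk(1)] x by (simp add: add_pos_nonneg)
    thus ?thesis by (auto intro!: derivative_eq_intros simp: power2_eq_square)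
  next
    case True thus ?thesis by (auto simp: power2_eq_square)
  qed
  have d2: "((\<lambda>t. p m * ln (q m + t * p m)) has_real_derivative (p m)\<^sup>2 / (q m + x * p m)) (at x)" for m
  proof (cases "p m = 0")
    case False
    hence "q m > 0" using pq_dom[of m] pq0(2)[of m] by force
    hence "q m + x * p m > 0" using pq0(1)[of m] x by (simp add: add_pos_nonneg)
    thus ?thesis by (auto intro!: derivative_eq_intros simp: power2_eq_square)
  qed auto
  have "(F has_real_derivative (\<Sum>j\<in>J. \<Sum>k\<in>K. c j k * (r j)\<^sup>2 / (s k + x * r j)) - (\<Sum>m\<in>M. (p m)\<^sup>2 / (q m + x * p m))) (at x)"
    unfolding F_def by (intro DERIV_diff DERIV_sum d1 d2)
  thus "\<exists>y. (F has_real_derivative y) (at x) \<and> 0 \<le> y" using resolvent_ineq[OF x(1)] by force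
qed

text \<open>Once \<open>ln t\<close> has cancelled, \<open>ln (1 + x) \<le> x\<close> shows that the
  quantum part exceeds its limit by at most \<open>s k / t\<close> per unit of \<open>c j k\<close>,
  while the classical part lies above its limit for every \<open>t\<close>.\<close>

lemma F_bound:
  assumes t: "0 < t"
  shows "F t \<le> (\<Sum>j\<in>J. r j * ln (r j)) - (\<Sum>m\<in>M. p m * ln (p m)) + (\<Sum>j\<in>J. \<Sum>k\<in>K. c j k * s k) / t"
proof -
  have 1: "c j k * r j * ln (s k + t * r j) \<le> c j k * (r j * ln t + r j * ln (r j)) + c j k * s k / t"
    if jk: "j \<in> J" "k \<in> K" for j k
  proof (cases "r j = 0")
    case False
    hence r: "r j > 0" using r0[OF jk(1)] by simp
    have "s k + t * r j = (t * r j) * (1 + s k / (t * r j))" using r t by (simp add: field_simps)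
    moreover have "1 + s k / (t * r j) > 0" using r t s0[OF jk(2)] by (simp add: add_pos_nonneg)
    ultimately have "ln (s k + t * r j) = ln t + ln (r j) + ln (1 + s k / (t * r j))"
      using r t by (simp add: ln_mult)
    also have "ln (1 + s k / (t * r j)) \<le> s k / (t * r j)"
      using r t s0[OF jk(2)] by (intro ln_add_one_self_le_self) auto
    finally have "r j * ln (s k + t * r j) \<le> r j * (ln t + ln (r j) + s k / (t * r j))"
      using r by simp
    also have "\<dots> = r j * ln t + r j * ln (r j) + s k / t" using r t by (simp add: field_simps)
    finally have "c j k * (r j * ln (s k + t * r j)) \<le> c j k * (r j * ln t + r j * ln (r j) + s k / t)"
      using c0 by (intro mult_left_mono)
    thus ?thesis by (simp add: algebra_simps)
  qed (use c0 s0 jk t in auto)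
  have "(\<Sum>j\<in>J. \<Sum>k\<in>K. c j k * r j * ln (s k + t * r j))
     \<le> (\<Sum>j\<in>J. \<Sum>k\<in>K. c j k * (r j * ln t + r j * ln (r j)) + c j k * s k / t)"
    using 1 by (intro sum_mono)
  also have "\<dots> = (\<Sum>j\<in>J. r j * ln t + r j * ln (r j)) + (\<Sum>j\<in>J. \<Sum>k\<in>K. c j k * s k) / t"
  proof -
    have "(\<Sum>k\<in>K. c j k * X) = X" if "j \<in> J" for j X
      by (simp only: sum_distrib_right[symmetric] sum_c[OF that] mult_1)
    thus ?thesis by (simp only: sum.distrib sum_divide_distrib cong: sum.cong)
  qed
  finally have A: "(\<Sum>j\<in>J. \<Sum>k\<in>K. c j k * r j * ln (s k + t * r j)) \<le>
     sum r J * ln t + (\<Sum>j\<in>J. r j * ln (r j)) + (\<Sum>j\<in>J. \<Sum>k\<in>K. c j k * s k) / t"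
    by (simp only: sum.distrib sum_distrib_right)
  have 2: "p m * ln t + p m * ln (p m) \<le> p m * ln (q m + t * p m)" for m
  proof (cases "p m = 0")
    case False
    hence p: "p m > 0" using pq0(1)[of m] by simp
    have "ln (t * p m) \<le> ln (q m + t * p m)" using p t pq0(2)[of m]
      by (subst ln_le_cancel_iff) (auto simp: add_nonneg_pos)
    hence "ln t + ln (p m) \<le> ln (q m + t * p m)" using p t by (simp add: ln_mult)
    hence "p m * (ln t + ln (p m)) \<le> p m * ln (q m + t * p m)" using p by simp
    thus ?thesis by (simp add: algebra_simps)
  qed simp
  have "sum r J * ln t + (\<Sum>m\<in>M. p m * ln (p m)) = (\<Sum>m\<in>M. p m * ln t + p m * ln (p m))"
    by (simp only: sum_p[symmetric] sum.distrib sum_distrib_right)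
  also have "\<dots> \<le> (\<Sum>m\<in>M. p m * ln (q m + t * p m))" using 2 by (intro sum_mono)
  finally show ?thesis using A unfolding F_def by simp
qed

lemma measured_le:
  "(\<Sum>m\<in>M. p m * ln (p m / q m)) \<le> (\<Sum>j\<in>J. r j * ln (r j)) - (\<Sum>k\<in>K. expct S R (b k) * ln (s k))"
proof -
  define X Y where "X = (\<Sum>j\<in>J. r j * ln (r j)) - (\<Sum>m\<in>M. p m * ln (p m))"
    and "Y = (\<Sum>j\<in>J. \<Sum>k\<in>K. c j k * s k)"
  have "F 0 \<le> X + e" if e: "e > 0" for e
  proof -
    have Y: "Y \<ge> 0" unfolding Y_def using c0 s0 by (auto intro!: sum_nonneg)
    \<comment> \<open>Choosing \<open>t = (Y + 1) / e\<close> brings the error \<open>Y / t\<close>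
      below \<open>e\<close>; the added 1 keeps \<open>t\<close> positive when
      \<open>Y = 0\<close>.\<close>
    have "F 0 \<le> X + Y / ((Y + 1) / e)"
      using F_mono[of "(Y + 1) / e"] F_bound[of "(Y + 1) / e"] Y e by (simp add: X_def Y_def)
    also have "Y / ((Y + 1) / e) = e * (Y / (Y + 1))" by simp
    also have "\<dots> \<le> e * 1" using Y e by (intro mult_left_mono) auto
    finally show ?thesis by simp
  qed
  hence F0: "F 0 \<le> X" by (rule field_le_epsilon)
  have "(\<Sum>j\<in>J. \<Sum>k\<in>K. c j k * r j * ln (s k)) = (\<Sum>k\<in>K. expct S R (b k) * ln (s k))"
    by (subst sum.swap) (simp add: sum_distrib_right[symmetric] sum_c_r)
  moreover have "p m * ln (p m / q m) = p m * ln (p m) - p m * ln (q m)" for m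
  proof (cases "p m = 0")
    case False
    hence "p m > 0" "q m > 0" using pq0[of m] pq_dom[of m] by force+
    thus ?thesis by (simp add: ln_div algebra_simps)
  qed simp
  ultimately show ?thesis using F0 by (simp add: F_def X_def sum_subtractf)
qed

end

text \<open>The relative entropy Tr R ln R - Tr R ln Q in nats. The decomposition chosen for
  \<open>Q\<close> is the same for every \<open>R\<close>, so \<open>sum_qrel\<close> can average
  over \<open>R\<close> in one fixed eigenbasis.\<close>

definition qrel :: "'a set \<Rightarrow> ('a \<Rightarrow> 'a \<Rightarrow> complex) \<Rightarrow> ('a \<Rightarrow> 'a \<Rightarrow> complex) \<Rightarrow> real" where
  "qrel S R Q =
     (let (a, r) = (SOME (a, r). spectral S R {..<card S} a r);
          (b, s) = (SOME (b, s). spectral S Q {..<card S} b s)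
      in (\<Sum>j<card S. r j * ln (r j)) - (\<Sum>k<card S. expct S R (b k) * ln (s k)))"

lemma qrelE:
  assumes "finite S" "hermitian_on S Q"
  obtains b s where "spectral S Q {..<card S} b s"
    "\<And>R. hermitian_on S R \<Longrightarrow> \<exists>a r. spectral S R {..<card S} a r \<and>
      qrel S R Q = (\<Sum>j<card S. r j * ln (r j)) - (\<Sum>k<card S. expct S R (b k) * ln (s k))"
proof -
  define some where "some R = (SOME (a, r). spectral S R {..<card S} a r)" for R :: "'a \<Rightarrow> 'a \<Rightarrow> complex"
  have some: "spectral S R {..<card S} (fst (some R)) (snd (some R))" if R: "hermitian_on S R" for R
  proof -
    obtain a0 r0 where 0: "spectral S R {..<card S} a0 r0" using spectral_exists[OF assms(1) R] by blast
    have "case some R of (a, r) \<Rightarrow> spectral S R {..<card S} a r"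
      unfolding some_def by (rule someI[where x = "(a0, r0)"]) (simp add: 0)
    thus ?thesis by (simp add: split_beta)
  qed
  have "qrel S R Q = (\<Sum>j<card S. snd (some R) j * ln (snd (some R) j)) -
      (\<Sum>k<card S. expct S R (fst (some Q) k) * ln (snd (some Q) k))" for R
    unfolding qrel_def some_def[symmetric] Let_def split_beta ..
  with that[OF some[OF assms(2)]] some show ?thesis by blast
qed

lemma psd_spectral_nonneg: "psd S K \<Longrightarrow> spectral S K J e l \<Longrightarrow> j \<in> J \<Longrightarrow> 0 \<le> l j"
  using expct_eigvec unfolding psd_def by metis

theorem measured_relative_entropy:
  assumes "psd S R" "psd S Q" and dom: "\<And>u. expct S Q u = 0 \<Longrightarrow> expct S R u = 0"
    and "onb S L v" "finite M" "\<And>l. l \<in> L \<Longrightarrow> g l \<in> M"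
  shows "(\<Sum>m\<in>M. (\<Sum>l\<in>{l\<in>L. g l = m}. expct S R (v l)) *
      ln ((\<Sum>l\<in>{l\<in>L. g l = m}. expct S R (v l)) / (\<Sum>l\<in>{l\<in>L. g l = m}. expct S Q (v l)))) \<le> qrel S R Q"
proof -
  have fS: "finite S" using onb_finite assms(4) by blast
  have her: "hermitian_on S R" "hermitian_on S Q" using assms by (auto simp: psd_def)
  obtain b s where b: "spectral S Q {..<card S} b s"
    and R: "\<And>R. hermitian_on S R \<Longrightarrow> \<exists>a r. spectral S R {..<card S} a r \<and>
      qrel S R Q = (\<Sum>j<card S. r j * ln (r j)) - (\<Sum>k<card S. expct S R (b k) * ln (s k))"
    using qrelE[OF fS her(2)] by blast
  obtain a r where a: "spectral S R {..<card S} a r"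
    and q: "qrel S R Q = (\<Sum>j<card S. r j * ln (r j)) - (\<Sum>k<card S. expct S R (b k) * ln (s k))"
    using R[OF her(1)] by blast
  interpret measured_pair S R Q "{..<card S}" a r "{..<card S}" b s L v M g
  proof
    show "0 \<le> r j" if "j \<in> {..<card S}" for j by (rule psd_spectral_nonneg[OF assms(1) a that])
    show "0 \<le> s k" if "k \<in> {..<card S}" for k by (rule psd_spectral_nonneg[OF assms(2) b that])
    show "expct S R (b k) = 0" if "k \<in> {..<card S}" "s k = 0" for k
      using dom expct_eigvec[OF b that(1)] that(2) by simp
  qed (use assms a b in blast)+
  show ?thesis using measured_le unfolding q p_def q_def .
qed

text \<open>Measure in the eigenbasis of \<open>Q\<close> and merge all outcomes into one: the
  classical side becomes \<open>p ln (p / q)\<close> with \<open>p = q\<close> by the trace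
  condition, which is 0.\<close>

lemma klein:
  assumes a: "spectral S R J a r" and b: "spectral S Q K b s" and "psd S R" "psd S Q"
    and dom: "\<And>k. k \<in> K \<Longrightarrow> s k = 0 \<Longrightarrow> expct S R (b k) = 0"
    and tr: "(\<Sum>x\<in>S. Re (R x x)) = (\<Sum>x\<in>S. Re (Q x x))"
  shows "(\<Sum>k\<in>K. expct S R (b k) * ln (s k)) \<le> (\<Sum>j\<in>J. r j * ln (r j))"
proof -
  have ob: "onb S K b" using b by (simp add: spectral_def)
  interpret measured_pair S R Q J a r K b s K b "{()}" "\<lambda>_. ()"
  proof
    show "0 \<le> r j" if "j \<in> J" for j by (rule psd_spectral_nonneg[OF assms(3) a that])
    show "0 \<le> s k" if "k \<in> K" for k by (rule psd_spectral_nonneg[OF assms(4) b that])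
    show "expct S R (b k) = 0" if "k \<in> K" "expct S Q (b k) = 0" for k
      using dom[OF that(1)] that expct_eigvec[OF b that(1)] by simp
  qed (use ob dom a b in auto)
  have "p () = (\<Sum>x\<in>S. Re (R x x))" "q () = (\<Sum>x\<in>S. Re (Q x x))"
    unfolding p_def q_def using sum_expct_onb[OF ob] by simp_all
  hence "p () = q ()" using tr by simp
  hence "p () * ln (p () / q ()) = 0" by simp
  thus ?thesis using measured_le by simp
qed

section \<open>Von Neumann entropy and the Holevo quantity\<close>

lemma ln2_eta: "0 \<le> t \<Longrightarrow> ln 2 * eta t = t * ln t"
  by (auto simp: eta_def log_def)

lemma vn_entropy_ln:
  assumes "psd (basis d S) R" "spectral (basis d S) R J a r"
  shows "(\<Sum>j\<in>J. r j * ln (r j)) = - ln 2 * vn_entropy d S R"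
proof -
  have "ln 2 * (\<Sum>j\<in>J. eta (r j)) = (\<Sum>j\<in>J. r j * ln (r j))"
    unfolding sum_distrib_left using psd_spectral_nonneg[OF assms] ln2_eta by (intro sum.cong refl) auto
  thus ?thesis unfolding vn_entropy_spectral[OF assms(2)] by simp
qed

lemma expct_lincomb:
  assumes "\<And>a b. a \<in> S \<Longrightarrow> b \<in> S \<Longrightarrow> Q a b = (\<Sum>i\<in>I. of_real (w i) * R i a b)"
  shows "expct S Q u = (\<Sum>i\<in>I. w i * expct S (R i) u)"
proof -
  have "sesq S Q u u = (\<Sum>a\<in>S. \<Sum>b\<in>S. \<Sum>i\<in>I. of_real (w i) * (cnj (u a) * R i a b * u b))"
    unfolding sesq_def
    by (intro sum.cong refl) (simp add: assms sum_distrib_left sum_distrib_right mult_ac)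
  also have "\<dots> = (\<Sum>a\<in>S. \<Sum>i\<in>I. \<Sum>b\<in>S. of_real (w i) * (cnj (u a) * R i a b * u b))"
    by (intro sum.cong refl sum.swap)
  also have "\<dots> = (\<Sum>i\<in>I. of_real (w i) * sesq S (R i) u u)"
    unfolding sesq_def sum_distrib_left by (rule sum.swap)
  finally show ?thesis unfolding expct_def by simp
qed

lemma hermitian_lincomb:
  assumes "\<And>a b. a \<in> S \<Longrightarrow> b \<in> S \<Longrightarrow> Q a b = (\<Sum>i\<in>I. of_real (w i) * R i a b)"
    and "\<And>i. i \<in> I \<Longrightarrow> hermitian_on S (R i)"
  shows "hermitian_on S Q"
  using assms by (auto simp: hermitian_on_def intro!: sum.cong)

lemma psd_lincomb:
  assumes Q: "\<And>a b. a \<in> S \<Longrightarrow> b \<in> S \<Longrightarrow> Q a b = (\<Sum>i\<in>I. of_real (w i) * R i a b)"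
    and "\<And>i. i \<in> I \<Longrightarrow> psd S (R i)" "\<And>i. i \<in> I \<Longrightarrow> 0 \<le> w i"
  shows "psd S Q"
  using assms hermitian_lincomb[of S Q w R I] by (auto simp: psd_def expct_lincomb[OF Q] intro!: sum_nonneg)

text \<open>By linearity of the trace, averaging the terms - Tr R_i ln Q replaces R_i by
  \<open>Q\<close> and leaves the entropy of \<open>Q\<close>. The average divergence from the mean
  is thus the Holevo quantity, converted from bits to nats.\<close>

lemma sum_qrel:
  assumes fin: "finite (basis d S)"
    and Q: "\<And>a b. a \<in> basis d S \<Longrightarrow> b \<in> basis d S \<Longrightarrow> Q a b = (\<Sum>i\<in>I. of_real (w i) * R i a b)"
    and R: "\<And>i. i \<in> I \<Longrightarrow> psd (basis d S) (R i)" and w: "\<And>i. i \<in> I \<Longrightarrow> 0 \<le> w i"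
  shows "(\<Sum>i\<in>I. w i * qrel (basis d S) (R i) Q) = ln 2 * (vn_entropy d S Q - (\<Sum>i\<in>I. w i * vn_entropy d S (R i)))"
proof -
  let ?S = "basis d S"
  have pQ: "psd ?S Q" by (rule psd_lincomb[OF Q R w])
  obtain b s where b: "spectral ?S Q {..<card ?S} b s"
    and q: "\<And>R. hermitian_on ?S R \<Longrightarrow> \<exists>a r. spectral ?S R {..<card ?S} a r \<and>
      qrel ?S R Q = (\<Sum>j<card ?S. r j * ln (r j)) - (\<Sum>k<card ?S. expct ?S R (b k) * ln (s k))"
    by (rule qrelE[OF fin, of Q]) (use pQ in \<open>auto simp: psd_def\<close>)
  have q': "qrel ?S (R i) Q = - ln 2 * vn_entropy d S (R i) - (\<Sum>k<card ?S. expct ?S (R i) (b k) * ln (s k))" if i: "i \<in> I" for i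
  proof -
    obtain a r where a: "spectral ?S (R i) {..<card ?S} a r"
      and e: "qrel ?S (R i) Q = (\<Sum>j<card ?S. r j * ln (r j)) - (\<Sum>k<card ?S. expct ?S (R i) (b k) * ln (s k))"
      using q[of "R i"] R[OF i] unfolding psd_def by blast
    show ?thesis unfolding e vn_entropy_ln[OF R[OF i] a] ..
  qed
  have "(\<Sum>i\<in>I. w i * (\<Sum>k<card ?S. expct ?S (R i) (b k) * ln (s k)))
      = (\<Sum>k<card ?S. (\<Sum>i\<in>I. w i * expct ?S (R i) (b k)) * ln (s k))"
    unfolding sum_distrib_left sum_distrib_right by (subst sum.swap) (simp add: mult_ac)
  also have "\<dots> = (\<Sum>k<card ?S. s k * ln (s k))"
    using expct_eigvec[OF b] by (intro sum.cong refl) (simp add: expct_lincomb[OF Q, symmetric])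
  also have "\<dots> = - ln 2 * vn_entropy d S Q" by (rule vn_entropy_ln[OF pQ b])
  finally have 1: "(\<Sum>i\<in>I. w i * (\<Sum>k<card ?S. expct ?S (R i) (b k) * ln (s k))) = - ln 2 * vn_entropy d S Q" .
  have "(\<Sum>i\<in>I. w i * qrel ?S (R i) Q) = (\<Sum>i\<in>I. - ln 2 * (w i * vn_entropy d S (R i)) - w i * (\<Sum>k<card ?S. expct ?S (R i) (b k) * ln (s k)))"
    by (intro sum.cong refl) (simp add: q' right_diff_distrib mult.left_commute)
  also have "\<dots> = - ln 2 * (\<Sum>i\<in>I. w i * vn_entropy d S (R i)) - (- ln 2 * vn_entropy d S Q)"
    by (simp only: sum_subtractf 1 sum_distrib_left[of "- ln 2"])
  finally show ?thesis by (simp add: algebra_simps)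
qed

text \<open>Pinsker's inequality through the Hellinger distance: \<open>ln x \<le> x - 1\<close> at
  \<open>sqrt (q / p)\<close> gives \<open>p - q + (sqrt p - sqrt q)^2\<close>, and
  \<open>p - q\<close> is at most twice \<open>sqrt p - sqrt q\<close> in modulus on the unit
  interval. The linear part stays because it cancels when summed over the outcomes.\<close>

lemma kl_term_ge:
  fixes p q :: real
  assumes "0 \<le> p" "p \<le> 1" "0 \<le> q" "q \<le> 1" "q = 0 \<Longrightarrow> p = 0"
  shows "p - q + (p - q)\<^sup>2 / 4 \<le> p * ln (p / q)"
proof (cases "p = 0")
  case True
  have "q * q \<le> q" using assms by (simp add: mult_left_le)
  thus ?thesis using True assms by (simp add: power2_eq_square)
next
  case False
  hence p: "p > 0" and q: "q > 0" using assms by force+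
  have "ln (sqrt (q / p)) \<le> sqrt (q / p) - 1" using p q by (intro ln_le_minus_one) simp
  hence "ln (q / p) \<le> 2 * sqrt (q / p) - 2" using p q by (simp add: ln_sqrt)
  hence "ln (p / q) \<ge> 2 - 2 * sqrt (q / p)" using p q by (simp add: ln_div)
  hence "p * (2 - 2 * sqrt (q / p)) \<le> p * ln (p / q)" using p by simp
  moreover have "p * sqrt (q / p) = sqrt p * sqrt q"
  proof -
    have "p * sqrt (q / p) = (sqrt p * sqrt p) * (sqrt q / sqrt p)" using p by (simp add: real_sqrt_divide)
    also have "\<dots> = sqrt p * sqrt q" using p by (simp del: real_sqrt_mult_self)
    finally show ?thesis .
  qed
  ultimately have 1: "2 * p - 2 * (sqrt p * sqrt q) \<le> p * ln (p / q)" by (simp add: algebra_simps)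
  have sq: "sqrt p * sqrt p = p" "sqrt q * sqrt q = q" using p q by auto
  have 2: "(sqrt p - sqrt q)\<^sup>2 = p + q - 2 * (sqrt p * sqrt q)"
    using p q by (simp add: power2_eq_square algebra_simps sq)
  have "p - q = (sqrt p - sqrt q) * (sqrt p + sqrt q)" using p q by (simp add: algebra_simps sq)
  hence "(p - q)\<^sup>2 = (sqrt p - sqrt q)\<^sup>2 * (sqrt p + sqrt q)\<^sup>2" by (simp add: power_mult_distrib)
  also have "\<dots> \<le> (sqrt p - sqrt q)\<^sup>2 * 2\<^sup>2"
  proof (intro mult_left_mono power_mono)
    have "sqrt p \<le> 1" "sqrt q \<le> 1" using assms by auto
    thus "sqrt p + sqrt q \<le> 2" by linarith
  qed (use p q in auto)
  finally show ?thesis using 1 2 by simp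
qed

text \<open>Both states are compared with their average by the measurement that reports only
  \<open>g\<close>. The bias \<open>t\<close> shifts each of the two outcome probabilities by
  \<open>t / 2\<close> from that of \<open>Q\<close>, so \<open>kl_term_ge\<close> yields
  \<open>2 (t / 2)^2 / 4 = t^2 / 8\<close> for either state.\<close>

lemma binary_holevo:
  assumes fin: "finite (basis d S)"
    and p0: "psd (basis d S) R0" and p1: "psd (basis d S) R1"
    and t0: "(\<Sum>a\<in>basis d S. Re (R0 a a)) = 1" and t1: "(\<Sum>a\<in>basis d S. Re (R1 a a)) = 1"
    and Q: "\<And>a b. a \<in> basis d S \<Longrightarrow> b \<in> basis d S \<Longrightarrow> Q a b = (R0 a b + R1 a b) / 2"
    and ob: "onb (basis d S) L v"
  shows "((\<Sum>l\<in>L. (if g l then 1 else -1) * (expct (basis d S) R0 (v l) - expct (basis d S) R1 (v l))) / 2)\<^sup>2 / 8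
    \<le> vn_entropy d S Q - (vn_entropy d S R0 + vn_entropy d S R1) / 2"
proof -
  let ?S = "basis d S"
  define R where "R i = (if i then R1 else R0)" for i
  have psd: "psd ?S (R i)" for i using p0 p1 by (simp add: R_def)
  have tr: "(\<Sum>a\<in>?S. Re (R i a a)) = 1" for i using t0 t1 by (simp add: R_def)
  have Q': "Q a b = (\<Sum>i\<in>UNIV. of_real (1 / 2) * R i a b)" if "a \<in> ?S" "b \<in> ?S" for a b
    using Q[OF that] by (simp add: UNIV_bool R_def field_simps)
  have pQ: "psd ?S Q" by (rule psd_lincomb[OF Q']) (use psd in auto)
  have eQ: "expct ?S Q u = (expct ?S (R True) u + expct ?S (R False) u) / 2" for u
    using expct_lincomb[OF Q', where u = u] by (simp add: UNIV_bool)
  define P where "P i m = (\<Sum>l\<in>{l\<in>L. g l = m}. expct ?S (R i) (v l))" for i m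
  define PQ where "PQ m = (\<Sum>l\<in>{l\<in>L. g l = m}. expct ?S Q (v l))" for m
  have fL: "finite L" using onb_finite[OF ob] by simp
  have split: "(\<Sum>l\<in>L. h l) = (\<Sum>l\<in>{l\<in>L. g l = True}. h l) + (\<Sum>l\<in>{l\<in>L. g l = False}. h l)" for h :: "_ \<Rightarrow> real"
  proof -
    have "(\<Sum>l\<in>L. h l) = (\<Sum>l\<in>{l\<in>L. g l = True} \<union> {l\<in>L. g l = False}. h l)"
      by (rule sum.cong) auto
    thus ?thesis using fL by (subst (asm) sum.union_disjoint) auto
  qed
  have P1: "P i True + P i False = 1" for i
    unfolding P_def split[symmetric] sum_expct_onb[OF ob] tr ..
  have P0: "0 \<le> P i m" for i m unfolding P_def using psd by (intro sum_nonneg) (auto simp: psd_def)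
  have PQ: "PQ m = (P True m + P False m) / 2" for m
    unfolding PQ_def P_def eQ by (simp add: sum.distrib sum_divide_distrib[symmetric])
  define t where "t = P False True - P True True"
  have t: "(\<Sum>l\<in>L. (if g l then 1 else -1) * (expct ?S R0 (v l) - expct ?S R1 (v l))) / 2 = t"
  proof -
    have "(\<Sum>l\<in>L. (if g l then 1 else -1) * (expct ?S R0 (v l) - expct ?S R1 (v l)))
       = (P False True - P True True) - (P False False - P True False)"
      unfolding split P_def by (simp add: R_def sum_subtractf sum_negf)
    thus ?thesis using P1[of True] P1[of False] by (simp add: t_def)
  qed
  have kl: "t\<^sup>2 / 8 \<le> qrel ?S (R i) Q" for i
  proof -
    have "(\<Sum>m\<in>UNIV. P i m * ln (P i m / PQ m)) \<le> qrel ?S (R i) Q"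
      unfolding P_def PQ_def
    proof (rule measured_relative_entropy[OF psd pQ _ ob])
      fix u assume 0: "expct ?S Q u = 0"
      have "0 \<le> expct ?S (R j) u" for j using psd by (simp add: psd_def)
      moreover have "expct ?S (R True) u + expct ?S (R False) u = 0" using eQ[of u] 0 by simp
      ultimately have "expct ?S (R True) u = 0 \<and> expct ?S (R False) u = 0"
        by (simp add: add_nonneg_eq_0_iff)
      thus "expct ?S (R i) u = 0" by (cases i) auto
    qed auto
    moreover have "P i m - PQ m + (P i m - PQ m)\<^sup>2 / 4 \<le> P i m * ln (P i m / PQ m)" for m
    proof (rule kl_term_ge)
      have le: "P j m \<le> 1" for j using P1[of j] P0[of j True] P0[of j False] by (cases m) auto
      show "P i m \<le> 1" by (rule le)
      show "0 \<le> P i m" by (rule P0)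
      show "0 \<le> PQ m" "PQ m \<le> 1" using le[of True] le[of False] P0[of True m] P0[of False m] by (auto simp: PQ)
      show "PQ m = 0 \<Longrightarrow> P i m = 0" using P0[of True m] P0[of False m] by (cases i) (auto simp: PQ)
    qed
    hence "(\<Sum>m\<in>UNIV. P i m - PQ m + (P i m - PQ m)\<^sup>2 / 4) \<le> (\<Sum>m\<in>UNIV. P i m * ln (P i m / PQ m))"
      by (intro sum_mono)
    moreover have "(\<Sum>m\<in>UNIV. P i m - PQ m + (P i m - PQ m)\<^sup>2 / 4) = t\<^sup>2 / 8"
    proof -
      have "P i True - PQ True = (if i then - t / 2 else t / 2)" by (auto simp: PQ t_def field_simps)
      moreover have "P i False - PQ False = (if i then t / 2 else - t / 2)"
        using P1[of True] P1[of False] by (auto simp: PQ t_def field_simps)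
      ultimately show ?thesis by (simp add: UNIV_bool power2_eq_square)
    qed
    ultimately show ?thesis by simp
  qed
  define X where "X = vn_entropy d S Q - (vn_entropy d S R0 + vn_entropy d S R1) / 2"
  have "(\<Sum>i\<in>UNIV. (1 / 2) * qrel ?S (R i) Q) = ln 2 * (vn_entropy d S Q - (\<Sum>i\<in>UNIV. (1 / 2) * vn_entropy d S (R i)))"
    by (rule sum_qrel[OF fin Q' psd]) auto
  also have "\<dots> = ln 2 * X" by (simp add: UNIV_bool R_def X_def field_simps)
  finally have "t\<^sup>2 / 8 \<le> ln 2 * X" using kl[of True] kl[of False] by (simp add: UNIV_bool)
  \<comment> \<open>From nats to bits: the factor \<open>ln 2\<close> is simply dropped, which is
    sound because \<open>X\<close> is nonnegative.\<close>
  also have "\<dots> \<le> 1 * X"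
  proof (rule mult_right_mono)
    show "ln 2 \<le> (1 :: real)" using ln_2_less_1 by simp
    have "0 \<le> t\<^sup>2 / 8" by simp
    hence "0 \<le> ln 2 * X" using calculation by linarith
    thus "0 \<le> X" by (simp add: zero_le_mult_iff)
  qed
  finally show ?thesis unfolding t X_def by simp
qed

section \<open>Gram operators V V^*, the reduced states of a bipartite pure state with amplitudes
  \<open>V a b\<close>\<close>

definition gram :: "'c set \<Rightarrow> ('a \<Rightarrow> 'c \<Rightarrow> complex) \<Rightarrow> 'a \<Rightarrow> 'a \<Rightarrow> complex" where
  "gram B V = (\<lambda>a a'. \<Sum>b\<in>B. V a b * cnj (V a' b))"

lemma sesq_gram:
  "sesq S (gram B V) u w = (\<Sum>b\<in>B. (\<Sum>a\<in>S. cnj (u a) * V a b) * cnj (\<Sum>a\<in>S. cnj (w a) * V a b))"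
proof -
  have "sesq S (gram B V) u w = (\<Sum>a\<in>S. \<Sum>a'\<in>S. \<Sum>b\<in>B. (cnj (u a) * V a b) * cnj (cnj (w a') * V a' b))"
    unfolding sesq_def gram_def by (simp add: sum_distrib_left sum_distrib_right mult_ac)
  also have "\<dots> = (\<Sum>b\<in>B. (\<Sum>a\<in>S. cnj (u a) * V a b) * cnj (\<Sum>a'\<in>S. cnj (w a') * V a' b))"
    unfolding cnj_sum sum_product
    by (subst (2) sum.swap, subst sum.swap) (intro sum.cong refl sum.swap)
  finally show ?thesis .
qed

lemma expct_gram: "expct S (gram B V) u = (\<Sum>b\<in>B. (cmod (\<Sum>a\<in>S. cnj (u a) * V a b))\<^sup>2)"
  unfolding expct_def sesq_gram complex_norm_square[symmetric] of_real_sum[symmetric] Re_complex_of_real ..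

lemma psd_gram: "psd S (gram B V)"
  unfolding psd_def expct_gram by (auto simp: hermitian_on_def gram_def mult.commute intro!: sum_nonneg)

lemma trace_gram: "(\<Sum>a\<in>S. Re (gram B V a a)) = (\<Sum>a\<in>S. \<Sum>b\<in>B. (cmod (V a b))\<^sup>2)"
  unfolding gram_def Re_sum complex_norm_square[symmetric] Re_complex_of_real ..

lemma sum_reverse4:
  "(\<Sum>x\<in>A. \<Sum>y\<in>B. \<Sum>z\<in>C. \<Sum>w\<in>D. f x y z w) = (\<Sum>w\<in>D. \<Sum>z\<in>C. \<Sum>y\<in>B. \<Sum>x\<in>A. (f x y z w :: complex))"
proof -
  have "(\<Sum>x\<in>A. \<Sum>y\<in>B. \<Sum>z\<in>C. \<Sum>w\<in>D. f x y z w) = (\<Sum>x\<in>A. \<Sum>y\<in>B. \<Sum>w\<in>D. \<Sum>z\<in>C. f x y z w)"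
    by (rule sum.cong[OF refl], rule sum.cong[OF refl], rule sum.swap)
  also have "\<dots> = (\<Sum>x\<in>A. \<Sum>w\<in>D. \<Sum>y\<in>B. \<Sum>z\<in>C. f x y z w)"
    by (rule sum.cong[OF refl], rule sum.swap)
  also have "\<dots> = (\<Sum>w\<in>D. \<Sum>x\<in>A. \<Sum>y\<in>B. \<Sum>z\<in>C. f x y z w)"
    by (rule sum.swap)
  also have "\<dots> = (\<Sum>w\<in>D. \<Sum>x\<in>A. \<Sum>z\<in>C. \<Sum>y\<in>B. f x y z w)"
    by (rule sum.cong[OF refl], rule sum.cong[OF refl], rule sum.swap)
  also have "\<dots> = (\<Sum>w\<in>D. \<Sum>z\<in>C. \<Sum>x\<in>A. \<Sum>y\<in>B. f x y z w)"
    by (rule sum.cong[OF refl], rule sum.swap)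
  also have "\<dots> = (\<Sum>w\<in>D. \<Sum>z\<in>C. \<Sum>y\<in>B. \<Sum>x\<in>A. f x y z w)"
    by (rule sum.cong[OF refl], rule sum.cong[OF refl], rule sum.swap)
  finally show ?thesis .
qed

text \<open>Both sides equal the sum of \<open>\<bar>\<langle>a\<^sub>m|V e\<^sub>j\<rangle>\<bar>\<^sup>2 * f \<alpha>\<^sub>m\<close> over all pairs of
  eigenvectors: the weight vanishes unless the two eigenvalues agree.\<close>
lemma gram_complement:
  assumes 1: "spectral A (gram B V) J a \<alpha>" and 2: "spectral B (gram A (\<lambda>b a. V a b)) L e \<beta>"
  shows "(\<Sum>m\<in>J. \<alpha> m * f (\<alpha> m)) = (\<Sum>j\<in>L. \<beta> j * f (\<beta> j))"
proof -
  have o: "onb A J a" "onb B L e" using assms by (auto simp: spectral_def)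
  define h where "h m b = (\<Sum>x\<in>A. cnj (a m x) * V x b)" for m b
  define k where "k j x = (\<Sum>b\<in>B. cnj (e j b) * V x b)" for j x
  define X where "X m j = ip B (e j) (h m)" for m j
  have X': "X m j = ip A (a m) (k j)" for m j
    unfolding X_def ip_def h_def k_def sum_distrib_left by (subst sum.swap) (simp add: mult_ac)
  have s1: "(\<Sum>j\<in>L. (cmod (X m j))\<^sup>2) = \<alpha> m" if "m \<in> J" for m
    unfolding X_def parseval_norm[OF o(2)] using expct_eigvec[OF 1 that] by (simp add: expct_gram h_def)
  have s2: "(\<Sum>m\<in>J. (cmod (X m j))\<^sup>2) = \<beta> j" if "j \<in> L" for j
    unfolding X' parseval_norm[OF o(1)] using expct_eigvec[OF 2 that] by (simp add: expct_gram k_def)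
  have "sesq A (gram B V) (a m) (k j) = sesq B (gram A (\<lambda>b a. V a b)) (e j) (h m)" for m j
  proof -
    have "sesq A (gram B V) (a m) (k j)
       = (\<Sum>x\<in>A. \<Sum>y\<in>A. \<Sum>b\<in>B. \<Sum>c\<in>B. cnj (a m x) * V x b * cnj (V y b) * (cnj (e j c) * V y c))"
      unfolding sesq_def gram_def k_def sum_distrib_left sum_distrib_right
      by (rule sum.cong[OF refl], rule sum.cong[OF refl], subst sum.swap) (simp add: mult_ac)
    also have "\<dots> = (\<Sum>c\<in>B. \<Sum>b\<in>B. \<Sum>y\<in>A. \<Sum>x\<in>A. cnj (a m x) * V x b * cnj (V y b) * (cnj (e j c) * V y c))"
      by (rule sum_reverse4)
    also have "\<dots> = sesq B (gram A (\<lambda>b a. V a b)) (e j) (h m)"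
      unfolding sesq_def gram_def h_def sum_distrib_left sum_distrib_right
      by (rule sum.cong[OF refl], rule sum.cong[OF refl], subst sum.swap) (simp add: mult_ac)
    finally show ?thesis .
  qed
  hence ab: "of_real (\<alpha> m) * X m j = of_real (\<beta> j) * X m j" if "m \<in> J" "j \<in> L" for m j
    using sesq_eigvec(1)[OF 1 that(1), of "k j"] sesq_eigvec(1)[OF 2 that(2), of "h m"]
    unfolding X'[symmetric] X_def[symmetric] by metis
  have eq: "(cmod (X m j))\<^sup>2 * f (\<alpha> m) = (cmod (X m j))\<^sup>2 * f (\<beta> j)" if "m \<in> J" "j \<in> L" for m j
    using ab[OF that] by auto
  have "(\<Sum>m\<in>J. \<alpha> m * f (\<alpha> m)) = (\<Sum>m\<in>J. \<Sum>j\<in>L. (cmod (X m j))\<^sup>2 * f (\<alpha> m))"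
    by (intro sum.cong refl) (simp add: sum_distrib_right[symmetric] s1)
  also have "\<dots> = (\<Sum>j\<in>L. \<Sum>m\<in>J. (cmod (X m j))\<^sup>2 * f (\<beta> j))"
    using eq by (subst sum.swap) (auto intro!: sum.cong)
  also have "\<dots> = (\<Sum>j\<in>L. \<beta> j * f (\<beta> j))"
    by (intro sum.cong refl) (simp add: sum_distrib_right[symmetric] s2)
  finally show ?thesis .
qed

lemma vn_entropy_complement:
  assumes "finite (basis d S)" "finite (basis d T)"
  shows "vn_entropy d S (gram (basis d T) V) = vn_entropy d T (gram (basis d S) (\<lambda>b a. V a b))"
proof -
  let ?A = "basis d S" and ?B = "basis d T"
  note p = psd_gram[of ?A ?B V] psd_gram[of ?B ?A "\<lambda>b a. V a b"]
  obtain a \<alpha> where 1: "spectral ?A (gram ?B V) {..<card ?A} a \<alpha>"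
    using spectral_exists[OF assms(1)] p(1) unfolding psd_def by blast
  obtain e \<beta> where 2: "spectral ?B (gram ?A (\<lambda>b a. V a b)) {..<card ?B} e \<beta>"
    using spectral_exists[OF assms(2)] p(2) unfolding psd_def by blast
  show ?thesis
    using gram_complement[OF 1 2, of ln] vn_entropy_ln[OF p(1) 1] vn_entropy_ln[OF p(2) 2] by simp
qed

section \<open>Fidelity and relative entropy\<close>

text \<open>Bessel's inequality for the unit vector at \<open>l0\<close>: its projection
  \<open>w\<close> onto the span of the \<open>u m\<close> has squared norm \<open>s\<close> and
  also the value \<open>s\<close> at \<open>l0\<close>, whence \<open>s^2 \<le> s\<close>.\<close>

lemma bessel_point:
  fixes u :: "'m \<Rightarrow> 'l \<Rightarrow> complex"
  assumes fin: "finite M" "finite L" and l0: "l0 \<in> L"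
    and on: "\<And>m n. m \<in> M \<Longrightarrow> n \<in> M \<Longrightarrow> (\<Sum>l\<in>L. u m l * cnj (u n l)) = of_bool (m = n)"
  shows "(\<Sum>m\<in>M. (cmod (u m l0))\<^sup>2) \<le> 1"
proof -
  define s where "s = (\<Sum>m\<in>M. (cmod (u m l0))\<^sup>2)"
  define w where "w l = (\<Sum>m\<in>M. u m l * cnj (u m l0))" for l
  have "w l0 = of_real s" unfolding w_def s_def of_real_sum complex_norm_square ..
  have "of_real (\<Sum>l\<in>L. (cmod (w l))\<^sup>2)
      = (\<Sum>l\<in>L. \<Sum>m\<in>M. \<Sum>n\<in>M. (u m l * cnj (u m l0)) * cnj (u n l * cnj (u n l0)))"
    unfolding of_real_sum complex_norm_square w_def cnj_sum sum_product ..
  also have "\<dots> = (\<Sum>m\<in>M. \<Sum>n\<in>M. \<Sum>l\<in>L. (u m l * cnj (u m l0)) * cnj (u n l * cnj (u n l0)))"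
    by (subst sum.swap, rule sum.cong[OF refl], rule sum.swap)
  also have "\<dots> = (\<Sum>m\<in>M. \<Sum>n\<in>M. cnj (u m l0) * u n l0 * (\<Sum>l\<in>L. u m l * cnj (u n l)))"
    unfolding sum_distrib_left by (simp add: mult_ac)
  also have "\<dots> = (\<Sum>m\<in>M. \<Sum>n\<in>M. if m = n then cnj (u m l0) * u n l0 else 0)"
    by (intro sum.cong refl) (simp add: on)
  also have "\<dots> = (\<Sum>m\<in>M. u m l0 * cnj (u m l0))"
    using fin by (simp add: mult.commute)
  also have "\<dots> = of_real s" unfolding s_def of_real_sum complex_norm_square ..
  finally have "(\<Sum>l\<in>L. (cmod (w l))\<^sup>2) = s" by (simp only: of_real_eq_iff)
  moreover have "(cmod (w l0))\<^sup>2 \<le> (\<Sum>l\<in>L. (cmod (w l))\<^sup>2)"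
    by (rule member_le_sum) (use fin l0 in auto)
  ultimately have "s\<^sup>2 \<le> s" using \<open>w l0 = of_real s\<close> by simp
  moreover have "0 \<le> s" unfolding s_def by (intro sum_nonneg) simp
  ultimately show ?thesis unfolding s_def[symmetric]
    by (cases "s = 0") (auto simp: power2_eq_square)
qed

text \<open>Fuchs--Caves: measuring in the eigenbasis of \<open>V C V\<^sup>*\<close> with
  \<open>C = (\<bar>N\<bar> + \<delta>)\<^sup>-\<^sup>1\<close>, \<open>N = V\<^sup>* D V = diag \<nu>\<close>, reduces the fidelity of
  \<open>V V\<^sup>*\<close> and \<open>D V V\<^sup>* D\<close> to the trace norm of \<open>N\<close>; the regularisation \<open>\<delta>\<close>
  avoids all inverses of singular operators.\<close>
lemma fuchs_caves:
  fixes V :: "'a \<Rightarrow> 'l \<Rightarrow> complex" and D :: "'a \<Rightarrow> real" and \<nu> :: "'l \<Rightarrow> real"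
  assumes fin: "finite A" "finite L" and \<delta>: "0 < \<delta>"
    and N: "\<And>l k. l \<in> L \<Longrightarrow> k \<in> L \<Longrightarrow>
       (\<Sum>a\<in>A. of_real (D a) * V a l * cnj (V a k)) = (if l = k then of_real (\<nu> l) else 0)"
  shows "\<exists>e. onb A {..<card A} e \<and>
    (\<Sum>m<card A. sqrt (expct A (gram L V) (e m)) * sqrt (expct A (gram L V) (\<lambda>a. of_real (D a) * e m a)))
      \<le> (\<Sum>l\<in>L. \<bar>\<nu> l\<bar> + \<delta>)"
proof -
  define c where "c l = \<bar>\<nu> l\<bar> + \<delta>" for l
  have c: "c l > 0" for l using \<delta> by (simp add: c_def add_nonneg_pos)
  define W where "W a l = V a l / of_real (sqrt (c l))" for a l
  obtain e \<kappa> where sp: "spectral A (gram L W) {..<card A} e \<kappa>"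
    using spectral_exists[OF fin(1)] psd_gram[of A L W] unfolding psd_def by blast
  have oe: "onb A {..<card A} e" using sp by (simp add: spectral_def)
  have \<kappa>0: "0 \<le> \<kappa> m" if "m < card A" for m
    using psd_spectral_nonneg[OF psd_gram sp] that by simp
  define h where "h m l = (\<Sum>a\<in>A. cnj (e m a) * V a l)" for m l
  define g where "g m l = (\<Sum>a\<in>A. cnj (e m a) * W a l)" for m l
  have gh: "(cmod (h m l))\<^sup>2 = c l * (cmod (g m l))\<^sup>2" for m l
  proof -
    have "g m l = h m l / of_real (sqrt (c l))"
      unfolding g_def h_def W_def sum_divide_distrib by simp
    thus ?thesis using c[of l] by (simp add: norm_divide power_divide)
  qed
  have gg: "(\<Sum>l\<in>L. g m l * cnj (g n l)) = (if m = n then of_real (\<kappa> m) else 0)"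
    if "m < card A" "n < card A" for m n
  proof -
    have "(\<Sum>l\<in>L. g m l * cnj (g n l)) = sesq A (gram L W) (e m) (e n)"
      unfolding sesq_gram g_def ..
    also have "\<dots> = of_real (\<kappa> m) * ip A (e m) (e n)" using sesq_eigvec(1)[OF sp] that by simp
    also have "ip A (e m) (e n) = of_bool (m = n)" using oe that by (simp add: onb_def)
    finally show ?thesis by simp
  qed
  define p where "p m = expct A (gram L V) (e m)" for m
  define q where "q m = expct A (gram L V) (\<lambda>a. of_real (D a) * e m a)" for m
  have p: "p m = (\<Sum>l\<in>L. c l * (cmod (g m l))\<^sup>2)" for m
    unfolding p_def expct_gram gh[symmetric] h_def ..
  have q0: "0 \<le> q m" for m unfolding q_def expct_gram by (intro sum_nonneg) simp
  have p0: "0 \<le> p m" for m unfolding p_def expct_gram by (intro sum_nonneg) simp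
  define G where "G = {m. m < card A \<and> \<kappa> m > 0}"
  have fG: "finite G" by (simp add: G_def)
  have bes: "(\<Sum>m\<in>G. (cmod (g m l))\<^sup>2 / \<kappa> m) \<le> 1" if l: "l \<in> L" for l
  proof -
    have "(\<Sum>m\<in>G. (cmod (g m l / of_real (sqrt (\<kappa> m))))\<^sup>2) \<le> 1"
    proof (rule bessel_point[OF fG fin(2) l])
      fix m n assume mn: "m \<in> G" "n \<in> G"
      have "(\<Sum>l\<in>L. g m l / of_real (sqrt (\<kappa> m)) * cnj (g n l / of_real (sqrt (\<kappa> n))))
         = (\<Sum>l\<in>L. g m l * cnj (g n l)) / of_real (sqrt (\<kappa> m) * sqrt (\<kappa> n))"
        unfolding sum_divide_distrib by simp
      also have "\<dots> = of_bool (m = n)"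
      proof (cases "m = n")
        case True
        have "complex_of_real (\<kappa> n) / of_real (sqrt (\<kappa> n) * sqrt (\<kappa> n)) = 1" using mn by (simp add: G_def)
        thus ?thesis using True gg[of m n] mn by (simp add: G_def)
      next
        case False
        thus ?thesis using gg[of m n] mn by (simp add: G_def)
      qed
      finally show "(\<Sum>l\<in>L. g m l / of_real (sqrt (\<kappa> m)) * cnj (g n l / of_real (sqrt (\<kappa> n)))) = of_bool (m = n)" .
    qed
    moreover have "(cmod (g m l / of_real (sqrt (\<kappa> m))))\<^sup>2 = (cmod (g m l))\<^sup>2 / \<kappa> m" if "m \<in> G" for m
      using that by (simp add: G_def norm_divide power_divide)
    ultimately show ?thesis by simp
  qed
  \<comment> \<open>Expanding \<open>p m\<close> over \<open>l\<close>, Bessel's inequality for the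
    orthonormal vectors \<open>g m / sqrt (\<kappa> m)\<close> bounds the coefficient of each
    \<open>c l\<close> by 1.\<close>
  have P: "(\<Sum>m\<in>G. p m / \<kappa> m) \<le> (\<Sum>l\<in>L. c l)"
  proof -
    have "(\<Sum>m\<in>G. p m / \<kappa> m) = (\<Sum>l\<in>L. c l * (\<Sum>m\<in>G. (cmod (g m l))\<^sup>2 / \<kappa> m))"
      unfolding p sum_divide_distrib sum_distrib_left by (subst sum.swap) simp
    also have "\<dots> \<le> (\<Sum>l\<in>L. c l * 1)"
      using bes c by (intro sum_mono mult_left_mono) (auto intro: less_imp_le)
    finally show ?thesis by simp
  qed
  \<comment> \<open>The left side is the trace of \<open>gram L W\<close> against D V V^* D.
    Expanded over the columns of D V, only diagonal entries of N appear, and each column leaves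
    \<open>(\<nu> l)^2 / c l\<close>.\<close>
  have Q: "(\<Sum>m<card A. \<kappa> m * q m) \<le> (\<Sum>l\<in>L. \<bar>\<nu> l\<bar>)"
  proof -
    have "(\<Sum>m<card A. \<kappa> m * q m) = (\<Sum>m<card A. \<kappa> m * (\<Sum>l\<in>L. (cmod (ip A (e m) (\<lambda>a. of_real (D a) * V a l)))\<^sup>2))"
      unfolding q_def expct_gram ip_def by (simp add: mult_ac)
    also have "\<dots> = (\<Sum>l\<in>L. \<Sum>m<card A. \<kappa> m * (cmod (ip A (e m) (\<lambda>a. of_real (D a) * V a l)))\<^sup>2)"
      unfolding sum_distrib_left by (rule sum.swap)
    also have "\<dots> = (\<Sum>l\<in>L. expct A (gram L W) (\<lambda>a. of_real (D a) * V a l))"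
      unfolding expct_spectral[OF sp] ..
    also have "\<dots> \<le> (\<Sum>l\<in>L. \<bar>\<nu> l\<bar>)"
    proof (rule sum_mono)
      fix l assume l: "l \<in> L"
      have "(cmod (\<Sum>a\<in>A. cnj (of_real (D a) * V a l) * W a k))\<^sup>2 = (if k = l then (\<nu> l)\<^sup>2 / c l else 0)"
        if k: "k \<in> L" for k
      proof -
        have "(\<Sum>a\<in>A. cnj (of_real (D a) * V a l) * W a k)
           = (\<Sum>a\<in>A. of_real (D a) * V a k * cnj (V a l)) / of_real (sqrt (c k))"
          unfolding W_def sum_divide_distrib by (simp add: mult_ac)
        thus ?thesis using N[OF k l] c[of l] by (simp add: norm_divide power_divide)
      qed
      hence "expct A (gram L W) (\<lambda>a. of_real (D a) * V a l) = (\<Sum>k\<in>L. if k = l then (\<nu> l)\<^sup>2 / c l else 0)"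
        unfolding expct_gram by (intro sum.cong refl) blast
      also have "\<dots> = (\<nu> l)\<^sup>2 / c l" using fin l by simp
      also have "\<dots> \<le> \<bar>\<nu> l\<bar>"
      proof -
        have "\<bar>\<nu> l\<bar> * \<bar>\<nu> l\<bar> \<le> \<bar>\<nu> l\<bar> * c l" using \<delta> by (intro mult_left_mono) (auto simp: c_def)
        thus ?thesis using c[of l] by (simp add: pos_divide_le_eq power2_eq_square)
      qed
      finally show "expct A (gram L W) (\<lambda>a. of_real (D a) * V a l) \<le> \<bar>\<nu> l\<bar>" .
    qed
    finally show ?thesis .
  qed
  \<comment> \<open>The product is read as the geometric mean of \<open>p m / \<kappa> m\<close> and
    \<open>\<kappa> m * q m\<close>, whose sums are bounded by \<open>P\<close> and
    \<open>Q\<close>. If \<open>\<kappa> m = 0\<close> then \<open>g m\<close> vanishes on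
    \<open>L\<close> and so does \<open>p m\<close>.\<close>
  have "(\<Sum>m<card A. sqrt (p m) * sqrt (q m)) \<le> (\<Sum>m<card A. (if m \<in> G then p m / \<kappa> m else 0) / 2 + \<kappa> m * q m / 2)"
  proof (rule sum_mono)
    fix m assume "m \<in> {..<card A}" hence m: "m < card A" by simp
    show "sqrt (p m) * sqrt (q m) \<le> (if m \<in> G then p m / \<kappa> m else 0) / 2 + \<kappa> m * q m / 2"
    proof (cases "m \<in> G")
      case True
      hence k: "\<kappa> m > 0" by (simp add: G_def)
      have "sqrt (p m) * sqrt (q m) = sqrt (p m / \<kappa> m * (\<kappa> m * q m))"
        using k by (simp add: real_sqrt_mult[symmetric])
      also have "\<dots> \<le> (p m / \<kappa> m + \<kappa> m * q m) / 2"
        by (rule arith_geo_mean_sqrt) (use k p0 q0 in auto)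
      finally show ?thesis using True by (simp add: add_divide_distrib)
    next
      case False
      hence k: "\<kappa> m = 0" using \<kappa>0[OF m] m by (auto simp: G_def)
      have "of_real (\<Sum>l\<in>L. (cmod (g m l))\<^sup>2) = (0 :: complex)"
        unfolding of_real_sum complex_norm_square using gg[OF m m] k by simp
      hence "(\<Sum>l\<in>L. (cmod (g m l))\<^sup>2) = 0" by (simp only: of_real_eq_0_iff)
      hence "g m l = 0" if "l \<in> L" for l using that fin by (simp add: sum_nonneg_eq_0_iff)
      hence "p m = 0" unfolding p by (intro sum.neutral) auto
      thus ?thesis using False k by simp
    qed
  qed
  also have "\<dots> = (\<Sum>m\<in>G. p m / \<kappa> m) / 2 + (\<Sum>m<card A. \<kappa> m * q m) / 2"
  proof -
    have "(\<Sum>m<card A. if m \<in> G then p m / \<kappa> m else 0) = (\<Sum>m\<in>{m\<in>{..<card A}. m \<in> G}. p m / \<kappa> m)"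
      by (subst sum.inter_filter) auto
    also have "{m\<in>{..<card A}. m \<in> G} = G" by (auto simp: G_def)
    finally show ?thesis by (simp only: sum.distrib sum_divide_distrib[symmetric])
  qed
  also have "\<dots> \<le> (\<Sum>l\<in>L. c l) / 2 + (\<Sum>l\<in>L. \<bar>\<nu> l\<bar>) / 2" using P Q by simp
  also have "\<dots> \<le> (\<Sum>l\<in>L. c l)"
  proof -
    have "(\<Sum>l\<in>L. \<bar>\<nu> l\<bar>) \<le> (\<Sum>l\<in>L. c l)" using \<delta> by (intro sum_mono) (simp add: c_def)
    thus ?thesis by simp
  qed
  finally show ?thesis using oe unfolding p_def q_def c_def by blast
qed

text \<open>Jensen's inequality with respect to the weights \<open>min (p' m) (q' m)\<close>, written out with the
  tangent of the exponential at \<open>z\<close>.\<close>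
lemma bhattacharyya_lower:
  fixes p q p' q' :: "'m \<Rightarrow> real"
  assumes fin: "finite M"
    and nn: "\<And>m. m \<in> M \<Longrightarrow> 0 \<le> p m \<and> 0 \<le> q m \<and> 0 \<le> p' m \<and> 0 \<le> q' m"
    and ac: "\<And>m. m \<in> M \<Longrightarrow> (p m = 0 \<longrightarrow> p' m = 0) \<and> (q m = 0 \<longrightarrow> q' m = 0)"
    and tot: "sum p M \<le> 1" "sum q M \<le> 1" "sum p' M \<le> 1" "sum q' M \<le> 1"
    and f: "0 < f" "f \<le> (\<Sum>m\<in>M. sqrt (p' m) * sqrt (q' m))"
    and kl: "(\<Sum>m\<in>M. p' m * ln (p' m / p m)) \<le> \<kappa>" "(\<Sum>m\<in>M. q' m * ln (q' m / q m)) \<le> \<kappa>"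
  shows "f\<^sup>2 / 2 * exp (- (2 * (\<kappa> + 1) / f\<^sup>2)) \<le> (\<Sum>m\<in>M. sqrt (p m) * sqrt (q m))"
proof -
  define w where "w m = min (p' m) (q' m)" for m
  define c where "c = sum w M"
  have w0: "0 \<le> w m" if "m \<in> M" for m using nn[OF that] by (simp add: w_def)
  \<comment> \<open>The product of \<open>p' m\<close> and \<open>q' m\<close> is \<open>w m\<close>
    times their maximum. The factors \<open>2 / f\<close> and \<open>f / 2\<close> in the
    arithmetic-geometric mean are balanced so that the maxima use up only \<open>f / 2\<close> in
    total, and the mass \<open>c\<close> of \<open>w\<close> must pay for the rest:
    \<open>c \<ge> f^2 / 2\<close>.\<close>
  have "f \<le> (\<Sum>m\<in>M. w m / f + f * (p' m + q' m) / 4)"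
  proof (rule order.trans[OF f(2)], rule sum_mono)
    fix m assume m: "m \<in> M"
    have "w m * max (p' m) (q' m) = p' m * q' m" by (auto simp: w_def min_def max_def)
    hence "sqrt (p' m) * sqrt (q' m) = sqrt ((2 * w m / f) * (f / 2 * max (p' m) (q' m)))"
      using f by (simp add: real_sqrt_mult[symmetric])
    also have "\<dots> \<le> (2 * w m / f + f / 2 * max (p' m) (q' m)) / 2"
      by (rule arith_geo_mean_sqrt) (use f w0[OF m] nn[OF m] in auto)
    also have "\<dots> = w m / f + f * max (p' m) (q' m) / 4" by (simp add: field_simps)
    also have "\<dots> \<le> w m / f + f * (p' m + q' m) / 4"
      using f nn[OF m] by (intro add_left_mono divide_right_mono mult_left_mono) auto
    finally show "sqrt (p' m) * sqrt (q' m) \<le> w m / f + f * (p' m + q' m) / 4" .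
  qed
  also have "\<dots> = c / f + f * (sum p' M + sum q' M) / 4"
    unfolding c_def sum_divide_distrib sum.distrib[symmetric] sum_distrib_left ..
  also have "\<dots> \<le> c / f + f * 2 / 4"
    using f tot by (intro add_left_mono divide_right_mono mult_left_mono) auto
  finally have "f \<le> c / f + f * 2 / 4" .
  hence "f / 2 \<le> c / f" by linarith
  hence cf: "f\<^sup>2 / 2 \<le> c" using f by (simp add: field_simps power2_eq_square)
  have c: "0 < c" using cf f by (smt (verit) half_gt_zero zero_less_power)
  \<comment> \<open>Adding \<open>x\<close> makes every divergence term nonnegative, so that sums
    can be restricted to the support of \<open>w\<close>; since the added masses total at most 1,
    this is where \<open>\<kappa> + 1\<close> comes from. The second part passes from the mass
    \<open>x'\<close> to a smaller mass \<open>y\<close>.\<close>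
  have kterm: "0 \<le> x' * ln (x' / x) + x \<and> (0 < y \<longrightarrow> y \<le> x' \<longrightarrow> - (x' * ln (x' / x) + x) \<le> y * ln (x / y))"
    if "0 \<le> x" "0 \<le> x'" "x = 0 \<longrightarrow> x' = 0" for x x' y :: real
  proof (cases "x' = 0")
    case False
    hence x: "x > 0" "x' > 0" using that by auto
    have "ln (x / x') \<le> x / x' - 1" using x by (intro ln_le_minus_one) simp
    hence "x' * ln (x / x') \<le> x' * (x / x' - 1)" using x by simp
    also have "\<dots> = x - x'" using x by (simp add: field_simps)
    finally have 1: "0 \<le> x' * ln (x' / x) + x" using x by (simp add: ln_div algebra_simps)
    have "- (x' * ln (x' / x) + x) \<le> y * ln (x / y)" if y: "0 < y" "y \<le> x'"
    proof (cases "ln (x' / x) \<ge> 0")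
      case True
      have "y * ln (y / x) \<le> y * ln (x' / x)" using x y by (simp add: divide_right_mono)
      also have "\<dots> \<le> x' * ln (x' / x)" using True y by (intro mult_right_mono)
      finally have "y * ln (y / x) \<le> x' * ln (x' / x) + x" using x by simp
      moreover have "y * ln (x / y) = - (y * ln (y / x))" using x y by (simp add: ln_div algebra_simps)
      ultimately show ?thesis by simp
    next
      case False
      have "x' / x < 1" using False x by (simp add: not_le)
      hence "x' < x" using x by (simp add: pos_divide_less_eq)
      hence "0 \<le> ln (x / y)" using x y by simp
      hence "0 \<le> y * ln (x / y)" using y by simp
      thus ?thesis using 1 by simp
    qed
    thus ?thesis using 1 by blast
  qed (use that in auto)
  have tot_term: "0 \<le> sum (\<lambda>m. u' m * ln (u' m / u m) + u m) M \<and>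
      - (\<kappa> + 1) \<le> (\<Sum>m\<in>{m\<in>M. 0 < w m}. w m * ln (u m / w m))"
    if u: "\<And>m. m \<in> M \<Longrightarrow> 0 \<le> u m \<and> 0 \<le> u' m \<and> (u m = 0 \<longrightarrow> u' m = 0) \<and> w m \<le> u' m"
      and su: "sum u M \<le> 1" "(\<Sum>m\<in>M. u' m * ln (u' m / u m)) \<le> \<kappa>" for u u'
  proof -
    have t: "0 \<le> u' m * ln (u' m / u m) + u m"
      "0 < w m \<Longrightarrow> - (u' m * ln (u' m / u m) + u m) \<le> w m * ln (u m / w m)" if "m \<in> M" for m
      using kterm[of "u m" "u' m" "w m"] u[OF that] by auto
    have "- (\<kappa> + 1) \<le> - (\<Sum>m\<in>M. u' m * ln (u' m / u m) + u m)" using su by (simp add: sum.distrib)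
    also have "\<dots> \<le> - (\<Sum>m\<in>{m\<in>M. 0 < w m}. u' m * ln (u' m / u m) + u m)"
      using t fin by (intro le_imp_neg_le sum_mono2) auto
    also have "\<dots> \<le> (\<Sum>m\<in>{m\<in>M. 0 < w m}. w m * ln (u m / w m))"
      unfolding sum_negf[symmetric] using t by (intro sum_mono) auto
    finally show ?thesis using sum_nonneg[of M "\<lambda>m. u' m * ln (u' m / u m) + u m"] t(1) by blast
  qed
  have P: "0 \<le> sum (\<lambda>m. p' m * ln (p' m / p m) + p m) M"
    "- (\<kappa> + 1) \<le> (\<Sum>m\<in>{m\<in>M. 0 < w m}. w m * ln (p m / w m))"
    using tot_term[of p p'] nn ac tot(1) kl(1) by (auto simp: w_def)
  have Q: "- (\<kappa> + 1) \<le> (\<Sum>m\<in>{m\<in>M. 0 < w m}. w m * ln (q m / w m))"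
    using tot_term[of q q'] nn ac tot(2) kl(2) by (auto simp: w_def)
  have k1: "0 \<le> \<kappa> + 1" using P(1) kl(1) tot(1) by (simp add: sum.distrib)
  define W where "W = {m\<in>M. 0 < w m}"
  define y where "y m = (ln (p m / w m) + ln (q m / w m)) / 2" for m
  \<comment> \<open>A lower bound for the mean of \<open>y\<close> under the weights
    \<open>w / c\<close>; the tangent of the exponential at this point has mean at least
    \<open>exp z\<close>.\<close>
  define z where "z = - (\<kappa> + 1) / c"
  have "- (\<kappa> + 1) \<le> (\<Sum>m\<in>W. w m * y m)"
  proof -
    have "(\<Sum>m\<in>W. w m * y m) = ((\<Sum>m\<in>W. w m * ln (p m / w m)) + (\<Sum>m\<in>W. w m * ln (q m / w m))) / 2"
    proof -
      have "w m * y m = w m * ln (p m / w m) / 2 + w m * ln (q m / w m) / 2" for m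
        by (simp add: y_def algebra_simps add_divide_distrib)
      thus ?thesis by (simp only: sum.distrib sum_divide_distrib add_divide_distrib)
    qed
    thus ?thesis using P(2) Q by (simp add: W_def)
  qed
  hence zc: "c * z \<le> (\<Sum>m\<in>W. w m * y m)" using c by (simp add: z_def)
  have cW: "c = sum w W" unfolding c_def W_def
    by (rule sum.mono_neutral_right) (use fin w0 in \<open>force+\<close>)
  have "f\<^sup>2 / 2 * exp (- (2 * (\<kappa> + 1) / f\<^sup>2)) \<le> c * exp z"
  proof (intro mult_mono)
    have "(\<kappa> + 1) / c \<le> (\<kappa> + 1) / (f\<^sup>2 / 2)" using k1 cf f c by (intro divide_left_mono mult_pos_pos) auto
    moreover have "z = - ((\<kappa> + 1) / c)" by (simp only: z_def minus_divide_left)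
    moreover have "2 * (\<kappa> + 1) / f\<^sup>2 = (\<kappa> + 1) / (f\<^sup>2 / 2)" by simp
    ultimately show "exp (- (2 * (\<kappa> + 1) / f\<^sup>2)) \<le> exp z" by (simp only: exp_le_cancel_iff neg_le_iff_le)
  qed (use cf c in auto)
  also have "\<dots> \<le> exp z * (c + ((\<Sum>m\<in>W. w m * y m) - c * z))"
    using zc by (simp add: mult.commute)
  also have "\<dots> = (\<Sum>m\<in>W. w m * (exp z * (1 + (y m - z))))"
  proof -
    have "w m * (exp z * (1 + (y m - z))) = exp z * (w m + (w m * y m - w m * z))" for m
      by (simp add: algebra_simps)
    hence "(\<Sum>m\<in>W. w m * (exp z * (1 + (y m - z)))) = exp z * (sum w W + ((\<Sum>m\<in>W. w m * y m) - sum w W * z))"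
      by (simp only: sum_distrib_left[symmetric] sum.distrib sum_subtractf sum_distrib_right[symmetric])
    thus ?thesis unfolding cW by (rule sym)
  qed
  also have "\<dots> \<le> (\<Sum>m\<in>W. sqrt (p m) * sqrt (q m))"
  proof (rule sum_mono)
    fix m assume m: "m \<in> W"
    hence mM: "m \<in> M" and w: "0 < w m" by (auto simp: W_def)
    have pq: "0 < p m" "0 < q m" using w nn[OF mM] ac[OF mM] unfolding w_def by force+
    have "exp z * (1 + (y m - z)) \<le> exp z * exp (y m - z)"
      by (intro mult_left_mono exp_ge_add_one_self) simp
    also have "\<dots> = exp (y m)" by (simp add: exp_add[symmetric])
    also have "exp (y m) = sqrt (p m / w m * (q m / w m))"
    proof (rule real_sqrt_unique[symmetric])
      have "(exp (y m))\<^sup>2 = exp (ln (p m / w m) + ln (q m / w m))"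
        by (simp add: power2_eq_square exp_add[symmetric] y_def)
      also have "\<dots> = p m / w m * (q m / w m)" using pq w by (simp add: exp_add)
      finally show "(exp (y m))\<^sup>2 = p m / w m * (q m / w m)" .
    qed simp
    also have "\<dots> = sqrt (p m) * sqrt (q m) / w m"
      using w by (simp add: real_sqrt_divide real_sqrt_mult)
    finally show "w m * (exp z * (1 + (y m - z))) \<le> sqrt (p m) * sqrt (q m)"
      using w by (simp add: pos_le_divide_eq mult.commute)
  qed
  also have "\<dots> \<le> (\<Sum>m\<in>M. sqrt (p m) * sqrt (q m))"
    using fin nn by (intro sum_mono2) (auto simp: W_def)
  finally show ?thesis .
qed

lemma onb_diag_sign:
  assumes "onb S J e" and D: "\<And>a. a \<in> S \<Longrightarrow> (D a)\<^sup>2 = (1::real)"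
  shows "onb S J (\<lambda>j a. of_real (D a) * e j a)"
proof -
  have DD: "complex_of_real (D a) * of_real (D a) = 1" if "a \<in> S" for a
    using D[OF that] by (metis of_real_1 of_real_mult power2_eq_square)
  have "ip S (\<lambda>a. of_real (D a) * e j a) (\<lambda>a. of_real (D a) * e k a) = ip S (e j) (e k)" for j k
    unfolding ip_def
  proof (rule sum.cong[OF refl])
    fix a assume a: "a \<in> S"
    have "cnj (of_real (D a) * e j a) * (of_real (D a) * e k a) = (of_real (D a) * of_real (D a)) * (cnj (e j a) * e k a)"
      by (simp add: mult_ac)
    thus "cnj (of_real (D a) * e j a) * (of_real (D a) * e k a) = cnj (e j a) * e k a" using DD[OF a] by simp
  qed
  moreover have "(\<Sum>j\<in>J. of_real (D a) * e j a * cnj (of_real (D b) * e j b)) = of_bool (a = b)" if "a \<in> S" "b \<in> S" for a b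
  proof -
    have "(\<Sum>j\<in>J. of_real (D a) * e j a * cnj (of_real (D b) * e j b)) = of_real (D a) * of_real (D b) * (\<Sum>j\<in>J. e j a * cnj (e j b))"
      unfolding sum_distrib_left by (simp add: mult_ac)
    also have "\<dots> = of_bool (a = b)" using assms(1) that DD by (auto simp: onb_def)
    finally show ?thesis .
  qed
  ultimately show ?thesis using assms(1) by (simp add: onb_def)
qed

text \<open>\<open>f\<close> is the correlation of Alice's sign \<open>D\<close> with a guess
  \<open>z\<close> made from \<open>c\<close>. Since \<open>z\<close> is bounded by 1 in modulus,
  Cauchy-Schwarz bounds this correlation by the Bhattacharyya sum of \<open>gram C \<Phi>\<close>
  and its sign-flipped version in every basis \<open>m\<close>; \<open>fuchs_caves\<close> supplies
  a basis that is good for \<open>gram B V\<close>. The assumption \<open>kl\<close> covers all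
  bases because it is used twice: measuring the sign-flipped state in \<open>m\<close> amounts to
  measuring the original one in the sign-flipped basis \<open>m'\<close>.\<close>

theorem trace_norm_lower:
  fixes V :: "'a \<Rightarrow> 'b \<Rightarrow> complex" and \<Phi> :: "'a \<Rightarrow> 'c \<Rightarrow> complex" and D :: "'a \<Rightarrow> real"
  assumes finA: "finite A" and D: "\<And>a. a \<in> A \<Longrightarrow> (D a)\<^sup>2 = 1"
    and sp: "spectral B (\<lambda>b b'. \<Sum>a\<in>A. of_real (D a) * V a b * cnj (V a b')) L e \<nu>"
    and trV: "(\<Sum>a\<in>A. \<Sum>b\<in>B. (cmod (V a b))\<^sup>2) = 1"
    and trP: "(\<Sum>a\<in>A. \<Sum>c\<in>C. (cmod (\<Phi> a c))\<^sup>2) = 1"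
    and z: "\<And>c. c \<in> C \<Longrightarrow> \<bar>z c\<bar> \<le> 1"
    and f: "0 < f" "f \<le> (\<Sum>a\<in>A. \<Sum>c\<in>C. D a * z c * (cmod (\<Phi> a c))\<^sup>2)"
    and dom: "\<And>u. expct A (gram B V) u = 0 \<Longrightarrow> expct A (gram C \<Phi>) u = 0"
    and kl: "\<And>m. onb A {..<card A} m \<Longrightarrow>
      (\<Sum>j<card A. expct A (gram C \<Phi>) (m j) * ln (expct A (gram C \<Phi>) (m j) / expct A (gram B V) (m j))) \<le> \<kappa>"
  shows "f\<^sup>2 / 2 * exp (- (2 * (\<kappa> + 1) / f\<^sup>2)) \<le> (\<Sum>l\<in>L. \<bar>\<nu> l\<bar>)"
proof -
  let ?N = "\<lambda>b b'. \<Sum>a\<in>A. of_real (D a) * V a b * cnj (V a b')"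
  have oe: "onb B L e" using sp by (simp add: spectral_def)
  note finL = onb_finite(2)[OF oe]
  \<comment> \<open>Rotating the index set \<open>B\<close> into the eigenbasis of \<open>?N\<close>
    leaves V V^* unchanged and produces the diagonal form that \<open>fuchs_caves\<close>
    assumes.\<close>
  define \<Theta> where "\<Theta> a l = (\<Sum>b\<in>B. cnj (e l b) * V a b)" for a l
  have gr: "gram L \<Theta> = gram B V"
  proof (intro ext)
    fix a a'
    have "gram L \<Theta> a a' = (\<Sum>l\<in>L. ip B (\<lambda>b. V a' b) (e l) * ip B (e l) (\<lambda>b. V a b))"
      unfolding gram_def \<Theta>_def ip_def by (simp add: mult_ac)
    also have "\<dots> = gram B V a a'" unfolding parseval[OF oe, symmetric] by (simp add: ip_def gram_def mult_ac)
    finally show "gram L \<Theta> a a' = gram B V a a'" .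
  qed
  have N: "(\<Sum>a\<in>A. of_real (D a) * \<Theta> a l * cnj (\<Theta> a k)) = (if l = k then of_real (\<nu> l) else 0)"
    if lk: "l \<in> L" "k \<in> L" for l k
  proof -
    have "(\<Sum>a\<in>A. of_real (D a) * \<Theta> a l * cnj (\<Theta> a k))
       = (\<Sum>a\<in>A. \<Sum>b\<in>B. \<Sum>b'\<in>B. cnj (e l b) * (of_real (D a) * V a b * cnj (V a b')) * e k b')"
      unfolding \<Theta>_def cnj_sum mult.assoc sum_product unfolding sum_distrib_left by (simp add: mult_ac)
    also have "\<dots> = (\<Sum>b\<in>B. \<Sum>b'\<in>B. \<Sum>a\<in>A. cnj (e l b) * (of_real (D a) * V a b * cnj (V a b')) * e k b')"
      by (subst sum.swap, rule sum.cong[OF refl], rule sum.swap)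
    also have "\<dots> = sesq B ?N (e l) (e k)"
      unfolding sesq_def sum_distrib_left sum_distrib_right ..
    also have "\<dots> = of_real (\<nu> l) * ip B (e l) (e k)" by (rule sesq_eigvec(1)[OF sp lk(1)])
    also have "ip B (e l) (e k) = of_bool (l = k)" using oe lk by (simp add: onb_def)
    finally show ?thesis by simp
  qed
  define X where "X = f\<^sup>2 / 2 * exp (- (2 * (\<kappa> + 1) / f\<^sup>2))"
  have X: "X \<le> (\<Sum>l\<in>L. \<bar>\<nu> l\<bar> + \<delta>)" if \<delta>: "0 < \<delta>" for \<delta>
  proof -
    obtain m where m: "onb A {..<card A} m" and fc:
      "(\<Sum>j<card A. sqrt (expct A (gram B V) (m j)) * sqrt (expct A (gram B V) (\<lambda>a. of_real (D a) * m j a)))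
      \<le> (\<Sum>l\<in>L. \<bar>\<nu> l\<bar> + \<delta>)"
      using fuchs_caves[OF finA finL \<delta> N] unfolding gr by blast
    define m' where "m' j a = of_real (D a) * m j a" for j a
    have m': "onb A {..<card A} m'" unfolding m'_def by (rule onb_diag_sign[OF m D])
    define p q p' q' where "p j = expct A (gram B V) (m j)" and "q j = expct A (gram B V) (m' j)"
      and "p' j = expct A (gram C \<Phi>) (m j)" and "q' j = expct A (gram C \<Phi>) (m' j)" for j
    have "X \<le> (\<Sum>j<card A. sqrt (p j) * sqrt (q j))"
      unfolding X_def
    proof (rule bhattacharyya_lower[where p' = p' and q' = q'])
      show "0 \<le> p j \<and> 0 \<le> q j \<and> 0 \<le> p' j \<and> 0 \<le> q' j" for j
        unfolding p_def q_def p'_def q'_def expct_gram by (auto intro: sum_nonneg)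
      show "(p j = 0 \<longrightarrow> p' j = 0) \<and> (q j = 0 \<longrightarrow> q' j = 0)" for j
        unfolding p_def q_def p'_def q'_def using dom by blast
      show "sum p {..<card A} \<le> 1" "sum q {..<card A} \<le> 1" "sum p' {..<card A} \<le> 1" "sum q' {..<card A} \<le> 1"
        unfolding p_def q_def p'_def q'_def sum_expct_onb[OF m] sum_expct_onb[OF m'] trace_gram trV trP by auto
      show "(\<Sum>j<card A. p' j * ln (p' j / p j)) \<le> \<kappa>" "(\<Sum>j<card A. q' j * ln (q' j / q j)) \<le> \<kappa>"
        unfolding p_def q_def p'_def q'_def by (rule kl[OF m], rule kl[OF m'])
      define x y where "x j c = ip A (m j) (\<lambda>a. \<Phi> a c)" and "y j c = ip A (m j) (\<lambda>a. of_real (D a) * \<Phi> a c)" for j c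
      have e1: "p' j = (\<Sum>c\<in>C. (cmod (x j c))\<^sup>2)" for j
        unfolding p'_def expct_gram x_def ip_def ..
      have e2: "q' j = (\<Sum>c\<in>C. (cmod (y j c))\<^sup>2)" for j
        unfolding q'_def expct_gram y_def ip_def m'_def by (simp add: mult_ac)
      have "(\<Sum>a\<in>A. D a * (cmod (\<Phi> a c))\<^sup>2) = Re (\<Sum>j<card A. ip A (\<lambda>a. of_real (D a) * \<Phi> a c) (m j) * x j c)" for c
      proof -
        have "of_real (\<Sum>a\<in>A. D a * (cmod (\<Phi> a c))\<^sup>2) = ip A (\<lambda>a. of_real (D a) * \<Phi> a c) (\<lambda>a. \<Phi> a c)"
          unfolding of_real_sum of_real_mult complex_norm_square ip_def by (simp add: mult_ac)
        from arg_cong[OF this, of Re] show ?thesis unfolding x_def parseval[OF m, symmetric] by simp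
      qed
      note inner = this
      have bnd: "\<bar>\<Sum>a\<in>A. D a * (cmod (\<Phi> a c))\<^sup>2\<bar> \<le> (\<Sum>j<card A. cmod (x j c) * cmod (y j c))" for c
      proof -
        have "\<bar>\<Sum>a\<in>A. D a * (cmod (\<Phi> a c))\<^sup>2\<bar> \<le> cmod (\<Sum>j<card A. ip A (\<lambda>a. of_real (D a) * \<Phi> a c) (m j) * x j c)"
          unfolding inner by (rule abs_Re_le_cmod)
        also have "\<dots> \<le> (\<Sum>j<card A. cmod (ip A (\<lambda>a. of_real (D a) * \<Phi> a c) (m j) * x j c))"
          by (rule norm_sum)
        also have "\<dots> = (\<Sum>j<card A. cmod (x j c) * cmod (y j c))"
          by (intro sum.cong refl) (simp add: y_def norm_mult cmod_ip_commute[of A _ "m _"] mult.commute)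
        finally show ?thesis .
      qed
      have "(\<Sum>a\<in>A. \<Sum>c\<in>C. D a * z c * (cmod (\<Phi> a c))\<^sup>2) = (\<Sum>c\<in>C. z c * (\<Sum>a\<in>A. D a * (cmod (\<Phi> a c))\<^sup>2))"
        unfolding sum_distrib_left by (subst sum.swap) (simp add: mult_ac)
      also have "\<dots> \<le> (\<Sum>c\<in>C. \<Sum>j<card A. cmod (x j c) * cmod (y j c))"
      proof (rule sum_mono)
        fix c assume c: "c \<in> C"
        have "z c * (\<Sum>a\<in>A. D a * (cmod (\<Phi> a c))\<^sup>2) \<le> \<bar>z c\<bar> * \<bar>\<Sum>a\<in>A. D a * (cmod (\<Phi> a c))\<^sup>2\<bar>"
          by (metis abs_ge_self abs_mult)
        also have "\<dots> \<le> 1 * \<bar>\<Sum>a\<in>A. D a * (cmod (\<Phi> a c))\<^sup>2\<bar>" using z[OF c] by (intro mult_right_mono) auto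
        finally show "z c * (\<Sum>a\<in>A. D a * (cmod (\<Phi> a c))\<^sup>2) \<le> (\<Sum>j<card A. cmod (x j c) * cmod (y j c))"
          using bnd[of c] by simp
      qed
      also have "\<dots> = (\<Sum>j<card A. \<Sum>c\<in>C. cmod (x j c) * cmod (y j c))"
        by (rule sum.swap)
      also have "\<dots> \<le> (\<Sum>j<card A. sqrt (p' j) * sqrt (q' j))"
      proof (rule sum_mono)
        fix j
        show "(\<Sum>c\<in>C. cmod (x j c) * cmod (y j c)) \<le> sqrt (p' j) * sqrt (q' j)"
          using L2_set_mult_ineq[of "\<lambda>c. cmod (x j c)" "\<lambda>c. cmod (y j c)" C]
          unfolding e1 e2 L2_set_def by simp
      qed
      finally show "f \<le> (\<Sum>j<card A. sqrt (p' j) * sqrt (q' j))" using f(2) by simp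
    qed (use f in auto)
    also have "\<dots> \<le> (\<Sum>l\<in>L. \<bar>\<nu> l\<bar> + \<delta>)" using fc unfolding p_def q_def m'_def[abs_def] .
    finally show ?thesis .
  qed
  have "X \<le> (\<Sum>l\<in>L. \<bar>\<nu> l\<bar>) + \<epsilon>" if "\<epsilon> > 0" for \<epsilon>
  proof -
    \<comment> \<open>The regularisation costs \<open>card L * \<delta>\<close> in total; the added
      1 avoids a zero denominator.\<close>
    define \<delta> where "\<delta> = \<epsilon> / (real (card L) + 1)"
    have "0 < \<delta>" using that by (simp add: \<delta>_def)
    have "X \<le> (\<Sum>l\<in>L. \<bar>\<nu> l\<bar>) + real (card L) * \<delta>" using X[OF \<open>0 < \<delta>\<close>] by (simp add: sum.distrib)
    also have "real (card L) * \<delta> \<le> (real (card L) + 1) * \<delta>" using \<open>0 < \<delta>\<close> by simp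
    also have "\<dots> = \<epsilon>" by (simp add: \<delta>_def)
    finally show ?thesis by simp
  qed
  hence "X \<le> (\<Sum>l\<in>L. \<bar>\<nu> l\<bar>)" by (rule field_le_epsilon)
  thus ?thesis by (simp add: X_def)
qed

section \<open>Registers\<close>

lemma sum_even_odd:
  fixes f :: "nat \<Rightarrow> 'b::comm_monoid_add"
  shows "(\<Sum>x<2 * N. f x) = (\<Sum>y<N. f (2 * y)) + (\<Sum>y<N. f (2 * y + 1))"
  by (induction N) (simp_all add: ac_simps)

text \<open>Induction on the number of bits. Bit 0 splits the indices into even and odd ones, in
  each of which the other bits move down by one place; \<open>binary_holevo\<close> pays for bit 0,
  the induction hypothesis for each half, and the entropies telescope. The measurement for bit
  \<open>j\<close> is fixed independently of the other bits, so its bias is the mean of its biases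
  in the two halves.\<close>

lemma chain_holevo:
  fixes \<sigma> :: "nat \<Rightarrow> cfg \<Rightarrow> cfg \<Rightarrow> complex"
  assumes fin: "finite (basis d S)"
    and psd: "\<And>x. x < 2 ^ n \<Longrightarrow> psd (basis d S) (\<sigma> x)"
    and tr: "\<And>x. x < 2 ^ n \<Longrightarrow> (\<Sum>a\<in>basis d S. Re (\<sigma> x a a)) = 1"
    and ob: "\<And>j. j < n \<Longrightarrow> onb (basis d S) (L j) (v j)"
    and Q: "\<And>a b. a \<in> basis d S \<Longrightarrow> b \<in> basis d S \<Longrightarrow> Q a b = (\<Sum>x<2 ^ n. of_real (1 / 2 ^ n) * \<sigma> x a b)"
  shows "(\<Sum>j<n. ((\<Sum>x<2 ^ n. (if bit x j then -1 else 1) *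
        (\<Sum>l\<in>L j. (if g j l then 1 else -1) * expct (basis d S) (\<sigma> x) (v j l))) / 2 ^ n)\<^sup>2 / 8)
     \<le> vn_entropy d S Q - (\<Sum>x<2 ^ n. vn_entropy d S (\<sigma> x)) / 2 ^ n"
  using psd tr ob Q
proof (induction n arbitrary: \<sigma> L v g Q)
  case 0
  let ?S = "basis d S"
  have "hermitian_on ?S (\<sigma> 0)" using 0(1)[of 0] by (simp add: psd_def)
  then obtain e l where sp: "spectral ?S (\<sigma> 0) {..<card ?S} e l"
    using spectral_exists[OF fin] by blast
  have "spectral ?S Q {..<card ?S} e l" using sp 0(4) by (simp add: spectral_def)
  from vn_entropy_spectral[OF this] show ?case using vn_entropy_spectral[OF sp] by simp
next
  case (Suc n)
  let ?S = "basis d S"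
  define R where "R b y = \<sigma> (2 * y + of_bool b)" for b y
  define A where "A b = (\<lambda>a a'. \<Sum>y<2 ^ n. of_real (1 / 2 ^ n) * R b y a a')" for b
  define h where "h K j = (\<Sum>l\<in>L j. (if g j l then 1 else -1) * expct ?S K (v j l))" for K j
  have lt: "2 * y + of_bool b < (2::nat) ^ Suc n" if "y < 2 ^ n" for y b
    using that by (cases b) auto
  have psdR: "psd ?S (R b y)" if "y < 2 ^ n" for b y using Suc.prems(1)[OF lt[OF that]] by (simp add: R_def)
  have trR: "(\<Sum>a\<in>?S. Re (R b y a a)) = 1" if "y < 2 ^ n" for b y using Suc.prems(2)[OF lt[OF that]] by (simp add: R_def)
  have psdA: "psd ?S (A b)" for b
    by (rule psd_lincomb[where S = ?S and Q = "A b" and I = "{..<2 ^ n}" and w = "\<lambda>_. 1 / 2 ^ n" and R = "R b"]) (use psdR in \<open>auto simp: A_def\<close>)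
  have trA: "(\<Sum>a\<in>?S. Re (A b a a)) = 1" for b
  proof -
    have "(\<Sum>a\<in>?S. Re (A b a a)) = (\<Sum>y<2 ^ n. (1 / 2 ^ n) * (\<Sum>a\<in>?S. Re (R b y a a)))"
      unfolding A_def Re_sum sum_distrib_left Re_complex_of_real
      by (subst sum.swap) (simp add: field_simps)
    thus ?thesis using trR by simp
  qed
  have QA: "Q a b = (A False a b + A True a b) / 2" if "a \<in> ?S" "b \<in> ?S" for a b
    using Suc.prems(4)[OF that]
    by (simp add: sum_even_odd A_def R_def sum_distrib_left sum_divide_distrib add_divide_distrib mult.commute)
  have eA: "expct ?S (A b) u = (\<Sum>y<2 ^ n. expct ?S (R b y) u) / 2 ^ n" for b u
    using expct_lincomb[where S = ?S and Q = "A b" and I = "{..<2 ^ n}" and w = "\<lambda>_. 1 / 2 ^ n" and R = "R b" and u = u]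
    by (simp add: A_def sum_divide_distrib)
  have hA: "h (A b) j = (\<Sum>y<2 ^ n. h (R b y) j) / 2 ^ n" for b j
  proof -
    have "h (A b) j = (\<Sum>l\<in>L j. \<Sum>y<2 ^ n. (if g j l then 1 else -1) * expct ?S (R b y) (v j l) / 2 ^ n)"
      unfolding h_def eA by (simp add: sum_distrib_left sum_divide_distrib)
    also have "\<dots> = (\<Sum>y<2 ^ n. h (R b y) j) / 2 ^ n"
      unfolding h_def sum_divide_distrib by (rule sum.swap)
    finally show ?thesis .
  qed
  define T where "T b j = (\<Sum>y<2 ^ n. (if bit y j then -1 else 1) * h (R b y) (Suc j)) / 2 ^ n" for b j
  define T0 where "T0 = (h (A False) 0 - h (A True) 0) / 2"
  define E where "E b = (\<Sum>y<2 ^ n. vn_entropy d S (R b y)) / 2 ^ n" for b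
  have IH: "(\<Sum>j<n. (T b j)\<^sup>2 / 8) \<le> vn_entropy d S (A b) - E b" for b
    unfolding T_def E_def h_def
  proof (rule Suc.IH)
    show "onb ?S (L (Suc j)) (v (Suc j))" if "j < n" for j using Suc.prems(3) that by simp
    show "A b a a' = (\<Sum>x<2 ^ n. of_real (1 / 2 ^ n) * R b x a a')" for a a' by (simp only: A_def)
  qed (use psdR trR in blast)+
  have top: "T0\<^sup>2 / 8 \<le> vn_entropy d S Q - (vn_entropy d S (A False) + vn_entropy d S (A True)) / 2"
  proof -
    have "h (A False) 0 - h (A True) 0 = (\<Sum>l\<in>L 0. (if g 0 l then 1 else -1) *
        (expct ?S (A False) (v 0 l) - expct ?S (A True) (v 0 l)))"
      unfolding h_def by (simp only: right_diff_distrib sum_subtractf)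
    thus ?thesis unfolding T0_def
      by (simp only:) (rule binary_holevo[OF fin psdA psdA trA trA QA Suc.prems(3)], simp_all)
  qed
  have fE: "(\<Sum>x<2 ^ Suc n. vn_entropy d S (\<sigma> x)) / 2 ^ Suc n = (E False + E True) / 2"
    by (simp add: sum_even_odd E_def R_def add_divide_distrib)
  have f0: "(\<Sum>x<2 ^ Suc n. (if bit x 0 then -1 else 1) * h (\<sigma> x) 0) / 2 ^ Suc n = T0"
    unfolding T0_def hA
    by (simp add: sum_even_odd R_def bit_0 sum_negf diff_divide_distrib)
  have f1: "(\<Sum>x<2 ^ Suc n. (if bit x (Suc j) then -1 else 1) * h (\<sigma> x) (Suc j)) / 2 ^ Suc n = (T False j + T True j) / 2" for j
    by (simp add: sum_even_odd T_def R_def bit_Suc add_divide_distrib)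
  \<comment> \<open>Convexity of the square: not knowing bit 0 can only lower the squared bias of a
    later bit.\<close>
  have "(\<Sum>j<n. ((T False j + T True j) / 2)\<^sup>2 / 8) \<le> (\<Sum>j<n. ((T False j)\<^sup>2 / 8 + (T True j)\<^sup>2 / 8) / 2)"
  proof (rule sum_mono)
    fix j
    have "0 \<le> (T False j - T True j)\<^sup>2" by simp
    thus "((T False j + T True j) / 2)\<^sup>2 / 8 \<le> ((T False j)\<^sup>2 / 8 + (T True j)\<^sup>2 / 8) / 2"
      by (simp add: power2_eq_square field_simps)
  qed
  also have "\<dots> = ((\<Sum>j<n. (T False j)\<^sup>2 / 8) + (\<Sum>j<n. (T True j)\<^sup>2 / 8)) / 2"
    by (simp only: sum.distrib sum_divide_distrib[symmetric])
  finally have Tle: "(\<Sum>j<n. ((T False j + T True j) / 2)\<^sup>2 / 8)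
      \<le> ((\<Sum>j<n. (T False j)\<^sup>2 / 8) + (\<Sum>j<n. (T True j)\<^sup>2 / 8)) / 2" .
  have arith: "r + b \<le> vq - (e0 + e1) / 2"
    if "r \<le> vq - (x + y) / 2" "b \<le> (t0 + t1) / 2" "t0 \<le> x - e0" "t1 \<le> y - e1"
    for r b vq x y e0 e1 t0 t1 :: real using that by (simp add: field_simps)
  have split: "(\<Sum>j<Suc n. ((\<Sum>x<2 ^ Suc n. (if bit x j then -1 else 1) * h (\<sigma> x) j) / 2 ^ Suc n)\<^sup>2 / 8)
      = T0\<^sup>2 / 8 + (\<Sum>j<n. ((T False j + T True j) / 2)\<^sup>2 / 8)"
    by (subst sum.lessThan_Suc_shift) (simp only: f0 f1)
  have "(\<Sum>j<Suc n. ((\<Sum>x<2 ^ Suc n. (if bit x j then -1 else 1) * h (\<sigma> x) j) / 2 ^ Suc n)\<^sup>2 / 8)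
      \<le> vn_entropy d S Q - (\<Sum>x<2 ^ Suc n. vn_entropy d S (\<sigma> x)) / 2 ^ Suc n"
    unfolding split fE by (rule arith[OF top Tle IH IH])
  thus ?case by (simp only: h_def)
qed

lemma psd_from_spectral:
  assumes "spectral S K J e l" "\<And>j. j \<in> J \<Longrightarrow> 0 \<le> l j"
  shows "psd S K"
  unfolding psd_def expct_spectral[OF assms(1)]
  using spectral_hermitian[OF assms(1)] assms(2) by (auto intro!: sum_nonneg)

section \<open>Configurations register by register, and product bases\<close>

lemma basis_insert_bij:
  assumes "q \<notin> S"
  shows "bij_betw (\<lambda>(\<tau>, i). \<tau>(q := i)) (basis d S \<times> {..<d q}) (basis d (insert q S))"
  by (rule bij_betwI[where g = "\<lambda>\<sigma>. (\<sigma>(q := 0), \<sigma> q)"])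
    (use assms in \<open>auto simp: basis_def fun_eq_iff\<close>)

lemma sum_basis_insert:
  assumes "q \<notin> S"
  shows "(\<Sum>\<sigma>\<in>basis d (insert q S). f \<sigma>) = (\<Sum>\<tau>\<in>basis d S. \<Sum>i<d q. f (\<tau>(q := i)))"
  unfolding sum.reindex_bij_betw[OF basis_insert_bij[OF assms], symmetric] sum.cartesian_product
  by (simp add: split_beta)

lemma basis_empty: "basis d {} = {\<lambda>_. 0}"
  by (auto simp: basis_def)

lemma finite_basis:
  assumes "finite S"
  shows "finite (basis d S)"
  using assms
proof induction
  case (insert q S)
  thus ?case using bij_betw_finite[OF basis_insert_bij[OF insert(2), of d]] by simp
qed (simp add: basis_empty)

lemma sum_basis_Un:
  assumes "S \<inter> T = {}"
  shows "(\<Sum>\<sigma>\<in>basis d (S \<union> T). f \<sigma>) = (\<Sum>\<alpha>\<in>basis d S. \<Sum>\<beta>\<in>basis d T. f (merge S \<alpha> \<beta>))"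
proof -
  have "bij_betw (\<lambda>(\<alpha>, \<beta>). merge S \<alpha> \<beta>) (basis d S \<times> basis d T) (basis d (S \<union> T))"
    by (rule bij_betwI[where g = "\<lambda>\<sigma>. (restr S \<sigma>, restr T \<sigma>)"])
      (use assms in \<open>auto simp: basis_def merge_def restr_def fun_eq_iff\<close>)
  from sum.reindex_bij_betw[OF this, of f] show ?thesis
    unfolding sum.cartesian_product by (simp add: split_beta)
qed

text \<open>The product of the basis state x of register \<open>q\<close> with \<open>e x j\<close>,
  where the second factor may depend on x. The update at \<open>q\<close> is needed because a
  configuration on \<open>S\<close> is 0 outside \<open>S\<close>.\<close>

definition on_block :: "nat \<Rightarrow> (nat \<Rightarrow> 'j \<Rightarrow> qvec) \<Rightarrow> nat \<times> 'j \<Rightarrow> qvec" where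
  "on_block q e = (\<lambda>(x, j) \<sigma>. if \<sigma> q = x then e x j (\<sigma>(q := 0)) else 0)"

lemma basis_upd_zero: "\<sigma> \<in> basis d (insert q S) \<Longrightarrow> q \<notin> S \<Longrightarrow> \<sigma>(q := 0) \<in> basis d S"
  by (auto simp: basis_def)

lemma basis_upd_zero_id: "\<sigma> \<in> basis d S \<Longrightarrow> q \<notin> S \<Longrightarrow> \<sigma>(q := 0) = \<sigma>"
  by (auto simp: basis_def fun_eq_iff)

lemma onb_block:
  assumes q: "q \<notin> S" and o: "\<And>x. x < d q \<Longrightarrow> onb (basis d S) J (e x)"
    and fS: "finite S" and fJ: "finite J"
  shows "onb (basis d (insert q S)) ({..<d q} \<times> J) (on_block q e)"
proof -
  let ?B = "basis d (insert q S)"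
  have "ip ?B (on_block q e (x, j)) (on_block q e (y, k)) = of_bool ((x, j) = (y, k))"
    if xj: "x < d q" "j \<in> J" "y < d q" "k \<in> J" for x j y k
  proof -
    have "ip ?B (on_block q e (x, j)) (on_block q e (y, k))
      = (\<Sum>\<tau>\<in>basis d S. \<Sum>i<d q. if i = x then (if x = y then cnj (e x j \<tau>) * e y k \<tau> else 0) else 0)"
      unfolding ip_def sum_basis_insert[OF q]
      by (intro sum.cong refl) (auto simp: on_block_def basis_upd_zero_id q)
    also have "\<dots> = (if x = y then ip (basis d S) (e x j) (e y k) else 0)"
      using xj by (simp add: ip_def)
    also have "\<dots> = of_bool ((x, j) = (y, k))" using o[OF xj(1)] xj by (auto simp: onb_def)
    finally show ?thesis .
  qed
  moreover have "(\<Sum>xj\<in>{..<d q} \<times> J. on_block q e xj \<sigma> * cnj (on_block q e xj \<tau>)) = of_bool (\<sigma> = \<tau>)"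
    if s: "\<sigma> \<in> ?B" "\<tau> \<in> ?B" for \<sigma> \<tau>
  proof -
    have sq: "\<sigma> q < d q" using s by (auto simp: basis_def)
    have "(\<Sum>xj\<in>{..<d q} \<times> J. on_block q e xj \<sigma> * cnj (on_block q e xj \<tau>))
      = (\<Sum>x<d q. \<Sum>j\<in>J. on_block q e (x, j) \<sigma> * cnj (on_block q e (x, j) \<tau>))"
      by (simp add: sum.cartesian_product split_beta)
    also have "\<dots> = (\<Sum>x<d q. if x = \<sigma> q then (if \<sigma> q = \<tau> q then (\<Sum>j\<in>J. e x j (\<sigma>(q := 0)) * cnj (e x j (\<tau>(q := 0)))) else 0) else 0)"
      by (intro sum.cong refl) (auto simp: on_block_def)
    also have "\<dots> = (if \<sigma> q = \<tau> q then of_bool (\<sigma>(q := 0) = \<tau>(q := 0)) else 0)"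
    proof -
      have "(\<Sum>j\<in>J. e (\<sigma> q) j (\<sigma>(q := 0)) * cnj (e (\<sigma> q) j (\<tau>(q := 0)))) = of_bool (\<sigma>(q := 0) = \<tau>(q := 0))"
        using o[OF sq] basis_upd_zero[OF s(1) q] basis_upd_zero[OF s(2) q] unfolding onb_def by blast
      thus ?thesis using sq by (cases "\<sigma> q = \<tau> q") auto
    qed
    also have "\<dots> = of_bool (\<sigma> = \<tau>)"
      by (auto simp: fun_eq_iff)
    finally show ?thesis .
  qed
  ultimately show ?thesis using finite_basis[of "insert q S" d] fS fJ by (auto simp: onb_def)
qed

text \<open>Covers both block-diagonal operators that occur: a uniformly distributed classical
  register with a different state in each block, and the product of one state with a maximally mixed
  qubit.\<close>

lemma spectral_block:
  assumes q: "q \<notin> S" and sp: "\<And>x. x < d q \<Longrightarrow> spectral (basis d S) (K x) J (e x) (l x)"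
    and fS: "finite S" and fJ: "finite J"
    and M: "\<And>\<sigma> \<tau>. \<sigma> \<in> basis d (insert q S) \<Longrightarrow> \<tau> \<in> basis d (insert q S) \<Longrightarrow>
      M \<sigma> \<tau> = (if \<sigma> q = \<tau> q then of_real c * K (\<sigma> q) (\<sigma>(q := 0)) (\<tau>(q := 0)) else 0)"
  shows "spectral (basis d (insert q S)) M ({..<d q} \<times> J) (on_block q e) (\<lambda>(x, j). c * l x j)"
proof -
  have "M \<sigma> \<tau> = (\<Sum>xj\<in>{..<d q} \<times> J. of_real ((\<lambda>(x, j). c * l x j) xj) * on_block q e xj \<sigma> * cnj (on_block q e xj \<tau>))"
    if s: "\<sigma> \<in> basis d (insert q S)" "\<tau> \<in> basis d (insert q S)" for \<sigma> \<tau>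
  proof -
    have sq: "\<sigma> q < d q" using s by (auto simp: basis_def)
    have "(\<Sum>xj\<in>{..<d q} \<times> J. of_real ((\<lambda>(x, j). c * l x j) xj) * on_block q e xj \<sigma> * cnj (on_block q e xj \<tau>))
      = (\<Sum>x<d q. \<Sum>j\<in>J. of_real (c * l x j) * on_block q e (x, j) \<sigma> * cnj (on_block q e (x, j) \<tau>))"
      by (simp add: sum.cartesian_product split_beta)
    also have "\<dots> = (\<Sum>x<d q. if x = \<sigma> q then (if \<sigma> q = \<tau> q then
        of_real c * (\<Sum>j\<in>J. of_real (l x j) * e x j (\<sigma>(q := 0)) * cnj (e x j (\<tau>(q := 0)))) else 0) else 0)"
      unfolding sum_distrib_left by (intro sum.cong refl) (auto simp: on_block_def mult_ac)
    also have "\<dots> = M \<sigma> \<tau>"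
    proof -
      have "K (\<sigma> q) (\<sigma>(q := 0)) (\<tau>(q := 0)) = (\<Sum>j\<in>J. of_real (l (\<sigma> q) j) * e (\<sigma> q) j (\<sigma>(q := 0)) * cnj (e (\<sigma> q) j (\<tau>(q := 0))))"
        using sp[OF sq] basis_upd_zero[OF s(1) q] basis_upd_zero[OF s(2) q] unfolding spectral_def by blast
      thus ?thesis using sq unfolding M[OF s] by (cases "\<sigma> q = \<tau> q") auto
    qed
    finally show ?thesis by simp
  qed
  moreover have "onb (basis d (insert q S)) ({..<d q} \<times> J) (on_block q e)"
    by (rule onb_block[OF q _ fS fJ]) (use sp in \<open>auto simp: spectral_def\<close>)
  ultimately show ?thesis by (simp add: spectral_def)
qed

lemma expct_on_block:
  assumes "q \<notin> S" "x < d q"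
  shows "expct (basis d (insert q S)) K (on_block q e (x, j))
    = expct (basis d S) (\<lambda>\<sigma> \<tau>. K (\<sigma>(q := x)) (\<tau>(q := x))) (e x j)"
proof -
  have 1: "(\<Sum>i<d q. on_block q e (x, j) (\<tau>(q := i)) * f i) = e x j \<tau> * f x"
    "(\<Sum>i<d q. cnj (on_block q e (x, j) (\<tau>(q := i))) * f i) = cnj (e x j \<tau>) * f x"
    if "\<tau> \<in> basis d S" for \<tau> f
  proof -
    have "(\<Sum>i<d q. on_block q e (x, j) (\<tau>(q := i)) * f i) = (\<Sum>i<d q. if i = x then e x j \<tau> * f x else 0)"
      by (intro sum.cong refl) (auto simp: on_block_def basis_upd_zero_id[OF that assms(1)])
    thus "(\<Sum>i<d q. on_block q e (x, j) (\<tau>(q := i)) * f i) = e x j \<tau> * f x" using assms(2) by simp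
    have "(\<Sum>i<d q. cnj (on_block q e (x, j) (\<tau>(q := i))) * f i) = (\<Sum>i<d q. if i = x then cnj (e x j \<tau>) * f x else 0)"
      by (intro sum.cong refl) (auto simp: on_block_def basis_upd_zero_id[OF that assms(1)])
    thus "(\<Sum>i<d q. cnj (on_block q e (x, j) (\<tau>(q := i))) * f i) = cnj (e x j \<tau>) * f x" using assms(2) by simp
  qed
  have "sesq (basis d (insert q S)) K (on_block q e (x, j)) (on_block q e (x, j))
    = (\<Sum>\<sigma>\<in>basis d S. \<Sum>i<d q. cnj (on_block q e (x, j) (\<sigma>(q := i))) *
        (\<Sum>\<tau>\<in>basis d S. \<Sum>k<d q. on_block q e (x, j) (\<tau>(q := k)) * K (\<sigma>(q := i)) (\<tau>(q := k))))"
    unfolding sesq_def sum_basis_insert[OF assms(1)] sum_distrib_left by (simp add: mult_ac)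
  also have "\<dots> = (\<Sum>\<sigma>\<in>basis d S. cnj (e x j \<sigma>) * (\<Sum>\<tau>\<in>basis d S. e x j \<tau> * K (\<sigma>(q := x)) (\<tau>(q := x))))"
    by (intro sum.cong refl) (simp add: 1)
  also have "\<dots> = sesq (basis d S) (\<lambda>\<sigma> \<tau>. K (\<sigma>(q := x)) (\<tau>(q := x))) (e x j) (e x j)"
    unfolding sesq_def sum_distrib_left by (simp add: mult_ac)
  finally show ?thesis by (simp add: expct_def)
qed

text \<open>Klein's inequality against the product of the reduced state with the maximally mixed qubit.\<close>
lemma qubit_subadditivity:
  assumes q: "q \<notin> S" "d q = 2" and fS: "finite S"
    and psd: "psd (basis d (insert q S)) K"
    and tr: "(\<Sum>\<sigma>\<in>basis d (insert q S). Re (K \<sigma> \<sigma>)) = 1"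
    and red: "\<And>\<sigma> \<tau>. \<sigma> \<in> basis d S \<Longrightarrow> \<tau> \<in> basis d S \<Longrightarrow> Kr \<sigma> \<tau> = (\<Sum>i<2. K (\<sigma>(q := i)) (\<tau>(q := i)))"
  shows "vn_entropy d (insert q S) K \<le> vn_entropy d S Kr + 1"
proof -
  let ?S = "basis d S" and ?T = "basis d (insert q S)"
  define Ki where "Ki i = (\<lambda>\<sigma> \<tau>. K (\<sigma>(q := i)) (\<tau>(q := i)))" for i :: nat
  have Kr: "Kr \<sigma> \<tau> = (\<Sum>i<2. of_real 1 * Ki i \<sigma> \<tau>)" if "\<sigma> \<in> ?S" "\<tau> \<in> ?S" for \<sigma> \<tau>
    using red[OF that] by (simp add: Ki_def)
  have eKr: "expct ?S Kr u = (\<Sum>i<2. expct ?S (Ki i) u)" for u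
    using expct_lincomb[OF Kr, where u = u] by simp
  have eKi: "expct ?S (Ki i) u = expct ?T K (on_block q (\<lambda>_ (_::unit). u) (i, ()))" if "i < 2" for i u
    using expct_on_block[OF q(1), of i d K "\<lambda>_ (_::unit). u" "()"] that q(2) by (simp add: Ki_def)
  have in_T: "\<sigma>(q := i) \<in> ?T" if "\<sigma> \<in> ?S" "i < 2" for \<sigma> i
    using that q by (auto simp: basis_def)
  have psdKi: "psd ?S (Ki i)" if "i < 2" for i
    using psd in_T[OF _ that] unfolding psd_def eKi[OF that] by (auto simp: hermitian_on_def Ki_def)
  have psdKr: "psd ?S Kr" by (rule psd_lincomb[OF Kr]) (use psdKi in auto)
  obtain b s where b: "spectral ?S Kr {..<card ?S} b s"
    using spectral_exists[OF finite_basis[OF fS]] psdKr unfolding psd_def by blast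
  have s0: "0 \<le> s k" if "k < card ?S" for k using psd_spectral_nonneg[OF psdKr b] that by simp
  obtain a r where a: "spectral ?T K {..<card ?T} a r"
    using spectral_exists[of ?T K] finite_basis[of "insert q S" d] fS psd unfolding psd_def by blast
  define Q where "Q = (\<lambda>\<sigma> \<tau>. if \<sigma> q = \<tau> q then of_real (1 / 2) * Kr (\<sigma>(q := 0)) (\<tau>(q := 0)) else 0)"
  have Q: "spectral ?T Q ({..<2} \<times> {..<card ?S}) (on_block q (\<lambda>_. b)) (\<lambda>(x, j). 1 / 2 * s j)"
    using spectral_block[OF q(1), of d "\<lambda>_. Kr" "{..<card ?S}" "\<lambda>_. b" "\<lambda>_. s" Q "1 / 2"] b fS q(2)
    by (simp add: Q_def)
  have psdQ: "psd ?T Q" by (rule psd_from_spectral[OF Q]) (use s0 in auto)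
  have ek: "(\<Sum>x<2. expct ?T K (on_block q (\<lambda>_. b) (x, k))) = s k" if "k < card ?S" for k
  proof -
    have "(\<Sum>x<2. expct ?T K (on_block q (\<lambda>_. b) (x, k))) = (\<Sum>x<2. expct ?S (Ki x) (b k))"
      using q by (intro sum.cong refl) (simp add: expct_on_block Ki_def)
    thus ?thesis using eKr[of "b k"] expct_eigvec[OF b] that by simp
  qed
  have s1: "(\<Sum>k<card ?S. s k) = 1"
  proof -
    have "(\<Sum>k<card ?S. s k) = (\<Sum>\<sigma>\<in>?S. \<Sum>i<2. Re (K (\<sigma>(q := i)) (\<sigma>(q := i))))"
      unfolding sum_eigenvalues[OF b] by (intro sum.cong refl) (simp add: red)
    thus ?thesis using tr unfolding sum_basis_insert[OF q(1)] q(2) by simp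
  qed
  have "(\<Sum>xk\<in>{..<2} \<times> {..<card ?S}. expct ?T K (on_block q (\<lambda>_. b) xk) * ln ((\<lambda>(x, j). 1 / 2 * s j) xk))
     \<le> (\<Sum>j<card ?T. r j * ln (r j))"
  proof (rule klein[OF a Q psd psdQ])
    fix xk :: "nat \<times> nat" assume xk: "xk \<in> {..<2} \<times> {..<card ?S}" and z: "(\<lambda>(x, j). 1 / 2 * s j) xk = 0"
    obtain x k where e: "xk = (x, k)" "x < 2" "k < card ?S" using xk by auto
    have "(\<Sum>x<2. expct ?T K (on_block q (\<lambda>_. b) (x, k))) = 0" using ek[OF e(3)] z e by simp
    hence "\<forall>x\<in>{..<2}. expct ?T K (on_block q (\<lambda>_. b) (x, k)) = 0"
      using psd by (subst (asm) sum_nonneg_eq_0_iff) (auto simp: psd_def)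
    thus "expct ?T K (on_block q (\<lambda>_. b) xk) = 0" using e by simp
  next
    have "(\<Sum>x\<in>?T. Re (Q x x)) = (\<Sum>(x, j)\<in>{..<2::nat} \<times> {..<card ?S}. 1 / 2 * s j)"
      using sum_eigenvalues[OF Q] by simp
    also have "\<dots> = (\<Sum>x<2::nat. (\<Sum>j<card ?S. s j) / 2)"
      unfolding sum.cartesian_product[symmetric] sum_divide_distrib by simp
    also have "\<dots> = 1" by (simp add: s1)
    finally show "(\<Sum>x\<in>?T. Re (K x x)) = (\<Sum>x\<in>?T. Re (Q x x))" using tr by simp
  qed
  also have "(\<Sum>xk\<in>{..<2} \<times> {..<card ?S}. expct ?T K (on_block q (\<lambda>_. b) xk) * ln ((\<lambda>(x, j). 1 / 2 * s j) xk))
     = (\<Sum>x<2. \<Sum>k<card ?S. expct ?T K (on_block q (\<lambda>_. b) (x, k)) * ln (s k / 2))"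
    by (simp add: sum.cartesian_product split_beta)
  also have "\<dots> = (\<Sum>k<card ?S. (\<Sum>x<2. expct ?T K (on_block q (\<lambda>_. b) (x, k))) * ln (s k / 2))"
    unfolding sum_distrib_right by (rule sum.swap)
  also have "\<dots> = (\<Sum>k<card ?S. s k * ln (s k) - s k * ln 2)"
  proof (rule sum.cong[OF refl])
    fix k assume "k \<in> {..<card ?S}" hence k: "k < card ?S" by simp
    show "(\<Sum>x<2. expct ?T K (on_block q (\<lambda>_. b) (x, k))) * ln (s k / 2) = s k * ln (s k) - s k * ln 2"
      unfolding ek[OF k] using s0[OF k] by (cases "s k = 0") (auto simp: ln_div algebra_simps)
  qed
  also have "\<dots> = - ln 2 * vn_entropy d S Kr - ln 2"
    unfolding sum_subtractf vn_entropy_ln[OF psdKr b] sum_distrib_right[symmetric] s1 by simp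
  also have "(\<Sum>j<card ?T. r j * ln (r j)) = - ln 2 * vn_entropy d (insert q S) K"
    by (rule vn_entropy_ln[OF psd a])
  finally have "ln 2 * vn_entropy d (insert q S) K \<le> ln 2 * (vn_entropy d S Kr + 1)"
    by (simp add: algebra_simps)
  thus ?thesis by simp
qed

section \<open>Partial traces, and mutual information with a classical register\<close>

lemma ptrace_proj: "ptrace d R S (proj v) = gram (basis d (R - S)) (\<lambda>\<sigma> \<kappa>. v (merge S \<sigma> \<kappa>))"
  by (simp add: ptrace_def proj_def gram_def fun_eq_iff)

lemma ptrace_sum: "ptrace d R S (\<lambda>\<sigma> \<tau>. \<Sum>x\<in>I. c x * \<rho> x \<sigma> \<tau>) = (\<lambda>\<sigma> \<tau>. \<Sum>x\<in>I. c x * ptrace d R S (\<rho> x) \<sigma> \<tau>)"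
  unfolding ptrace_def sum_distrib_left by (simp add: sum.swap[of _ I])

lemma trace_ptrace_proj:
  assumes "S \<subseteq> R"
  shows "(\<Sum>\<sigma>\<in>basis d S. Re (ptrace d R S (proj v) \<sigma> \<sigma>)) = (\<Sum>\<sigma>\<in>basis d R. (cmod (v \<sigma>))\<^sup>2)"
proof -
  have "S \<union> (R - S) = R" using assms by auto
  thus ?thesis unfolding ptrace_proj trace_gram
    using sum_basis_Un[of S "R - S" "\<lambda>\<sigma>. (cmod (v \<sigma>))\<^sup>2" d] by simp
qed

lemma ptrace_insert:
  assumes "q \<in> R" "q \<notin> S" "\<sigma> \<in> basis d S" "\<tau> \<in> basis d S"
  shows "ptrace d R S \<rho> \<sigma> \<tau> = (\<Sum>i<d q. ptrace d R (insert q S) \<rho> (\<sigma>(q := i)) (\<tau>(q := i)))"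
proof -
  have "R - S = insert q (R - insert q S)" using assms by auto
  hence "ptrace d R S \<rho> \<sigma> \<tau> = (\<Sum>\<kappa>\<in>basis d (R - insert q S). \<Sum>i<d q.
      \<rho> (merge S \<sigma> (\<kappa>(q := i))) (merge S \<tau> (\<kappa>(q := i))))"
    unfolding ptrace_def using sum_basis_insert[of q "R - insert q S"] by simp
  also have "\<dots> = (\<Sum>i<d q. ptrace d R (insert q S) \<rho> (\<sigma>(q := i)) (\<tau>(q := i)))"
  proof -
    have "merge S \<alpha> (\<kappa>(q := i)) = merge (insert q S) (\<alpha>(q := i)) \<kappa>" for \<alpha> \<kappa> and i :: nat
      using assms(2) by (auto simp: merge_def fun_eq_iff)
    thus ?thesis unfolding ptrace_def by (simp add: sum.swap[of _ "{..<d q}"])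
  qed
  finally show ?thesis .
qed

text \<open>The joint state is block diagonal with equal weights, so its entropy is
  \<open>log 2 (d c)\<close> plus the mean entropy of the blocks. The same formula with an empty
  second system gives \<open>log 2 (d c)\<close> for the classical register alone; the logarithms
  cancel and the Holevo quantity remains.\<close>

lemma qmutual_info_classical:
  assumes c: "c \<in> R" "c \<notin> S" "S \<subseteq> R" and fR: "finite R" and N: "0 < d c"
    and cl: "\<And>x \<sigma>. \<sigma> c \<noteq> x \<Longrightarrow> v x \<sigma> = 0"
    and nv: "\<And>x. x < d c \<Longrightarrow> (\<Sum>\<sigma>\<in>basis d R. (cmod (v x \<sigma>))\<^sup>2) = 1"
  shows "qmutual_info d R {c} S (\<lambda>\<sigma> \<tau>. \<Sum>x<d c. of_real (1 / real (d c)) * proj (v x) \<sigma> \<tau>)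
    = vn_entropy d S (\<lambda>\<sigma> \<tau>. \<Sum>x<d c. of_real (1 / real (d c)) * ptrace d R S (proj (v x)) \<sigma> \<tau>)
      - (\<Sum>x<d c. vn_entropy d S (ptrace d R S (proj (v x)))) / real (d c)"
proof -
  let ?N = "real (d c)"
  define \<rho> where "\<rho> = (\<lambda>\<sigma> \<tau>. \<Sum>x<d c. of_real (1 / ?N) * proj (v x) \<sigma> \<tau>)"
  have fS: "finite S" using c fR finite_subset by blast
  have p: "proj (v x) \<alpha> \<beta> = 0" if "\<alpha> c \<noteq> x \<or> \<beta> c \<noteq> x" for x \<alpha> \<beta>
    using that cl by (auto simp: proj_def)
  have blk: "ptrace d R (insert c S) \<rho> \<sigma> \<tau> = (if \<sigma> c = \<tau> c then of_real (1 / ?N) *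
      ptrace d R S (proj (v (\<sigma> c))) (\<sigma>(c := 0)) (\<tau>(c := 0)) else 0)"
    if cS: "c \<notin> S" and s: "\<sigma> \<in> basis d (insert c S)" "\<tau> \<in> basis d (insert c S)" for \<sigma> \<tau> S
  proof -
    have sc: "\<sigma> c < d c" "\<tau> c < d c" using s by (auto simp: basis_def)
    have pt0: "ptrace d R (insert c S) (proj (v x)) \<alpha> \<beta> = 0" if "\<alpha> c \<noteq> x \<or> \<beta> c \<noteq> x" for x \<alpha> \<beta>
      unfolding ptrace_def by (intro sum.neutral ballI p) (use that in \<open>auto simp: merge_def\<close>)
    have "ptrace d R S (proj (v (\<sigma> c))) (\<sigma>(c := 0)) (\<tau>(c := 0))
        = (\<Sum>i<d c. ptrace d R (insert c S) (proj (v (\<sigma> c))) (\<sigma>(c := i)) (\<tau>(c := i)))"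
      using ptrace_insert[OF c(1) cS, of "\<sigma>(c := 0)" d "\<tau>(c := 0)"] basis_upd_zero[OF s(1) cS] basis_upd_zero[OF s(2) cS]
      by simp
    also have "\<dots> = (\<Sum>i<d c. if i = \<sigma> c then ptrace d R (insert c S) (proj (v (\<sigma> c))) \<sigma> (\<tau>(c := \<sigma> c)) else 0)"
      by (intro sum.cong refl) (auto intro: pt0)
    also have "\<dots> = ptrace d R (insert c S) (proj (v (\<sigma> c))) \<sigma> (\<tau>(c := \<sigma> c))" using sc by simp
    finally have 1: "ptrace d R S (proj (v (\<sigma> c))) (\<sigma>(c := 0)) (\<tau>(c := 0))
       = ptrace d R (insert c S) (proj (v (\<sigma> c))) \<sigma> (\<tau>(c := \<sigma> c))" .
    have "ptrace d R (insert c S) \<rho> \<sigma> \<tau> = (\<Sum>x<d c. if x = \<sigma> c then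
       (if \<sigma> c = \<tau> c then of_real (1 / ?N) * ptrace d R (insert c S) (proj (v (\<sigma> c))) \<sigma> \<tau> else 0) else 0)"
      unfolding \<rho>_def ptrace_sum by (intro sum.cong refl) (auto intro!: pt0)
    also have "\<dots> = (if \<sigma> c = \<tau> c then of_real (1 / ?N) * ptrace d R (insert c S) (proj (v (\<sigma> c))) \<sigma> \<tau> else 0)"
      using sc by simp
    finally show ?thesis unfolding 1 by (metis fun_upd_triv)
  qed
  have mix: "vn_entropy d (insert c S') (ptrace d R (insert c S') \<rho>)
     = (\<Sum>x<d c. vn_entropy d S' (ptrace d R S' (proj (v x)))) / ?N + log 2 ?N"
    if S': "c \<notin> S'" "S' \<subseteq> R" for S'
  proof -
    have fS': "finite S'" using S' fR finite_subset by blast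
    let ?B = "basis d S'"
    define K where "K x = ptrace d R S' (proj (v x))" for x
    have psd: "psd ?B (K x)" for x unfolding K_def ptrace_proj by (rule psd_gram)
    have "\<forall>x. \<exists>e l. spectral ?B (K x) {..<card ?B} e l"
      using spectral_exists[OF finite_basis[OF fS']] psd unfolding psd_def by blast
    then obtain e l where sp: "\<And>x. spectral ?B (K x) {..<card ?B} (e x) (l x)" by metis
    have l1: "(\<Sum>j<card ?B. l x j) = 1" if "x < d c" for x
      unfolding sum_eigenvalues[OF sp] K_def trace_ptrace_proj[OF S'(2)] by (rule nv[OF that])
    have l0: "0 \<le> l x j" if "j < card ?B" for x j using psd_spectral_nonneg[OF psd sp] that by simp
    have "spectral (basis d (insert c S')) (ptrace d R (insert c S') \<rho>) ({..<d c} \<times> {..<card ?B})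
      (on_block c e) (\<lambda>(x, j). 1 / ?N * l x j)"
      by (rule spectral_block[OF S'(1) sp fS']) (use blk[OF S'(1)] in \<open>auto simp: K_def\<close>)
    from vn_entropy_spectral[OF this]
    have "vn_entropy d (insert c S') (ptrace d R (insert c S') \<rho>) = - (\<Sum>x<d c. \<Sum>j<card ?B. eta (1 / ?N * l x j))"
      by (simp add: sum.cartesian_product split_beta)
    also have "(\<Sum>x<d c. \<Sum>j<card ?B. eta (1 / ?N * l x j)) = (\<Sum>x<d c. \<Sum>j<card ?B. eta (l x j) / ?N - l x j * (log 2 ?N / ?N))"
    proof (intro sum.cong refl)
      fix x j assume "j \<in> {..<card ?B}"
      hence "0 \<le> l x j" using l0 by simp
      thus "eta (1 / ?N * l x j) = eta (l x j) / ?N - l x j * (log 2 ?N / ?N)"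
        using N by (cases "l x j = 0") (auto simp: eta_def log_divide field_simps)
    qed
    also have "\<dots> = (\<Sum>x<d c. (\<Sum>j<card ?B. eta (l x j)) / ?N - log 2 ?N / ?N)"
      by (intro sum.cong refl)
        (simp add: sum_subtractf sum_divide_distrib[symmetric] sum_distrib_right[symmetric] l1 del: sum_divide_distrib)
    also have "\<dots> = (\<Sum>x<d c. (\<Sum>j<card ?B. eta (l x j))) / ?N - log 2 ?N"
      using N by (simp add: sum_subtractf sum_divide_distrib)
    finally show ?thesis unfolding K_def[symmetric] vn_entropy_spectral[OF sp] by (simp add: sum_negf)
  qed
  have e: "vn_entropy d {} (ptrace d R {} (proj (v x))) = 0" if "x < d c" for x
  proof -
    have b: "basis d {} = {\<lambda>_. 0}" by (rule basis_empty)
    have "ptrace d R {} (proj (v x)) (\<lambda>_. 0) (\<lambda>_. 0) = 1"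
    proof -
      have "Re (ptrace d R {} (proj (v x)) (\<lambda>_. 0) (\<lambda>_. 0)) = 1"
        using trace_ptrace_proj[of "{}" R d "v x"] nv[OF that] b by simp
      moreover have "Im (ptrace d R {} (proj (v x)) (\<lambda>_. 0) (\<lambda>_. 0)) = 0"
        unfolding ptrace_def proj_def by simp
      ultimately show ?thesis by (simp add: complex_eq_iff)
    qed
    hence "spectral (basis d {}) (ptrace d R {} (proj (v x))) {()} (\<lambda>_ _. 1) (\<lambda>_. 1)"
      by (simp add: spectral_def onb_def ip_def b)
    from vn_entropy_spectral[OF this] show ?thesis by (simp add: eta_def)
  qed
  have "vn_entropy d {c} (ptrace d R {c} \<rho>) = log 2 ?N" using mix[of "{}"] e by simp
  moreover have "ptrace d R S \<rho> = (\<lambda>\<sigma> \<tau>. \<Sum>x<d c. of_real (1 / ?N) * ptrace d R S (proj (v x)) \<sigma> \<tau>)"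
    unfolding \<rho>_def ptrace_sum ..
  ultimately show ?thesis
    unfolding qmutual_info_def \<rho>_def[symmetric] using mix[OF c(2,3)] by simp
qed

lemma vn_entropy_cong:
  assumes "finite (basis d S)" "hermitian_on (basis d S) K"
    and eq: "\<And>\<sigma> \<tau>. \<sigma> \<in> basis d S \<Longrightarrow> \<tau> \<in> basis d S \<Longrightarrow> K \<sigma> \<tau> = K' \<sigma> \<tau>"
  shows "vn_entropy d S K = vn_entropy d S K'"
proof -
  obtain e l where sp: "spectral (basis d S) K {..<card (basis d S)} e l"
    using spectral_exists[OF assms(1,2)] by blast
  have "spectral (basis d S) K' {..<card (basis d S)} e l" using sp eq by (simp add: spectral_def)
  from vn_entropy_spectral[OF this] vn_entropy_spectral[OF sp] show ?thesis by simp
qed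

lemma merge_swap:
  assumes "a \<in> basis d S" "b \<in> basis d T" "S \<inter> T = {}"
  shows "merge T b a = merge S a b"
  using assms by (auto simp: merge_def basis_def fun_eq_iff)

lemma vn_entropy_ptrace_complement:
  assumes S: "S \<subseteq> R" and fR: "finite R"
  shows "vn_entropy d S (ptrace d R S (proj v)) = vn_entropy d (R - S) (ptrace d R (R - S) (proj v))"
proof -
  have fin: "finite (basis d S)" "finite (basis d (R - S))"
    using S fR finite_subset by (auto intro!: finite_basis)
  have RS: "R - (R - S) = S" using S by auto
  have "vn_entropy d S (ptrace d R S (proj v)) = vn_entropy d (R - S) (gram (basis d S) (\<lambda>\<kappa> \<sigma>. v (merge S \<sigma> \<kappa>)))"
    unfolding ptrace_proj by (rule vn_entropy_complement[OF fin])
  also have "\<dots> = vn_entropy d (R - S) (ptrace d R (R - S) (proj v))"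
  proof (rule vn_entropy_cong[OF fin(2)])
    show "hermitian_on (basis d (R - S)) (gram (basis d S) (\<lambda>\<kappa> \<sigma>. v (merge S \<sigma> \<kappa>)))"
      using psd_gram unfolding psd_def by blast
    show "gram (basis d S) (\<lambda>\<kappa> \<sigma>. v (merge S \<sigma> \<kappa>)) \<sigma> \<tau> = ptrace d R (R - S) (proj v) \<sigma> \<tau>"
      if "\<sigma> \<in> basis d (R - S)" "\<tau> \<in> basis d (R - S)" for \<sigma> \<tau>
      unfolding ptrace_proj RS gram_def
      by (intro sum.cong refl) (use that merge_swap[of _ d S _ "R - S"] in auto)
  qed
  finally show ?thesis .
qed

text \<open>As for Klein's inequality, a measurement with all outcomes merged has classical
  divergence 0.\<close>

lemma qrel_nonneg:
  assumes fS: "finite S" and p: "psd S K" "psd S Q" and dom: "\<And>u. expct S Q u = 0 \<Longrightarrow> expct S K u = 0"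
    and tr: "(\<Sum>x\<in>S. Re (K x x)) = (\<Sum>x\<in>S. Re (Q x x))"
  shows "0 \<le> qrel S K Q"
proof -
  obtain e l where "spectral S K {..<card S} e l" using spectral_exists[OF fS] p(1) unfolding psd_def by blast
  hence o: "onb S {..<card S} e" by (simp add: spectral_def)
  have "(\<Sum>l<card S. expct S K (e l)) = (\<Sum>l<card S. expct S Q (e l))"
    unfolding sum_expct_onb[OF o] tr ..
  hence z: "(\<Sum>l<card S. expct S K (e l)) * ln ((\<Sum>l<card S. expct S K (e l)) / (\<Sum>l<card S. expct S Q (e l))) = 0"
    by simp
  have "(\<Sum>l<card S. expct S K (e l)) * ln ((\<Sum>l<card S. expct S K (e l)) / (\<Sum>l<card S. expct S Q (e l))) \<le> qrel S K Q"
    using measured_relative_entropy[OF p dom o, of "{()}" "\<lambda>_. ()"] by (simp add: lessThan_def[symmetric])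
  thus ?thesis unfolding z .
qed

lemma measured_relative_entropy_basis:
  assumes p: "psd S K" "psd S Q" and dom: "\<And>u. expct S Q u = 0 \<Longrightarrow> expct S K u = 0"
    and o: "onb S J m"
  shows "(\<Sum>j\<in>J. expct S K (m j) * ln (expct S K (m j) / expct S Q (m j))) \<le> qrel S K Q"
proof -
  have "{l \<in> J. l = j} = {j}" if "j \<in> J" for j using that by auto
  hence "(\<Sum>l\<in>{l\<in>J. l = j}. f l) = f j" if "j \<in> J" for j and f :: "_ \<Rightarrow> real" using that by simp
  thus ?thesis
    using measured_relative_entropy[OF p dom o onb_finite(2)[OF o], of "\<lambda>x. x"] by simp
qed

text \<open>Measuring \<open>T\<close> alone means measuring in a product basis of \<open>q\<close>
  and \<open>T\<close> and forgetting the outcome on \<open>q\<close>. The coarse-graining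
  \<open>g\<close> of \<open>measured_relative_entropy\<close> thus does the work of monotonicity
  under partial trace.\<close>

lemma measured_relative_entropy_subsystem:
  assumes q: "q \<notin> T" and fT: "finite T"
    and p: "psd (basis d (insert q T)) K" "psd (basis d (insert q T)) Q"
    and dom: "\<And>u. expct (basis d (insert q T)) Q u = 0 \<Longrightarrow> expct (basis d (insert q T)) K u = 0"
    and o: "onb (basis d T) J m"
    and K': "\<And>\<sigma> \<tau>. \<sigma> \<in> basis d T \<Longrightarrow> \<tau> \<in> basis d T \<Longrightarrow> K' \<sigma> \<tau> = (\<Sum>i<d q. K (\<sigma>(q := i)) (\<tau>(q := i)))"
    and Q': "\<And>\<sigma> \<tau>. \<sigma> \<in> basis d T \<Longrightarrow> \<tau> \<in> basis d T \<Longrightarrow> Q' \<sigma> \<tau> = (\<Sum>i<d q. Q (\<sigma>(q := i)) (\<tau>(q := i)))"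
  shows "(\<Sum>j\<in>J. expct (basis d T) K' (m j) * ln (expct (basis d T) K' (m j) / expct (basis d T) Q' (m j)))
     \<le> qrel (basis d (insert q T)) K Q"
proof -
  let ?T = "basis d (insert q T)"
  have red: "(\<Sum>xl\<in>{xl \<in> {..<d q} \<times> J. snd xl = j}. expct ?T G (on_block q (\<lambda>_. m) xl)) = expct (basis d T) G' (m j)"
    if j: "j \<in> J" and G: "\<And>\<sigma> \<tau>. \<sigma> \<in> basis d T \<Longrightarrow> \<tau> \<in> basis d T \<Longrightarrow> G' \<sigma> \<tau> = (\<Sum>i<d q. G (\<sigma>(q := i)) (\<tau>(q := i)))"
    for j G G'
  proof -
    have "{xl \<in> {..<d q} \<times> J. snd xl = j} = {..<d q} \<times> {j}" using j by auto
    hence "(\<Sum>xl\<in>{xl \<in> {..<d q} \<times> J. snd xl = j}. expct ?T G (on_block q (\<lambda>_. m) xl))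
       = (\<Sum>x<d q. expct ?T G (on_block q (\<lambda>_. m) (x, j)))"
      by (simp add: sum.cartesian_product' )
    also have "\<dots> = (\<Sum>x<d q. 1 * expct (basis d T) (\<lambda>\<sigma> \<tau>. G (\<sigma>(q := x)) (\<tau>(q := x))) (m j))"
      by (intro sum.cong refl) (simp add: expct_on_block q)
    also have "\<dots> = expct (basis d T) G' (m j)"
      by (rule expct_lincomb[symmetric]) (simp add: G)
    finally show ?thesis .
  qed
  have ob: "onb ?T ({..<d q} \<times> J) (on_block q (\<lambda>_. m))"
    by (rule onb_block[OF q o fT onb_finite(2)[OF o]])
  have "(\<Sum>j\<in>J. expct (basis d T) K' (m j) * ln (expct (basis d T) K' (m j) / expct (basis d T) Q' (m j)))
    = (\<Sum>j\<in>J. (\<Sum>xl\<in>{xl \<in> {..<d q} \<times> J. snd xl = j}. expct ?T K (on_block q (\<lambda>_. m) xl)) *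
      ln ((\<Sum>xl\<in>{xl \<in> {..<d q} \<times> J. snd xl = j}. expct ?T K (on_block q (\<lambda>_. m) xl)) /
          (\<Sum>xl\<in>{xl \<in> {..<d q} \<times> J. snd xl = j}. expct ?T Q (on_block q (\<lambda>_. m) xl))))"
    by (rule sum.cong[OF refl]) (simp only: red[where G = K and G' = K', OF _ K'] red[where G = Q and G' = Q', OF _ Q'])
  also have "\<dots> \<le> qrel ?T K Q"
    by (rule measured_relative_entropy[OF p dom ob onb_finite(2)[OF o]]) auto
  finally show ?thesis .
qed

section \<open>Protocol runs: inputs act as controls only, and norms are preserved\<close>

lemma unitary_on_norm:
  assumes U: "unitary_on d S U" and fS: "finite S"
  shows "(\<Sum>\<alpha>\<in>basis d S. (cmod (\<Sum>\<tau>\<in>basis d S. U \<alpha> \<tau> * g \<tau>))\<^sup>2) = (\<Sum>\<tau>\<in>basis d S. (cmod (g \<tau>))\<^sup>2)"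
proof -
  let ?B = "basis d S"
  have "of_real (\<Sum>\<alpha>\<in>?B. (cmod (\<Sum>\<tau>\<in>?B. U \<alpha> \<tau> * g \<tau>))\<^sup>2)
    = (\<Sum>\<alpha>\<in>?B. \<Sum>\<tau>\<in>?B. \<Sum>\<kappa>\<in>?B. (U \<alpha> \<tau> * g \<tau>) * cnj (U \<alpha> \<kappa> * g \<kappa>))"
    unfolding of_real_sum complex_norm_square cnj_sum sum_product ..
  also have "\<dots> = (\<Sum>\<tau>\<in>?B. \<Sum>\<kappa>\<in>?B. \<Sum>\<alpha>\<in>?B. (U \<alpha> \<tau> * g \<tau>) * cnj (U \<alpha> \<kappa> * g \<kappa>))"
    by (subst sum.swap, rule sum.cong[OF refl], rule sum.swap)
  also have "\<dots> = (\<Sum>\<tau>\<in>?B. \<Sum>\<kappa>\<in>?B. g \<tau> * cnj (g \<kappa>) * (\<Sum>\<alpha>\<in>?B. cnj (U \<alpha> \<kappa>) * U \<alpha> \<tau>))"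
    unfolding sum_distrib_left by (simp add: mult_ac)
  also have "\<dots> = (\<Sum>\<tau>\<in>?B. \<Sum>\<kappa>\<in>?B. if \<kappa> = \<tau> then g \<tau> * cnj (g \<kappa>) else 0)"
    using U by (intro sum.cong refl) (simp add: unitary_on_def)
  also have "\<dots> = (\<Sum>\<tau>\<in>?B. g \<tau> * cnj (g \<tau>))" using finite_basis[OF fS] by simp
  also have "\<dots> = of_real (\<Sum>\<tau>\<in>?B. (cmod (g \<tau>))\<^sup>2)" unfolding of_real_sum complex_norm_square ..
  finally show ?thesis by (simp only: of_real_eq_iff)
qed

lemma workregs_not_input: "Xr \<notin> workregs m" "Yr \<notin> workregs m" "Xr \<noteq> Yr"
  by (auto simp: workregs_def Xr_def Yr_def)

lemma acting_subset: "acting_qubits P t \<subseteq> workregs (nwork P)"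
  by (auto simp: acting_qubits_def)

text \<open>Amplitude 1 on every input is unnormalised, but no round alters an input register. The
  value at a configuration is therefore the final amplitude of the run on exactly its inputs, and
  every other run is this one multiplied by its own input amplitudes.\<close>

definition final_amp :: "nat \<Rightarrow> nat \<Rightarrow> protocol \<Rightarrow> qvec" where
  "final_amp n ny P = run n ny P (init_state P (\<lambda>_. 1) (\<lambda>_. 1))"

lemma run_init_state:
  "run n ny P (init_state P \<alpha> \<beta>) = (\<lambda>\<sigma>. \<alpha> (\<sigma> Xr) * \<beta> (\<sigma> Yr) * final_amp n ny P \<sigma>)"
proof -
  have step: "apply_round n ny P t (\<lambda>\<sigma>. \<alpha> (\<sigma> Xr) * \<beta> (\<sigma> Yr) * v \<sigma>)
     = (\<lambda>\<sigma>. \<alpha> (\<sigma> Xr) * \<beta> (\<sigma> Yr) * apply_round n ny P t v \<sigma>)" for t v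
  proof
    fix \<sigma>
    have "Xr \<notin> acting_qubits P t" "Yr \<notin> acting_qubits P t"
      using acting_subset workregs_not_input by blast+
    thus "apply_round n ny P t (\<lambda>\<sigma>. \<alpha> (\<sigma> Xr) * \<beta> (\<sigma> Yr) * v \<sigma>) \<sigma> = \<alpha> (\<sigma> Xr) * \<beta> (\<sigma> Yr) * apply_round n ny P t v \<sigma>"
      unfolding apply_round_def sum_distrib_left by (simp add: merge_def mult_ac)
  qed
  have "fold (apply_round n ny P) ts (\<lambda>\<sigma>. \<alpha> (\<sigma> Xr) * \<beta> (\<sigma> Yr) * v \<sigma>)
     = (\<lambda>\<sigma>. \<alpha> (\<sigma> Xr) * \<beta> (\<sigma> Yr) * fold (apply_round n ny P) ts v \<sigma>)" for ts v
    by (induction ts arbitrary: v) (simp_all add: step)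
  from this[of "[0..<rounds P]" "init_state P (\<lambda>_. 1) (\<lambda>_. 1)"]
  show ?thesis by (simp add: final_amp_def run_def init_state_def)
qed

text \<open>For a fixed pair of inputs the round is a single unitary on the qubits \<open>S\<close>,
  with the remaining work qubits \<open>\<beta>\<close> as spectators. Working input by input is
  what the unnormalised \<open>final_amp\<close> calls for.\<close>

lemma apply_round_norm:
  assumes v: "valid_protocol n ny P" and t: "t < rounds P" and xy: "x < 2 ^ n" "y < ny"
  shows "(\<Sum>\<kappa>\<in>basis (dims n ny) (workregs (nwork P)). (cmod (apply_round n ny P t u (\<kappa>(Yr := y, Xr := x))))\<^sup>2)
    = (\<Sum>\<kappa>\<in>basis (dims n ny) (workregs (nwork P)). (cmod (u (\<kappa>(Yr := y, Xr := x))))\<^sup>2)"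
proof -
  let ?d = "dims n ny" and ?W = "workregs (nwork P)"
  define S where "S = acting_qubits P t"
  define z where "z = (if alice_acts P t then x else y)"
  have SW: "S \<subseteq> ?W" unfolding S_def by (rule acting_subset)
  have in_S: "Xr \<notin> S" "Yr \<notin> S" using SW workregs_not_input by blast+
  have fS: "finite S" using SW by (rule finite_subset) (simp add: workregs_def)
  have "z < dims n ny (input_reg P t)"
    using xy by (auto simp: z_def input_reg_def dims_def workregs_not_input(3) Xr_def Yr_def)
  hence U: "unitary_on ?d S (unis P t z)" using v t unfolding valid_protocol_def S_def by blast
  have W: "?W = S \<union> (?W - S)" using SW by auto
  have split: "(\<Sum>\<kappa>\<in>basis ?d ?W. f \<kappa>) = (\<Sum>\<beta>\<in>basis ?d (?W - S). \<Sum>\<alpha>\<in>basis ?d S. f (merge S \<alpha> \<beta>))" for f :: "cfg \<Rightarrow> real"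
    by (subst W, subst sum_basis_Un) (auto intro: sum.swap)
  have step: "apply_round n ny P t u ((merge S \<alpha> \<beta>)(Yr := y, Xr := x))
      = (\<Sum>\<tau>\<in>basis ?d S. unis P t z \<alpha> \<tau> * u ((merge S \<tau> \<beta>)(Yr := y, Xr := x)))"
    if "\<alpha> \<in> basis ?d S" for \<alpha> \<beta>
  proof -
    have "restr S ((merge S \<alpha> \<beta>)(Yr := y, Xr := x)) = \<alpha>"
      using that in_S by (auto simp: restr_def merge_def basis_def fun_eq_iff)
    moreover have "merge S \<tau> ((merge S \<alpha> \<beta>)(Yr := y, Xr := x)) = (merge S \<tau> \<beta>)(Yr := y, Xr := x)" for \<tau>
      using in_S by (auto simp: merge_def fun_eq_iff)
    moreover have "((merge S \<alpha> \<beta>)(Yr := y, Xr := x)) (input_reg P t) = z"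
      using workregs_not_input(3) by (simp add: input_reg_def z_def)
    ultimately show ?thesis unfolding apply_round_def S_def[symmetric] by simp
  qed
  show ?thesis unfolding split
    by (rule sum.cong[OF refl]) (simp add: step unitary_on_norm[OF U fS])
qed

lemma final_amp_norm:
  assumes v: "valid_protocol n ny P" and xy: "x < 2 ^ n" "y < ny"
  shows "(\<Sum>\<kappa>\<in>basis (dims n ny) (workregs (nwork P)). (cmod (final_amp n ny P (\<kappa>(Yr := y, Xr := x))))\<^sup>2) = 1"
proof -
  let ?B = "basis (dims n ny) (workregs (nwork P))"
  have "(\<Sum>\<kappa>\<in>?B. (cmod (fold (apply_round n ny P) [0..<t] u (\<kappa>(Yr := y, Xr := x))))\<^sup>2)
     = (\<Sum>\<kappa>\<in>?B. (cmod (u (\<kappa>(Yr := y, Xr := x))))\<^sup>2)" if "t \<le> rounds P" for t u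
    using that by (induction t) (simp_all add: apply_round_norm[OF v _ xy])
  from this[of "rounds P" "init_state P (\<lambda>_. 1) (\<lambda>_. 1)"]
  have "(\<Sum>\<kappa>\<in>?B. (cmod (final_amp n ny P (\<kappa>(Yr := y, Xr := x))))\<^sup>2)
     = (\<Sum>\<kappa>\<in>?B. (cmod (init_state P (\<lambda>_. 1) (\<lambda>_. 1) (\<kappa>(Yr := y, Xr := x))))\<^sup>2)"
    by (simp add: final_amp_def run_def)
  also have "\<dots> = (\<Sum>\<kappa>\<in>?B. (cmod (psi P \<kappa>))\<^sup>2)"
  proof (rule sum.cong[OF refl])
    fix \<kappa> assume k: "\<kappa> \<in> ?B"
    have "restr (workregs (nwork P)) (\<kappa>(Yr := y, Xr := x)) = \<kappa>"
      using k workregs_not_input by (auto simp: restr_def basis_def fun_eq_iff)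
    thus "(cmod (init_state P (\<lambda>_. 1) (\<lambda>_. 1) (\<kappa>(Yr := y, Xr := x))))\<^sup>2 = (cmod (psi P \<kappa>))\<^sup>2"
      by (simp add: init_state_def)
  qed
  also have "\<dots> = 1" using v by (simp add: valid_protocol_def unit_vec_def)
  finally show ?thesis .
qed

lemma sum_basis_allregs:
  "(\<Sum>\<sigma>\<in>basis (dims n ny) (allregs m). f \<sigma>)
    = (\<Sum>x<2 ^ n. \<Sum>y<ny. \<Sum>\<kappa>\<in>basis (dims n ny) (workregs m). f (\<kappa>(Yr := y, Xr := x)))"
proof -
  have a: "allregs m = insert Xr (insert Yr (workregs m))" by (auto simp: allregs_def)
  have d: "dims n ny Xr = 2 ^ n" "dims n ny Yr = ny" by (auto simp: dims_def Xr_def Yr_def)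
  have "(\<Sum>\<sigma>\<in>basis (dims n ny) (allregs m). f \<sigma>)
    = (\<Sum>\<kappa>\<in>basis (dims n ny) (workregs m). \<Sum>y<ny. \<Sum>x<2 ^ n. f (\<kappa>(Yr := y, Xr := x)))"
    unfolding a using workregs_not_input by (simp add: sum_basis_insert d)
  also have "\<dots> = (\<Sum>\<kappa>\<in>basis (dims n ny) (workregs m). \<Sum>x<2 ^ n. \<Sum>y<ny. f (\<kappa>(Yr := y, Xr := x)))"
    by (rule sum.cong[OF refl], rule sum.swap)
  also have "\<dots> = (\<Sum>x<2 ^ n. \<Sum>\<kappa>\<in>basis (dims n ny) (workregs m). \<Sum>y<ny. f (\<kappa>(Yr := y, Xr := x)))"
    by (rule sum.swap)
  also have "\<dots> = (\<Sum>x<2 ^ n. \<Sum>y<ny. \<Sum>\<kappa>\<in>basis (dims n ny) (workregs m). f (\<kappa>(Yr := y, Xr := x)))"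
    by (rule sum.cong[OF refl], rule sum.swap)
  finally show ?thesis .
qed

section \<open>The final state of a set membership protocol\<close>

lemma expct_average_zero:
  assumes Q: "\<And>a b. a \<in> S \<Longrightarrow> b \<in> S \<Longrightarrow> Q a b = (\<Sum>i<N. of_real (1 / real N) * K i a b)"
    and K: "\<And>i. psd S (K i)" and i: "i < N" and z: "expct S Q u = 0"
  shows "expct S (K i) u = 0"
proof -
  have "(\<Sum>i<N. (1 / real N) * expct S (K i) u) = 0" using expct_lincomb[OF Q, where u = u] z by simp
  hence "\<forall>i\<in>{..<N}. (1 / real N) * expct S (K i) u = 0"
    using K by (subst (asm) sum_nonneg_eq_0_iff) (auto simp: psd_def)
  thus ?thesis using i by auto
qed

locale setmemb_run =
  fixes n :: nat and P :: protocol
  assumes n1: "1 \<le> n" and valid: "valid_protocol n n P"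
begin

abbreviation "d \<equiv> dims n n"
abbreviation "W \<equiv> workregs (nwork P)"
abbreviation "R \<equiv> allregs (nwork P)"
abbreviation "q \<equiv> ans P"
abbreviation "lossA \<equiv> loss_AB n n P (\<lambda>x. 1 / 2 ^ n) (\<lambda>i. 1 / real n)"
abbreviation "lossB \<equiv> loss_BA n n P (\<lambda>x. 1 / 2 ^ n) (\<lambda>i. 1 / real n)"
abbreviation "\<phi> \<equiv> final_amp n n P"

text \<open>\<open>vx\<close> and \<open>wi\<close> are the pure final states whose mixtures occur
  in \<open>loss_AB\<close> and \<open>loss_BA\<close>.\<close>

definition vx :: "nat \<Rightarrow> qvec" where
  "vx x = run n n P (init_state P (ket x) (\<lambda>_. complex_of_real (sqrt (1 / real n))))"
definition wi :: "nat \<Rightarrow> qvec" where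
  "wi i = run n n P (init_state P (\<lambda>_. complex_of_real (sqrt (1 / 2 ^ n))) (ket i))"

text \<open>The answer qubit is always counted on Bob's side: a single qubit changes his information
  by at most two bits, which is the source of the final \<open>- 2\<close>.\<close>
definition SA :: "nat set" where "SA = (regA P - {q}) \<union> {Xr}"
definition SB :: "nat set" where "SB = (regB P \<union> {q}) \<union> {Yr}"

lemma vx: "vx x \<sigma> = (if \<sigma> Xr = x then of_real (sqrt (1 / real n)) * \<phi> \<sigma> else 0)"
  by (simp add: vx_def run_init_state ket_def)

lemma wi: "wi i \<sigma> = (if \<sigma> Yr = i then of_real (sqrt (1 / 2 ^ n)) * \<phi> \<sigma> else 0)"
  by (simp add: wi_def run_init_state ket_def)

lemma qW: "q \<in> W" using valid by (simp add: valid_protocol_def)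

lemma q_neq: "q \<noteq> Xr" "q \<noteq> Yr" using qW workregs_not_input by metis+

lemma d_vals: "d Xr = 2 ^ n" "d Yr = n" "d q = 2"
  using q_neq workregs_not_input(3) by (auto simp: dims_def)

lemma fR: "finite R" by (simp add: allregs_def workregs_def)

lemma regs:
  "regA P \<subseteq> W" "regB P \<subseteq> W" "regA P \<inter> regB P = {}" "regA P \<union> regB P = W"
  by (auto simp: regA_def regB_def)

lemma SAB: "SA \<union> SB = R" "SA \<inter> SB = {}" "R - SA = SB" "R - SB = SA" "SA \<subseteq> R" "SB \<subseteq> R"
  "Xr \<in> SA" "Yr \<in> SB" "q \<in> SB" "Xr \<notin> SB" "Yr \<notin> SA" "q \<notin> SA"
proof -
  have f: "Xr \<notin> W" "Yr \<notin> W" "Xr \<notin> regA P" "Yr \<notin> regA P" "Xr \<notin> regB P" "Yr \<notin> regB P" "Yr \<noteq> Xr"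
    using regs workregs_not_input by auto
  have e: "R = regA P \<union> regB P \<union> {q, Xr, Yr}" using regs(4) qW by (auto simp: allregs_def)
  show u: "SA \<union> SB = R" and i: "SA \<inter> SB = {}"
    using f regs(3) q_neq unfolding e SA_def SB_def by auto
  from u i show "R - SA = SB" "R - SB = SA" "SA \<subseteq> R" "SB \<subseteq> R" by auto
  show m: "Xr \<in> SA" "Yr \<in> SB" "q \<in> SB" by (auto simp: SA_def SB_def)
  from m i show "Xr \<notin> SB" "Yr \<notin> SA" "q \<notin> SA" by auto
qed

lemma finSAB: "finite SA" "finite SB"
  using SAB(5,6) fR finite_subset by blast+

lemma finB: "finite (basis d SA)" "finite (basis d SB)"
  using finSAB finite_basis by blast+

lemma vx_norm: "x < 2 ^ n \<Longrightarrow> (\<Sum>\<sigma>\<in>basis d R. (cmod (vx x \<sigma>))\<^sup>2) = 1"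
proof -
  assume x: "x < 2 ^ n"
  have "(\<Sum>\<sigma>\<in>basis d R. (cmod (vx x \<sigma>))\<^sup>2) = (\<Sum>x'<2 ^ n. if x' = x then
      (\<Sum>y<n. (1 / real n) * (\<Sum>\<kappa>\<in>basis d W. (cmod (\<phi> (\<kappa>(Yr := y, Xr := x))))\<^sup>2)) else 0)"
    unfolding sum_basis_allregs
    by (intro sum.cong refl) (auto simp: vx sum_distrib_left norm_mult power_mult_distrib)
  also have "\<dots> = (\<Sum>y<n. (1 / real n) * (\<Sum>\<kappa>\<in>basis d W. (cmod (\<phi> (\<kappa>(Yr := y, Xr := x))))\<^sup>2))"
    using x by simp
  also have "\<dots> = (\<Sum>y<n. 1 / real n)"
    by (intro sum.cong refl) (simp add: final_amp_norm[OF valid x])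
  finally show ?thesis using n1 by simp
qed

lemma wi_sum:
  fixes h :: "cfg \<Rightarrow> real"
  assumes i: "i < n"
  shows "(\<Sum>\<sigma>\<in>basis d R. h \<sigma> * (cmod (wi i \<sigma>))\<^sup>2) =
    (\<Sum>x<2 ^ n. \<Sum>\<kappa>\<in>basis d W. h (\<kappa>(Yr := i, Xr := x)) * (cmod (\<phi> (\<kappa>(Yr := i, Xr := x))))\<^sup>2) / 2 ^ n"
proof -
  have w: "(cmod (wi i (\<kappa>(Yr := y, Xr := x))))\<^sup>2 = (if y = i then (cmod (\<phi> (\<kappa>(Yr := i, Xr := x))))\<^sup>2 / 2 ^ n else 0)"
    for \<kappa> y x
    using workregs_not_input(3) by (auto simp: wi norm_mult power_mult_distrib real_sqrt_divide norm_divide power_divide)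
  have "(\<Sum>\<kappa>\<in>basis d W. h (\<kappa>(Yr := y, Xr := x)) * (cmod (wi i (\<kappa>(Yr := y, Xr := x))))\<^sup>2) = (if y = i then
      (\<Sum>\<kappa>\<in>basis d W. h (\<kappa>(Yr := i, Xr := x)) * (cmod (\<phi> (\<kappa>(Yr := i, Xr := x))))\<^sup>2) / 2 ^ n else 0)" for x y
    unfolding w by (cases "y = i") (simp_all add: sum_divide_distrib)
  hence "(\<Sum>\<sigma>\<in>basis d R. h \<sigma> * (cmod (wi i \<sigma>))\<^sup>2) = (\<Sum>x<2 ^ n. \<Sum>y<n. if y = i then
      (\<Sum>\<kappa>\<in>basis d W. h (\<kappa>(Yr := i, Xr := x)) * (cmod (\<phi> (\<kappa>(Yr := i, Xr := x))))\<^sup>2) / 2 ^ n else 0)"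
    unfolding sum_basis_allregs by presburger
  also have "\<dots> = (\<Sum>x<2 ^ n. (\<Sum>\<kappa>\<in>basis d W. h (\<kappa>(Yr := i, Xr := x)) * (cmod (\<phi> (\<kappa>(Yr := i, Xr := x))))\<^sup>2) / 2 ^ n)"
    using i by simp
  also have "\<dots> = (\<Sum>x<2 ^ n. \<Sum>\<kappa>\<in>basis d W. h (\<kappa>(Yr := i, Xr := x)) * (cmod (\<phi> (\<kappa>(Yr := i, Xr := x))))\<^sup>2) / 2 ^ n"
    by (rule sum_divide_distrib[symmetric])
  finally show ?thesis .
qed

lemma wi_norm: "i < n \<Longrightarrow> (\<Sum>\<sigma>\<in>basis d R. (cmod (wi i \<sigma>))\<^sup>2) = 1"
  using wi_sum[of i "\<lambda>_. 1"] by (simp add: final_amp_norm[OF valid])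

text \<open>The final state with both inputs in superposition, as a matrix between Alice's side and
  Bob's side.\<close>

definition V :: "cfg \<Rightarrow> cfg \<Rightarrow> complex" where
  "V a b = of_real (sqrt (1 / (real n * 2 ^ n))) * \<phi> (merge SA a b)"

definition \<Phi> :: "nat \<Rightarrow> cfg \<Rightarrow> cfg \<Rightarrow> complex" where
  "\<Phi> i a b = wi i (merge SA a b)"

definition \<sigma>B :: "nat \<Rightarrow> qop" where "\<sigma>B x = ptrace d R SB (proj (vx x))"

lemma merge_vals: "(merge SA a b) Xr = a Xr" "(merge SA a b) Yr = b Yr" "(merge SA a b) q = b q"
  using SAB by (auto simp: merge_def)

lemma sum_SAB: "(\<Sum>\<sigma>\<in>basis d R. f \<sigma>) = (\<Sum>a\<in>basis d SA. \<Sum>b\<in>basis d SB. f (merge SA a b))"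
  using sum_basis_Un[OF SAB(2), where d = d and f = f] SAB(1) by simp

lemma ptrace_wi: "ptrace d R SA (proj (wi i)) = gram (basis d SB) (\<Phi> i)"
  unfolding ptrace_proj SAB(3) \<Phi>_def[abs_def] ..

lemma sqrt_prod: "complex_of_real (sqrt c) * x * cnj (of_real (sqrt c) * y) = of_real \<bar>c\<bar> * (x * cnj y)"
proof -
  have "complex_of_real (sqrt c) * of_real (sqrt c) = of_real \<bar>c\<bar>"
    unfolding of_real_mult[symmetric] by simp
  thus ?thesis by (metis (no_types, opaque_lifting) complex_cnj_complex_of_real complex_cnj_mult mult.assoc mult.left_commute)
qed

text \<open>Bob's side contains \<open>Yr\<close>; tracing it out destroys the coherence between his
  inputs, so Alice cannot tell the superposition from the uniform mixture.\<close>

lemma gram_V: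
  "gram (basis d SB) V a a' = (\<Sum>i<n. of_real (1 / real n) * gram (basis d SB) (\<Phi> i) a a')"
proof -
  have "(\<Sum>i<n. of_real (1 / real n) * gram (basis d SB) (\<Phi> i) a a')
     = (\<Sum>b\<in>basis d SB. \<Sum>i<n. if i = b Yr then of_real (1 / (real n * 2 ^ n)) * (\<phi> (merge SA a b) * cnj (\<phi> (merge SA a' b))) else 0)"
  proof -
    have t: "of_real (1 / real n) * (\<Phi> i a b * cnj (\<Phi> i a' b)) =
      (if i = b Yr then of_real (1 / (real n * 2 ^ n)) * (\<phi> (merge SA a b) * cnj (\<phi> (merge SA a' b))) else 0)" for i b
    proof (cases "i = b Yr")
      case True
      have "\<Phi> i a b * cnj (\<Phi> i a' b) = of_real \<bar>1 / 2 ^ n\<bar> * (\<phi> (merge SA a b) * cnj (\<phi> (merge SA a' b)))"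
        unfolding \<Phi>_def wi merge_vals True by (simp only: refl if_True sqrt_prod)
      thus ?thesis using True by simp
    qed (simp add: \<Phi>_def wi merge_vals)
    show ?thesis unfolding gram_def sum_distrib_left t by (rule sum.swap)
  qed
  also have "\<dots> = (\<Sum>b\<in>basis d SB. of_real (1 / (real n * 2 ^ n)) * (\<phi> (merge SA a b) * cnj (\<phi> (merge SA a' b))))"
  proof (rule sum.cong[OF refl])
    fix b assume "b \<in> basis d SB"
    hence "b Yr < n" using SAB(8) d_vals(2) by (auto simp: basis_def)
    thus "(\<Sum>i<n. if i = b Yr then of_real (1 / (real n * 2 ^ n)) * (\<phi> (merge SA a b) * cnj (\<phi> (merge SA a' b))) else 0)
      = of_real (1 / (real n * 2 ^ n)) * (\<phi> (merge SA a b) * cnj (\<phi> (merge SA a' b)))" by simp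
  qed
  also have "\<dots> = gram (basis d SB) V a a'"
    unfolding gram_def V_def sqrt_prod by simp
  finally show ?thesis by simp
qed

lemma trace_Phi: "i < n \<Longrightarrow> (\<Sum>a\<in>basis d SA. \<Sum>b\<in>basis d SB. (cmod (\<Phi> i a b))\<^sup>2) = 1"
  using wi_norm[of i] unfolding sum_SAB by (simp add: \<Phi>_def)

lemma trace_V: "(\<Sum>a\<in>basis d SA. \<Sum>b\<in>basis d SB. (cmod (V a b))\<^sup>2) = 1"
proof -
  have "(\<Sum>a\<in>basis d SA. \<Sum>b\<in>basis d SB. (cmod (V a b))\<^sup>2) = (\<Sum>a\<in>basis d SA. Re (gram (basis d SB) V a a))"
    by (rule trace_gram[symmetric])
  also have "\<dots> = (\<Sum>i<n. (1 / real n) * (\<Sum>a\<in>basis d SA. Re (gram (basis d SB) (\<Phi> i) a a)))"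
    unfolding gram_V Re_sum sum_distrib_left by (subst sum.swap) simp
  also have "\<dots> = (\<Sum>i<n. 1 / real n)"
    unfolding trace_gram by (intro sum.cong refl) (simp add: trace_Phi)
  finally show ?thesis using n1 by simp
qed

lemma loss_BA_eq:
  "lossB =
    vn_entropy d (regA P \<union> {Xr}) (\<lambda>\<sigma> \<tau>. \<Sum>i<n. of_real (1 / real n) * ptrace d R (regA P \<union> {Xr}) (proj (wi i)) \<sigma> \<tau>)
      - (\<Sum>i<n. vn_entropy d (regA P \<union> {Xr}) (ptrace d R (regA P \<union> {Xr}) (proj (wi i)))) / real n"
proof -
  have "Yr \<in> R" "Yr \<notin> regA P \<union> {Xr}" "regA P \<union> {Xr} \<subseteq> R"
    using regs workregs_not_input unfolding allregs_def by auto
  from qmutual_info_classical[OF this fR, of d wi] show ?thesis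
    unfolding loss_BA_def wi_def[symmetric] using n1 wi_norm by (simp add: d_vals wi)
qed

lemma loss_AB_eq:
  "lossA =
    vn_entropy d (regB P \<union> {Yr}) (\<lambda>\<sigma> \<tau>. \<Sum>x<2 ^ n. of_real (1 / 2 ^ n) * ptrace d R (regB P \<union> {Yr}) (proj (vx x)) \<sigma> \<tau>)
      - (\<Sum>x<2 ^ n. vn_entropy d (regB P \<union> {Yr}) (ptrace d R (regB P \<union> {Yr}) (proj (vx x)))) / 2 ^ n"
proof -
  have "Xr \<in> R" "Xr \<notin> regB P \<union> {Yr}" "regB P \<union> {Yr} \<subseteq> R"
    using regs workregs_not_input unfolding allregs_def by auto
  from qmutual_info_classical[OF this fR, of d vx] show ?thesis
    unfolding loss_AB_def vx_def[symmetric] using vx_norm by (simp add: d_vals vx)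
qed

definition measured_kl :: "nat \<Rightarrow> (nat \<Rightarrow> cfg \<Rightarrow> complex) \<Rightarrow> real" where
  "measured_kl i m = (\<Sum>j<card (basis d SA). expct (basis d SA) (gram (basis d SB) (\<Phi> i)) (m j) *
        ln (expct (basis d SA) (gram (basis d SB) (\<Phi> i)) (m j) / expct (basis d SA) (gram (basis d SB) V) (m j)))"

text \<open>\<open>\<kappa> i\<close> is the divergence on all registers that Alice owns at the end.
  If these include the answer qubit, \<open>SA\<close> is a proper subsystem, and a measurement on
  \<open>SA\<close> is handled by forgetting the outcome on that qubit; so moving it to Bob's side
  costs nothing here.\<close>

lemma alice_relative_entropy:
  "\<exists>\<kappa>. (\<Sum>i<n. \<kappa> i) = real n * (ln 2 * lossB) \<and> (\<forall>i<n. 0 \<le> \<kappa> i) \<and>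
    (\<forall>i<n. \<forall>m. onb (basis d SA) {..<card (basis d SA)} m \<longrightarrow>
      measured_kl i m \<le> \<kappa> i)"
proof -
  define S where "S = regA P \<union> {Xr}"
  define K where "K i = ptrace d R S (proj (wi i))" for i
  define Q where "Q = (\<lambda>\<sigma> \<tau>. \<Sum>i<n. of_real (1 / real n) * K i \<sigma> \<tau>)"
  define \<kappa> where "\<kappa> i = qrel (basis d S) (K i) Q" for i
  have SR: "S \<subseteq> R" using regs unfolding S_def allregs_def by auto
  have fS: "finite S" using SR fR finite_subset by blast
  have psd: "psd (basis d S) (K i)" for i unfolding K_def ptrace_proj by (rule psd_gram)
  have psdQ: "psd (basis d S) Q"
    by (rule psd_lincomb[where I = "{..<n}" and w = "\<lambda>_. 1 / real n" and R = K]) (use psd in \<open>auto simp: Q_def\<close>)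
  have dom: "expct (basis d S) (K i) u = 0" if "i < n" "expct (basis d S) Q u = 0" for i u
    by (rule expct_average_zero[OF _ psd that]) (simp add: Q_def)
  have trK: "(\<Sum>x\<in>basis d S. Re (K i x x)) = 1" if "i < n" for i
    unfolding K_def trace_ptrace_proj[OF SR] by (rule wi_norm[OF that])
  have trQ: "(\<Sum>x\<in>basis d S. Re (Q x x)) = 1"
  proof -
    have "(\<Sum>x\<in>basis d S. Re (Q x x)) = (\<Sum>i<n. (1 / real n) * (\<Sum>x\<in>basis d S. Re (K i x x)))"
      unfolding Q_def Re_sum sum_distrib_left by (subst sum.swap) simp
    thus ?thesis using trK n1 by simp
  qed
  have "(\<Sum>i<n. (1 / real n) * \<kappa> i) = ln 2 * (vn_entropy d S Q - (\<Sum>i<n. (1 / real n) * vn_entropy d S (K i)))"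
    unfolding \<kappa>_def by (rule sum_qrel[OF finite_basis[OF fS]]) (use psd in \<open>auto simp: Q_def\<close>)
  also have "\<dots> = ln 2 * lossB"
    unfolding loss_BA_eq S_def[symmetric] K_def[symmetric] Q_def[symmetric] by (simp add: sum_divide_distrib)
  finally have "(\<Sum>i<n. \<kappa> i) / real n = ln 2 * lossB"
    by (simp add: sum_divide_distrib)
  hence sum: "(\<Sum>i<n. \<kappa> i) = real n * (ln 2 * lossB)"
    using n1 by (simp add: field_simps)
  have nonneg: "0 \<le> \<kappa> i" if "i < n" for i
    unfolding \<kappa>_def
    by (rule qrel_nonneg[OF finite_basis[OF fS] psd psdQ dom[OF that]]) (simp_all add: trK[OF that] trQ)
  have kl: "measured_kl i m \<le> \<kappa> i"
    if i: "i < n" and m: "onb (basis d SA) {..<card (basis d SA)} m" for i m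
  proof (cases "q \<in> regA P")
    case True
    have S: "S = insert q SA" using True q_neq by (auto simp: S_def SA_def)
    have qR: "q \<in> R" using SAB(6,9) by blast
    have red: "gram (basis d SB) (\<Phi> i) \<sigma> \<tau> = (\<Sum>x<d q. K i (\<sigma>(q := x)) (\<tau>(q := x)))"
      if "\<sigma> \<in> basis d SA" "\<tau> \<in> basis d SA" for \<sigma> \<tau> i
      unfolding ptrace_wi[symmetric] K_def S by (rule ptrace_insert[OF qR SAB(12) that])
    show ?thesis unfolding measured_kl_def \<kappa>_def S
    proof (rule measured_relative_entropy_subsystem[OF SAB(12) finSAB(1) psd[unfolded S] psdQ[unfolded S] dom[OF i, unfolded S] m])
      fix \<sigma> \<tau> assume st: "\<sigma> \<in> basis d SA" "\<tau> \<in> basis d SA"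
      show "gram (basis d SB) (\<Phi> i) \<sigma> \<tau> = (\<Sum>x<d q. K i (\<sigma>(q := x)) (\<tau>(q := x)))" by (rule red[OF st])
      show "gram (basis d SB) V \<sigma> \<tau> = (\<Sum>x<d q. Q (\<sigma>(q := x)) (\<tau>(q := x)))"
        unfolding gram_V red[OF st] Q_def sum_distrib_left by (rule sum.swap)
    qed
  next
    case False
    have S: "S = SA" using False by (auto simp: S_def SA_def)
    have K: "gram (basis d SB) (\<Phi> i) = K i" for i unfolding ptrace_wi[symmetric] K_def S ..
    have Q: "gram (basis d SB) V = Q" by (intro ext) (simp only: gram_V K Q_def)
    show ?thesis unfolding measured_kl_def \<kappa>_def K Q unfolding S
      by (rule measured_relative_entropy_basis[OF psd[unfolded S] psdQ[unfolded S] dom[OF i, unfolded S] m])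
  qed
  show ?thesis using sum nonneg kl by blast
qed

text \<open>If Alice owns the answer qubit, giving it to Bob raises the entropy of his average state
  by at most 1. For fixed \<open>x\<close> the global state is pure, so Bob's entropy equals that of
  the complement; there subadditivity shows that the transfer lowers his entropy by at most 1. The
  two effects add up to 2.\<close>

lemma bob_holevo_le:
  "vn_entropy d SB (\<lambda>\<sigma> \<tau>. \<Sum>x<2 ^ n. of_real (1 / 2 ^ n) * \<sigma>B x \<sigma> \<tau>) - (\<Sum>x<2 ^ n. vn_entropy d SB (\<sigma>B x)) / 2 ^ n
     \<le> lossA + 2"
proof (cases "q \<in> regB P")
  case True
  hence "regB P \<union> {Yr} = SB" by (auto simp: SB_def)
  thus ?thesis unfolding loss_AB_eq \<sigma>B_def by simp
next
  case False
  define S where "S = regB P \<union> {Yr}"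
  have qS: "q \<notin> S" using False q_neq by (auto simp: S_def)
  have SB: "SB = insert q S" by (auto simp: S_def SB_def)
  have qR: "q \<in> R" using SAB(6,9) by blast
  have fS: "finite S" using finSAB(2) SB by simp
  have RS: "R - S = insert q SA" using SAB(1,2) SB qS by auto
  have SR: "S \<subseteq> R" "insert q SA \<subseteq> R" using SAB(1) SB by auto
  define Q where "Q = (\<lambda>\<sigma> \<tau>. \<Sum>x<2 ^ n. of_real (1 / 2 ^ n) * \<sigma>B x \<sigma> \<tau>)"
  define Q' where "Q' = (\<lambda>\<sigma> \<tau>. \<Sum>x<2 ^ n. of_real (1 / 2 ^ n) * ptrace d R S (proj (vx x)) \<sigma> \<tau>)"
  have psd: "psd (basis d T) (ptrace d R T (proj v))" for T v unfolding ptrace_proj by (rule psd_gram)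
  have tr: "(\<Sum>\<sigma>\<in>basis d T. Re (ptrace d R T (proj (vx x)) \<sigma> \<sigma>)) = 1" if "x < 2 ^ n" "T \<subseteq> R" for T x
    unfolding trace_ptrace_proj[OF that(2)] by (rule vx_norm[OF that(1)])
  have 1: "vn_entropy d SB Q \<le> vn_entropy d S Q' + 1"
    unfolding SB
  proof (rule qubit_subadditivity[where q = q and d = d, OF qS d_vals(3) fS])
    show "psd (basis d (insert q S)) Q" unfolding SB[symmetric]
      by (rule psd_lincomb[where I = "{..<2 ^ n}" and w = "\<lambda>_. 1 / 2 ^ n" and R = \<sigma>B]) (use psd in \<open>auto simp: Q_def \<sigma>B_def\<close>)
    have "(\<Sum>\<sigma>\<in>basis d SB. Re (Q \<sigma> \<sigma>)) = (\<Sum>x<2 ^ n. (1 / 2 ^ n) * (\<Sum>\<sigma>\<in>basis d SB. Re (\<sigma>B x \<sigma> \<sigma>)))"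
      unfolding Q_def Re_sum sum_distrib_left by (subst sum.swap) (simp add: field_simps)
    thus "(\<Sum>\<sigma>\<in>basis d (insert q S). Re (Q \<sigma> \<sigma>)) = 1"
      unfolding SB[symmetric] using tr[OF _ SAB(6)] by (simp add: \<sigma>B_def)
    show "Q' \<sigma> \<tau> = (\<Sum>i<2. Q (\<sigma>(q := i)) (\<tau>(q := i)))" if "\<sigma> \<in> basis d S" "\<tau> \<in> basis d S" for \<sigma> \<tau>
      unfolding Q_def Q'_def \<sigma>B_def SB ptrace_insert[OF qR qS that] d_vals(3) sum_distrib_left
      by (rule sum.swap)
  qed
  have 2: "vn_entropy d S (ptrace d R S (proj (vx x))) \<le> vn_entropy d SB (\<sigma>B x) + 1" if x: "x < 2 ^ n" for x
  proof -
    have "vn_entropy d (insert q SA) (ptrace d R (insert q SA) (proj (vx x))) \<le> vn_entropy d SA (ptrace d R SA (proj (vx x))) + 1"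
      by (rule qubit_subadditivity[where q = q and d = d, OF SAB(12) d_vals(3) finSAB(1) psd tr[OF x SR(2)]])
        (simp only: ptrace_insert[OF qR SAB(12)] d_vals(3))
    thus ?thesis
      using vn_entropy_ptrace_complement[OF SR(1) fR, of d "vx x"] vn_entropy_ptrace_complement[OF SAB(6) fR, of d "vx x"]
      unfolding RS SAB(4) \<sigma>B_def by simp
  qed
  have "(\<Sum>x<2 ^ n. vn_entropy d S (ptrace d R S (proj (vx x)))) \<le> (\<Sum>x<2 ^ n. vn_entropy d SB (\<sigma>B x) + 1)"
    using 2 by (intro sum_mono) auto
  also have "\<dots> = (\<Sum>x<2 ^ n. vn_entropy d SB (\<sigma>B x)) + 2 ^ n" by (simp add: sum.distrib)
  finally have "(\<Sum>x<2 ^ n. vn_entropy d S (ptrace d R S (proj (vx x)))) / 2 ^ n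
    \<le> ((\<Sum>x<2 ^ n. vn_entropy d SB (\<sigma>B x)) + 2 ^ n) / 2 ^ n" by (intro divide_right_mono) auto
  also have "\<dots> = (\<Sum>x<2 ^ n. vn_entropy d SB (\<sigma>B x)) / 2 ^ n + 1" by (simp add: add_divide_distrib)
  finally show ?thesis using 1 unfolding loss_AB_eq S_def[symmetric] Q_def[symmetric] Q'_def[symmetric] by linarith
qed

end

section \<open>Bob's guess of a single bit\<close>

context setmemb_run
begin

lemma out_prob_eq:
  assumes "x < 2 ^ n" "y < n"
  shows "out_prob n n P x y b = (\<Sum>\<kappa>\<in>basis d W. if \<kappa> q = (if b then 1 else 0)
    then (cmod (\<phi> (\<kappa>(Yr := y, Xr := x))))\<^sup>2 else 0)"
proof -
  define c :: nat where "c = (if b then 1 else 0)"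
  define G where "G = (\<Sum>\<kappa>\<in>basis d W. if \<kappa> q = c then (cmod (\<phi> (\<kappa>(Yr := y, Xr := x))))\<^sup>2 else 0)"
  have fs: "final_state n n P x y \<sigma> = (if \<sigma> Xr = x \<and> \<sigma> Yr = y then \<phi> \<sigma> else 0)" for \<sigma>
    by (simp add: final_state_def run_init_state ket_def)
  have "out_prob n n P x y b = (\<Sum>\<sigma>\<in>basis d R. if \<sigma> q = c then (cmod (final_state n n P x y \<sigma>))\<^sup>2 else 0)"
    unfolding out_prob_def c_def[symmetric] by (rule sum.inter_filter[OF finite_basis[OF fR]])
  also have "\<dots> = (\<Sum>x'<2 ^ n. \<Sum>y'<n. \<Sum>\<kappa>\<in>basis d W. if (\<kappa>(Yr := y', Xr := x')) q = c
      then (cmod (final_state n n P x y (\<kappa>(Yr := y', Xr := x'))))\<^sup>2 else 0)"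
    by (rule sum_basis_allregs)
  also have "\<dots> = (\<Sum>x'<2 ^ n. if x' = x then \<Sum>y'<n. if y' = y then G else 0 else 0)"
  proof (rule sum.cong[OF refl])
    fix x'
    have "(\<Sum>\<kappa>\<in>basis d W. if (\<kappa>(Yr := y', Xr := x')) q = c
        then (cmod (final_state n n P x y (\<kappa>(Yr := y', Xr := x'))))\<^sup>2 else 0)
      = (if x' = x then if y' = y then G else 0 else 0)" for y'
      using q_neq workregs_not_input(3) unfolding G_def
      by (cases "x' = x"; cases "y' = y") (auto simp: fs intro!: sum.cong sum.neutral)
    thus "(\<Sum>y'<n. \<Sum>\<kappa>\<in>basis d W. if (\<kappa>(Yr := y', Xr := x')) q = c
        then (cmod (final_state n n P x y (\<kappa>(Yr := y', Xr := x'))))\<^sup>2 else 0)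
      = (if x' = x then \<Sum>y'<n. if y' = y then G else 0 else 0)"
      by (cases "x' = x") (simp_all only: if_True if_False sum.neutral_const refl simp_thms)
  qed
  also have "\<dots> = G"
    using assms by (simp only: sum.delta finite_lessThan lessThan_iff if_True)
  finally show ?thesis by (simp only: c_def G_def)
qed

definition D :: "nat \<Rightarrow> cfg \<Rightarrow> real" where "D j a = (if bit (a Xr) j then -1 else 1)"
definition z :: "cfg \<Rightarrow> real" where "z b = (if b q = 1 then -1 else 1)"

definition err :: "nat \<Rightarrow> real" where
  "err i = (\<Sum>x<2 ^ n. out_prob n n P x i (\<not> bit x i)) / 2 ^ n"

text \<open>The product of the signs \<open>D i\<close> and \<open>z\<close> is 1 exactly when the
  answer qubit shows the bit \<open>bit x i\<close>, and -1 otherwise.\<close>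

lemma advantage:
  assumes i: "i < n"
  shows "(\<Sum>a\<in>basis d SA. \<Sum>b\<in>basis d SB. D i a * z b * (cmod (\<Phi> i a b))\<^sup>2) = 1 - 2 * err i"
proof -
  have "(\<Sum>a\<in>basis d SA. \<Sum>b\<in>basis d SB. D i a * z b * (cmod (\<Phi> i a b))\<^sup>2)
    = (\<Sum>\<sigma>\<in>basis d R. (D i \<sigma> * z \<sigma>) * (cmod (wi i \<sigma>))\<^sup>2)"
    unfolding sum_SAB by (simp add: \<Phi>_def D_def z_def merge_vals)
  also have "\<dots> = (\<Sum>x<2 ^ n. \<Sum>\<kappa>\<in>basis d W. (D i (\<kappa>(Yr := i, Xr := x)) * z (\<kappa>(Yr := i, Xr := x))) *
      (cmod (\<phi> (\<kappa>(Yr := i, Xr := x))))\<^sup>2) / 2 ^ n"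
    by (rule wi_sum[OF i])
  also have "(\<Sum>x<2 ^ n. \<Sum>\<kappa>\<in>basis d W. (D i (\<kappa>(Yr := i, Xr := x)) * z (\<kappa>(Yr := i, Xr := x))) *
      (cmod (\<phi> (\<kappa>(Yr := i, Xr := x))))\<^sup>2) = (\<Sum>x<2 ^ n. 1 - 2 * out_prob n n P x i (\<not> bit x i))"
  proof (rule sum.cong[OF refl])
    fix x :: nat assume "x \<in> {..<2 ^ n}" hence x: "x < 2 ^ n" by simp
    define g where "g \<kappa> = (cmod (\<phi> (\<kappa>(Yr := i, Xr := x))))\<^sup>2" for \<kappa>
    have "(D i (\<kappa>(Yr := i, Xr := x)) * z (\<kappa>(Yr := i, Xr := x))) * g \<kappa>
        = g \<kappa> - 2 * (if \<kappa> q = (if \<not> bit x i then 1 else 0) then g \<kappa> else 0)" if "\<kappa> \<in> basis d W" for \<kappa>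
    proof -
      have "\<kappa> q < 2" using that qW d_vals(3) by (auto simp: basis_def)
      hence "\<kappa> q = 0 \<or> \<kappa> q = 1" by auto
      thus ?thesis using q_neq by (auto simp: D_def z_def)
    qed
    hence "(\<Sum>\<kappa>\<in>basis d W. (D i (\<kappa>(Yr := i, Xr := x)) * z (\<kappa>(Yr := i, Xr := x))) * g \<kappa>)
       = (\<Sum>\<kappa>\<in>basis d W. g \<kappa>) - 2 * (\<Sum>\<kappa>\<in>basis d W. if \<kappa> q = (if \<not> bit x i then 1 else 0) then g \<kappa> else 0)"
      by (simp only: sum_subtractf sum_distrib_left cong: sum.cong)
    thus "(\<Sum>\<kappa>\<in>basis d W. (D i (\<kappa>(Yr := i, Xr := x)) * z (\<kappa>(Yr := i, Xr := x))) *
      (cmod (\<phi> (\<kappa>(Yr := i, Xr := x))))\<^sup>2) = 1 - 2 * out_prob n n P x i (\<not> bit x i)"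
      unfolding out_prob_eq[OF x i] g_def final_amp_norm[OF valid x i] .
  qed
  also have "\<dots> / 2 ^ n = 1 - 2 * err i"
    by (simp add: err_def sum_subtractf sum_distrib_left[symmetric] diff_divide_distrib)
  finally show ?thesis .
qed

lemma err_nonneg: "i < n \<Longrightarrow> 0 \<le> err i"
  unfolding err_def by (intro divide_nonneg_nonneg sum_nonneg) (auto simp: out_prob_eq intro!: sum_nonneg)

lemma sum_err:
  "(\<Sum>i<n. err i) = real n * dist_error n n P setmemb (\<lambda>x i. 1 / (2 ^ n * real n))"
proof -
  have "real n * dist_error n n P setmemb (\<lambda>x i. 1 / (2 ^ n * real n))
      = (\<Sum>x<2 ^ n. \<Sum>i<n. out_prob n n P x i (\<not> bit x i) / 2 ^ n)"
    unfolding dist_error_def setmemb_def sum_distrib_left using n1 by simp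
  also have "\<dots> = (\<Sum>i<n. err i)" unfolding err_def sum_divide_distrib by (rule sum.swap)
  finally show ?thesis by simp
qed

definition N :: "nat \<Rightarrow> cfg \<Rightarrow> cfg \<Rightarrow> complex" where
  "N j b b' = (\<Sum>a\<in>basis d SA. of_real (D j a) * V a b * cnj (V a b'))"

lemma N_hermitian: "hermitian_on (basis d SB) (N j)"
  by (auto simp: hermitian_on_def N_def mult_ac)

text \<open>Alice's register \<open>Xr\<close> is traced out, so only equal values of x survive. For
  \<open>j < n\<close>, \<open>N j\<close> is half the difference of Bob's average states for the
  two values of bit \<open>j\<close>, and its trace norm is the bias of the best guess of this
  bit.\<close>

lemma N_eq:
  assumes b: "b \<in> basis d SB" "b' \<in> basis d SB"
  shows "N j b b' = (\<Sum>x<2 ^ n. of_real ((if bit x j then -1 else 1) / 2 ^ n) * \<sigma>B x b b')"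
proof -
  define G where "G a = \<phi> (merge SA a b) * cnj (\<phi> (merge SA a b'))" for a
  have t: "of_real ((if bit x j then -1 else 1) / 2 ^ n) * (vx x (merge SB b a) * cnj (vx x (merge SB b' a)))
     = (if x = a Xr then of_real (D j a / (real n * 2 ^ n)) * G a else 0)" if a: "a \<in> basis d SA" for x a
  proof (cases "x = a Xr")
    case True
    have "vx x (merge SB b a) * cnj (vx x (merge SB b' a)) = of_real \<bar>1 / real n\<bar> * G a"
      unfolding merge_swap[OF a b(1) SAB(2)] merge_swap[OF a b(2) SAB(2)] vx merge_vals True G_def
      by (simp only: refl if_True sqrt_prod)
    thus ?thesis using True by (simp add: D_def)
  next
    case False
    thus ?thesis unfolding merge_swap[OF a b(1) SAB(2)] vx merge_vals by simp
  qed
  have "(\<Sum>x<2 ^ n. of_real ((if bit x j then -1 else 1) / 2 ^ n) * \<sigma>B x b b')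
     = (\<Sum>x<2 ^ n. \<Sum>a\<in>basis d SA. of_real ((if bit x j then -1 else 1) / 2 ^ n) * (vx x (merge SB b a) * cnj (vx x (merge SB b' a))))"
    unfolding \<sigma>B_def ptrace_proj SAB(4) gram_def sum_distrib_left ..
  also have "\<dots> = (\<Sum>a\<in>basis d SA. \<Sum>x<2 ^ n. if x = a Xr then of_real (D j a / (real n * 2 ^ n)) * G a else 0)"
    by (subst sum.swap) (simp only: t cong: sum.cong)
  also have "\<dots> = (\<Sum>a\<in>basis d SA. of_real (D j a) * V a b * cnj (V a b'))"
  proof (rule sum.cong[OF refl])
    fix a assume a: "a \<in> basis d SA"
    hence "a Xr < 2 ^ n" using SAB(7) d_vals(1) by (auto simp: basis_def)
    hence "(\<Sum>x<2 ^ n. if x = a Xr then of_real (D j a / (real n * 2 ^ n)) * G a else 0) = of_real (D j a / (real n * 2 ^ n)) * G a"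
      by simp
    also have "\<dots> = of_real (D j a) * (V a b * cnj (V a b'))"
      unfolding V_def sqrt_prod G_def[symmetric] by simp
    finally show "(\<Sum>x<2 ^ n. if x = a Xr then of_real (D j a / (real n * 2 ^ n)) * G a else 0)
      = of_real (D j a) * V a b * cnj (V a b')" by (simp only: mult.assoc)
  qed
  finally show ?thesis by (simp only: N_def)
qed

definition diagN :: "nat \<Rightarrow> (nat \<Rightarrow> cfg \<Rightarrow> complex) \<times> (nat \<Rightarrow> real)" where
  "diagN j = (SOME (e, l). spectral (basis d SB) (N j) {..<card (basis d SB)} e l)"

definition T :: "nat \<Rightarrow> real" where
  "T j = (\<Sum>l<card (basis d SB). \<bar>snd (diagN j) l\<bar>)"

lemma diagN: "spectral (basis d SB) (N j) {..<card (basis d SB)} (fst (diagN j)) (snd (diagN j))"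
proof -
  obtain e l where sp: "spectral (basis d SB) (N j) {..<card (basis d SB)} e l"
    using spectral_exists[OF finB(2) N_hermitian] by blast
  have "case diagN j of (e, l) \<Rightarrow> spectral (basis d SB) (N j) {..<card (basis d SB)} e l"
    unfolding diagN_def by (rule someI[where x = "(e, l)"]) (simp add: sp)
  thus ?thesis by (simp only: split_beta)
qed

text \<open>The Helstrom measurement: measuring in the eigenbasis of \<open>N j\<close> and
  reporting the sign of the eigenvalue attains the bias \<open>T j\<close>. These measurements are
  fed into the chain rule.\<close>

lemma sum_T_le: "(\<Sum>j<n. (T j)\<^sup>2 / 8) \<le> lossA + 2"
proof -
  let ?C = "{..<card (basis d SB)}"
  define g where "g j l \<longleftrightarrow> 0 \<le> snd (diagN j) l" for j l
  have psd: "psd (basis d SB) (\<sigma>B x)" for x unfolding \<sigma>B_def ptrace_proj by (rule psd_gram)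
  have tr: "(\<Sum>a\<in>basis d SB. Re (\<sigma>B x a a)) = 1" if "x < 2 ^ n" for x
    unfolding \<sigma>B_def trace_ptrace_proj[OF SAB(6)] by (rule vx_norm[OF that])
  have ob: "onb (basis d SB) ?C (fst (diagN j))" for j using diagN[of j] by (simp add: spectral_def)
  have T: "(\<Sum>x<2 ^ n. (if bit x j then -1 else 1) *
      (\<Sum>l\<in>?C. (if g j l then 1 else -1) * expct (basis d SB) (\<sigma>B x) (fst (diagN j) l))) / 2 ^ n = T j" for j
  proof -
    have "(\<Sum>x<2 ^ n. (if bit x j then -1 else 1) *
      (\<Sum>l\<in>?C. (if g j l then 1 else -1) * expct (basis d SB) (\<sigma>B x) (fst (diagN j) l))) / 2 ^ n
      = (\<Sum>x<2 ^ n. \<Sum>l\<in>?C. (if g j l then 1 else -1) *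
         ((if bit x j then -1 else 1) / 2 ^ n * expct (basis d SB) (\<sigma>B x) (fst (diagN j) l)))"
      unfolding sum_divide_distrib sum_distrib_left by (intro sum.cong refl) simp
    also have "\<dots> = (\<Sum>l\<in>?C. (if g j l then 1 else -1) *
         (\<Sum>x<2 ^ n. (if bit x j then -1 else 1) / 2 ^ n * expct (basis d SB) (\<sigma>B x) (fst (diagN j) l)))"
      unfolding sum_distrib_left by (rule sum.swap)
    also have "\<dots> = (\<Sum>l\<in>?C. (if g j l then 1 else -1) * snd (diagN j) l)"
    proof (rule sum.cong[OF refl])
      fix l assume l: "l \<in> ?C"
      have "(\<Sum>x<2 ^ n. (if bit x j then -1 else 1) / 2 ^ n * expct (basis d SB) (\<sigma>B x) (fst (diagN j) l))
        = expct (basis d SB) (N j) (fst (diagN j) l)"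
        by (rule expct_lincomb[symmetric]) (rule N_eq)
      also have "\<dots> = snd (diagN j) l" by (rule expct_eigvec[OF diagN l])
      finally show "(if g j l then 1 else -1) * (\<Sum>x<2 ^ n. (if bit x j then -1 else 1) / 2 ^ n * expct (basis d SB) (\<sigma>B x) (fst (diagN j) l))
        = (if g j l then 1 else -1) * snd (diagN j) l" by simp
    qed
    also have "\<dots> = T j" unfolding T_def by (intro sum.cong refl) (auto simp: g_def)
    finally show ?thesis .
  qed
  have "(\<Sum>j<n. (T j)\<^sup>2 / 8) \<le> vn_entropy d SB (\<lambda>\<sigma> \<tau>. \<Sum>x<2 ^ n. of_real (1 / 2 ^ n) * \<sigma>B x \<sigma> \<tau>)
      - (\<Sum>x<2 ^ n. vn_entropy d SB (\<sigma>B x)) / 2 ^ n"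
    using chain_holevo[where n = n and \<sigma> = \<sigma>B and L = "\<lambda>_. ?C" and v = "\<lambda>j. fst (diagN j)" and g = g
        and Q = "\<lambda>\<sigma> \<tau>. \<Sum>x<2 ^ n. of_real (1 / 2 ^ n) * \<sigma>B x \<sigma> \<tau>", OF finB(2) psd tr ob refl]
    unfolding T .
  thus ?thesis using bob_holevo_le by linarith
qed

lemma T_lower:
  assumes i: "i < n" and f: "0 < f" "f \<le> 1 - 2 * err i"
    and kl: "\<And>m. onb (basis d SA) {..<card (basis d SA)} m \<Longrightarrow>
      measured_kl i m \<le> \<kappa>"
  shows "f\<^sup>2 / 2 * exp (- (2 * (\<kappa> + 1) / f\<^sup>2)) \<le> T i"
  unfolding T_def
proof (rule trace_norm_lower[where D = "D i" and z = z and e = "fst (diagN i)"])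
  show "spectral (basis d SB) (\<lambda>b b'. \<Sum>a\<in>basis d SA. of_real (D i a) * V a b * cnj (V a b'))
      {..<card (basis d SB)} (fst (diagN i)) (snd (diagN i))"
    using diagN[of i] by (simp add: N_def[abs_def])
  show "f \<le> (\<Sum>a\<in>basis d SA. \<Sum>c\<in>basis d SB. D i a * z c * (cmod (\<Phi> i a c))\<^sup>2)"
    unfolding advantage[OF i] by (rule f(2))
  show "expct (basis d SA) (gram (basis d SB) (\<Phi> i)) u = 0" if "expct (basis d SA) (gram (basis d SB) V) u = 0" for u
    by (rule expct_average_zero[OF gram_V psd_gram i that])
qed (use finB f trace_V trace_Phi[OF i] kl in \<open>auto simp: D_def z_def measured_kl_def\<close>)

end

section \<open>Markov-type averaging over Bob's inputs, and the numerical constants\<close>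

lemma few_large:
  fixes \<kappa> :: "nat \<Rightarrow> real"
  assumes "\<And>j. j < n \<Longrightarrow> 0 \<le> \<kappa> j" "(\<Sum>j<n. \<kappa> j) \<le> real n * K" "0 < \<theta>"
  shows "real (card {j. j < n \<and> \<theta> < \<kappa> j}) * \<theta> \<le> real n * K"
proof -
  let ?B = "{j. j < n \<and> \<theta> < \<kappa> j}"
  have "real (card ?B) * \<theta> = (\<Sum>j\<in>?B. \<theta>)" by simp
  also have "\<dots> \<le> (\<Sum>j\<in>?B. \<kappa> j)" by (intro sum_mono) auto
  also have "\<dots> \<le> (\<Sum>j<n. \<kappa> j)" using assms(1) by (intro sum_mono2) auto
  finally show ?thesis using assms(2) by simp
qed

text \<open>Values of at least \<open>\<epsilon>\<close> count for at most 1 each and the others for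
  less than \<open>\<epsilon>\<close>, so half of the mean \<open>2 * \<epsilon>\<close> has to come
  from the former.\<close>

lemma many_large:
  fixes f :: "nat \<Rightarrow> real"
  assumes "\<And>j. j < n \<Longrightarrow> f j \<le> 1" "real n * (2 * \<epsilon>) \<le> (\<Sum>j<n. f j)" "0 \<le> \<epsilon>"
  shows "real n * \<epsilon> \<le> real (card {j. j < n \<and> \<epsilon> \<le> f j})"
proof -
  let ?G = "{j. j < n \<and> \<epsilon> \<le> f j}"
  have "(\<Sum>j<n. f j) \<le> (\<Sum>j<n. (if \<epsilon> \<le> f j then 1 else 0) + \<epsilon>)"
    using assms(1,3) by (intro sum_mono) force
  also have "\<dots> = (\<Sum>j<n. if \<epsilon> \<le> f j then 1 else 0) + real n * \<epsilon>" by (simp add: sum.distrib)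
  also have "(\<Sum>j<n. if \<epsilon> \<le> f j then 1 else 0) = real (card ?G)"
    by (subst sum.inter_filter[symmetric]) auto
  finally show ?thesis using assms(2) by simp
qed

text \<open>In the exponent everything is measured in units of
  \<open>u = 1 / \<epsilon> ^ 3\<close>. From \<open>\<epsilon> \<le> 1 / 2\<close> one gets
  \<open>1 / \<epsilon> \<le> u / 4\<close>, \<open>1 / \<epsilon>\<^sup>2 \<le> u / 2\<close> and
  \<open>u \<ge> 8\<close>. Then \<open>2 * X\<close> costs \<open>8 K u + 10 u\<close>, the factor
  \<open>\<epsilon> ^ 5\<close> costs \<open>5 u / 4\<close>, and \<open>1 / 64\<close> costs
  \<open>6 ln 2\<close>, at most \<open>3 u / 4\<close>. The total is \<open>8 K u + 12 u\<close>,
  and \<open>12 \<le> 24 ln 2\<close>.\<close>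

lemma exponent_bound:
  fixes \<epsilon> K :: real
  assumes e: "0 < \<epsilon>" "\<epsilon> \<le> 1 / 2" and K: "0 \<le> K"
  shows "exp (- ((14 * K + 24 * ln 2) / \<epsilon> ^ 3))
    \<le> \<epsilon> / 2 * ((\<epsilon>\<^sup>2 / 2 * exp (- (2 * (2 * (K + 1) / \<epsilon> + 1) / \<epsilon>\<^sup>2)))\<^sup>2 / 8)"
proof -
  define X where "X = 2 * (2 * (K + 1) / \<epsilon> + 1) / \<epsilon>\<^sup>2"
  define u where "u = 1 / \<epsilon> ^ 3"
  have e2: "1 / \<epsilon>\<^sup>2 \<le> u / 2" using e by (simp add: u_def field_simps power2_eq_square power3_eq_cube)
  have e1: "1 / \<epsilon> \<le> u / 4"
  proof -
    have "1 / \<epsilon> \<le> (1 / \<epsilon>\<^sup>2) / 2" using e by (simp add: field_simps power2_eq_square)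
    thus ?thesis using e2 by simp
  qed
  have e0: "8 \<le> u"
  proof -
    have "2 \<le> 1 / \<epsilon>" using e by (simp add: field_simps)
    thus ?thesis using e1 by simp
  qed
  have l2: "1 / 2 \<le> ln (2::real)" "ln (2::real) \<le> 1"
    by (subst ln_ge_iff) (use exp_half_le2 ln_2_less_1 in auto)
  have "ln (1 / \<epsilon>) \<le> 1 / \<epsilon> - 1" using e by (intro ln_le_minus_one) simp
  hence le: "- ln \<epsilon> \<le> u / 4" using e1 e by (simp add: ln_div)
  have "2 * X = 8 * (K + 1) * u + 4 * (1 / \<epsilon>\<^sup>2)"
    using e by (simp add: X_def u_def field_simps power2_eq_square power3_eq_cube)
  also have "\<dots> \<le> 8 * (K + 1) * u + 2 * u" using e2 by simp
  finally have ex: "2 * X \<le> 8 * (K + 1) * u + 2 * u" .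
  have "\<epsilon> / 2 * ((\<epsilon>\<^sup>2 / 2 * exp (- X))\<^sup>2 / 8)
     = \<epsilon> ^ 5 / 64 * exp (- (2 * X))"
  proof -
    have "\<epsilon> / 2 * ((\<epsilon>\<^sup>2 / 2 * exp (- x))\<^sup>2 / 8) = \<epsilon> ^ 5 / 64 * exp (- (2 * x))" for x
      by (simp add: power_mult_distrib power_divide exp_of_nat_mult[symmetric] eval_nat_numeral exp_add[symmetric] del: exp_of_nat_mult)
    thus ?thesis by blast
  qed
  also have "\<epsilon> ^ 5 / 64 = exp (5 * ln \<epsilon> - 6 * ln 2)"
  proof -
    have "exp (5 * ln \<epsilon>) = \<epsilon> ^ 5" using e exp_of_nat_mult[of 5 "ln \<epsilon>"] by simp
    moreover have "exp (6 * ln 2) = (64 :: real)" using exp_of_nat_mult[of 6 "ln (2::real)"] by simp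
    ultimately show ?thesis by (simp add: exp_diff)
  qed
  also have "\<dots> * exp (- (2 * X))
     = exp (5 * ln \<epsilon> - 6 * ln 2 - 2 * X)"
    by (simp add: exp_add[symmetric])
  finally have eq: "\<epsilon> / 2 * ((\<epsilon>\<^sup>2 / 2 * exp (- X))\<^sup>2 / 8)
     = exp (5 * ln \<epsilon> - 6 * ln 2 - 2 * X)" .
  have 8: "8 * (K * u) \<le> 14 * (K * u)" using K e0 by simp
  have 12: "12 * u \<le> (24 * ln 2) * u" using l2 e0 by (intro mult_right_mono) auto
  have "8 * (K + 1) * u = 8 * (K * u) + 8 * u" "(14 * K + 24 * ln 2) * u = 14 * (K * u) + (24 * ln 2) * u"
    by (simp_all add: algebra_simps)
  hence "8 * (K + 1) * u + 2 * u + 5 * (u / 4) + 6 * ln 2 \<le> (14 * K + 24 * ln 2) * u"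
    using 8 12 l2 e0 by linarith
  hence "- ((14 * K + 24 * ln 2) * u) \<le> 5 * ln \<epsilon> - 6 * ln 2 - 2 * X"
    using ex le by linarith
  thus ?thesis unfolding X_def[symmetric] eq by (simp add: u_def)
qed

theorem theorem1:
  fixes n :: nat and \<epsilon> k :: real and P :: protocol
  assumes "n \<ge> 1"
    and "0 < \<epsilon>" and "\<epsilon> \<le> 1/2" and "k \<ge> 0"
    and "valid_protocol n n P"
    and "dist_error n n P setmemb (\<lambda>x i. 1 / (2 ^ n * real n)) \<le> 1/2 - \<epsilon>"
    and "loss_BA n n P (\<lambda>x. 1 / 2 ^ n) (\<lambda>i. 1 / real n) \<le> k"
  shows "loss_AB n n P (\<lambda>x. 1 / 2 ^ n) (\<lambda>i. 1 / real n)
           \<ge> real n / 2 powr (\<epsilon> powr (-3) * (14 * k + 24)) - 2"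
proof -
  interpret setmemb_run n P by unfold_locales (use assms in auto)
  \<comment> \<open>The loss bound \<open>k\<close> is in bits, the divergences
    \<open>\<kappa> i\<close> are in nats.\<close>
  define K where "K = ln 2 * k"
  have K: "0 \<le> K" using assms(4) by (simp add: K_def)
  \<comment> \<open>Markov threshold: if the mean divergence is at most \<open>K + 1\<close>, at
    most a fraction \<open>\<epsilon> / 2\<close> of Bob's inputs exceeds it. Using
    \<open>K + 1\<close> instead of \<open>K\<close> keeps the threshold positive when
    \<open>k = 0\<close>.\<close>
  define \<theta> where "\<theta> = 2 * (K + 1) / \<epsilon>"
  have \<theta>: "0 < \<theta>" using K assms(2) by (simp add: \<theta>_def)
  obtain \<kappa> where sum\<kappa>: "(\<Sum>i<n. \<kappa> i) = real n * (ln 2 * lossB)"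
    and \<kappa>0: "\<And>i. i < n \<Longrightarrow> 0 \<le> \<kappa> i"
    and kl: "\<And>i m. i < n \<Longrightarrow> onb (basis d SA) {..<card (basis d SA)} m \<Longrightarrow>
      measured_kl i m \<le> \<kappa> i"
    using alice_relative_entropy by blast
  have "(\<Sum>i<n. \<kappa> i) \<le> real n * (K + 1)"
    unfolding sum\<kappa> K_def using assms(7) by (intro mult_left_mono) (auto simp: add_increasing2)
  from few_large[OF \<kappa>0 this \<theta>]
  have "real (card {j. j < n \<and> \<theta> < \<kappa> j}) * (2 * (K + 1)) \<le> real n * (K + 1) * \<epsilon>"
    using assms(2) by (simp add: \<theta>_def field_simps)
  hence "(2 * real (card {j. j < n \<and> \<theta> < \<kappa> j})) * (K + 1) \<le> (real n * \<epsilon>) * (K + 1)"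
    by (simp only: mult_ac)
  from mult_right_le_imp_le[OF this] K
  have bad: "real (card {j. j < n \<and> \<theta> < \<kappa> j}) \<le> real n * \<epsilon> / 2" by simp
  have "real n * (2 * \<epsilon>) \<le> (\<Sum>i<n. 1 - 2 * err i)"
  proof -
    have "(\<Sum>i<n. err i) \<le> real n * (1 / 2 - \<epsilon>)"
      unfolding sum_err using assms(6) by (intro mult_left_mono) auto
    thus ?thesis by (simp add: sum_subtractf sum_distrib_left[symmetric] algebra_simps)
  qed
  hence good: "real n * \<epsilon> \<le> real (card {j. j < n \<and> \<epsilon> \<le> 1 - 2 * err j})"
    by (intro many_large) (use err_nonneg assms in auto)
  \<comment> \<open>Inputs with both a good advantage and a small divergence. At least
    \<open>n * \<epsilon>\<close> inputs have the first property and at most half as many violate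
    the second, so at least \<open>n * \<epsilon> / 2\<close> remain.\<close>
  define G where "G = {j. j < n \<and> \<epsilon> \<le> 1 - 2 * err j \<and> \<kappa> j \<le> \<theta>}"
  have "{j. j < n \<and> \<epsilon> \<le> 1 - 2 * err j} \<subseteq> G \<union> {j. j < n \<and> \<theta> < \<kappa> j}" by (auto simp: G_def)
  hence "card {j. j < n \<and> \<epsilon> \<le> 1 - 2 * err j} \<le> card (G \<union> {j. j < n \<and> \<theta> < \<kappa> j})"
    by (intro card_mono) (auto simp: G_def)
  also have "\<dots> \<le> card G + card {j. j < n \<and> \<theta> < \<kappa> j}" by (rule card_Un_le)
  finally have cG: "real n * (\<epsilon> / 2) \<le> real (card G)" using good bad by simp
  \<comment> \<open>The bound of \<open>T_lower\<close> at advantage \<open>\<epsilon>\<close> and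
    divergence \<open>\<theta>\<close>, the worst case allowed in \<open>G\<close>.\<close>
  define \<tau> where "\<tau> = \<epsilon>\<^sup>2 / 2 * exp (- (2 * (\<theta> + 1) / \<epsilon>\<^sup>2))"
  have \<tau>: "0 \<le> \<tau>" using assms(2) by (simp add: \<tau>_def)
  have TG: "\<tau> \<le> T j" if "j \<in> G" for j
    unfolding \<tau>_def using that assms(2) kl[of j]
    by (intro T_lower) (auto simp: G_def intro: order.trans)
  have "\<epsilon> powr (-3) = 1 / \<epsilon> ^ 3"
    using assms(2) powr_minus[of \<epsilon> 3] by (simp add: divide_inverse)
  hence "2 powr (\<epsilon> powr (-3) * (14 * k + 24)) = exp ((14 * K + 24 * ln 2) / \<epsilon> ^ 3)"
    by (simp add: powr_def K_def algebra_simps add_divide_distrib)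
  hence "real n / 2 powr (\<epsilon> powr (-3) * (14 * k + 24)) = real n * exp (- ((14 * K + 24 * ln 2) / \<epsilon> ^ 3))"
    by (simp add: exp_minus divide_inverse)
  also have "\<dots> \<le> real n * (\<epsilon> / 2 * (\<tau>\<^sup>2 / 8))"
    using exponent_bound[OF assms(2,3) K] unfolding \<tau>_def \<theta>_def by (intro mult_left_mono) auto
  also have "\<dots> = real n * (\<epsilon> / 2) * (\<tau>\<^sup>2 / 8)" by simp
  also have "\<dots> \<le> real (card G) * (\<tau>\<^sup>2 / 8)" using cG by (intro mult_right_mono) auto
  also have "\<dots> = (\<Sum>j\<in>G. \<tau>\<^sup>2 / 8)" by simp
  also have "\<dots> \<le> (\<Sum>j\<in>G. (T j)\<^sup>2 / 8)"
    using TG \<tau> by (intro sum_mono divide_right_mono power_mono) auto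
  also have "\<dots> \<le> (\<Sum>j<n. (T j)\<^sup>2 / 8)" by (intro sum_mono2) (auto simp: G_def)
  also note sum_T_le
  finally show ?thesis by simp
qed

end
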